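(* There is a bijective correspondence between restriction quantal frames and étale localic categories. Precisely, with the constructions $\mathcal C$ and $\mathcal O$ described in the context: every restriction quantal frame $Q$ is multiplicative and $\mathcal C(Q)$ is an étale localic category; for every étale localic category $C$, $\mathcal O(C)$ is a restriction quantal frame; and $Q=\mathcal O(\mathcal C(Q))$ and $C\cong\mathcal C(\mathcal O(C))$ for all such $Q$ and $C$.
   Context: **Restriction quantal frames.** An Ehresmann quantale is a unital quantale $Q$ (a complete lattice with an associative multiplication, with unit $e$, distributing over arbitrary joins on both sides; top element $1$), with maps $\lambda,\rho:Q\to e^{\downarrow}=\{a:a\le e\}$ that preserve arbitrary joins and satisfy: $\lambda(a)=\rho(a)=a$ for $a\le e$; $a=\rho(a)a=a\lambda(a)$; $\lambda(ab)=\lambda(\lambda(a)b)$ and $\rho(ab)=\rho(a\rho(b))$. It is an Ehresmann quantal frame if its underlying lattice is a frame. The natural order $\le'$ on $Q$ is: $a\le' b$ iff $a=gb=bf$ for some $f,g\le e$. An element $a$ is a partial isometry if $b\le a$ implies $b\le' a$. A restriction quantal frame is an Ehresmann quantal frame in which $1$ is a join of partial isometries and the set of partial isometries is closed under multiplication. **Locales.** A locale $X$ has frame $O(X)$; a locale map $f:X\to Y$ is given by a frame map $f^*:O(Y)\to O(X)$. It is semiopen if $f^*$ preserves arbitrary meets; then $f_!$ denotes the left adjoint of $f^*$. A semiopen $f$ is open if $f_!(a\wedge f^*(b))=f_!(a)\wedge b$ for all $a,b$. An open $f$ is étale (a local homeomorphism) if there is $B\subseteq O(X)$ with $\bigvee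 B=1$ such that for each $b\in B$ the map $O(Y)\to b^{\downarrow}$, $x\mapsto f^*(x)\wedge b$, is surjective. **Localic categories.** A localic category $C=(C_1,C_0,u,d,r,m)$ is an internal category in locales: $u:C_0\to C_1$, $d,r:C_1\to C_0$, $m:C_1\times_{C_0}C_1\to C_1$, where $C_1\times_{C_0}C_1$, with projections $\pi_1,\pi_2$, is the pullback determined by $d\pi_1=r\pi_2$, and $du=ru=\mathrm{id}$, $m(u\times \mathrm{id})=\pi_2$, $m(\mathrm{id}\times u)=\pi_1$, $r\pi_1=rm$, $d\pi_2=dm$, $m(\mathrm{id}\times m)=m(m\times\mathrm{id})$. The frame of $C_1\times_{C_0}C_1$ is the frame pushout $O(C_1)\otimes_{O(C_0)}O(C_1)$ of $d^*$ and $r^*$, generated by $a\otimes b=\pi_1^*(a)\wedge\pi_2^*(b)$. An étale localic category is a localic category with $u,m$ open and $d,r$ étale. **The construction $\mathcal C(Q)$.** For an Ehresmann quantal frame $Q$ put $O(C_1)=Q$, $O(C_0)=e^{\downarrow}$, $u^*(a)=a\wedge e$, $d^*(f)=1f$, $r^*(f)=f1$. Then $O(C_1\times_{C_0}C_1)$ is the tensor product $Q\otimes_{e^{\downarrow}}Q$ (relations $af\otimes b=a\otimes fb$, $f\le e$); the sup-map $a\otimes b\mapsto ab$ to $Q$ has right adjoint $m^*(a)=\bigvee_{xy\le a}x\otimes y$. $Q$ is multiplicative if $m^*$ preserves arbitrary joins; then $m^*$ defines $m$ and $\mathcal C(Q)=(C_1,C_0,u,d,r,m)$. **The construction $\mathcal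 O(C)$.** For a localic category $C$ with $d,r,u$ open and $m$ semiopen, $\mathcal O(C)$ is the frame $O(C_1)$ with multiplication $ab=m_!(a\otimes b)$, unit $e=u_!(1_{O(C_0)})$, $\lambda=u_!d_!$ and $\rho=u_!r_!$. *)

theory Defs
  imports "HOL-Algebra.Galois_Connection"
begin

section \<open>Frames and maps of locales\<close>

locale frame = complete_lattice L for L (structure) +
  assumes frame_distrib:
    "\<lbrakk>x \<in> carrier L; A \<subseteq> carrier L\<rbrakk> \<Longrightarrow> x \<sqinter> \<Squnion>A = \<Squnion>((\<lambda>a. x \<sqinter> a) ` A)"

definition preserves_sups :: "('a, 'm) gorder_scheme \<Rightarrow> ('b, 'n) gorder_scheme \<Rightarrow> ('a \<Rightarrow> 'b) \<Rightarrow> bool" where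
  "preserves_sups X Y h \<longleftrightarrow> h \<in> carrier X \<rightarrow> carrier Y \<and> sup_pres X Y h"

definition preserves_infs :: "('a, 'm) gorder_scheme \<Rightarrow> ('b, 'n) gorder_scheme \<Rightarrow> ('a \<Rightarrow> 'b) \<Rightarrow> bool" where
  "preserves_infs X Y h \<longleftrightarrow> h \<in> carrier X \<rightarrow> carrier Y \<and> inf_pres X Y h"

definition frame_map :: "('a, 'm) gorder_scheme \<Rightarrow> ('b, 'n) gorder_scheme \<Rightarrow> ('a \<Rightarrow> 'b) \<Rightarrow> bool" where
  "frame_map X Y h \<longleftrightarrow> preserves_sups X Y h \<and> h \<top>\<^bsub>X\<^esub> = \<top>\<^bsub>Y\<^esub> \<and> meet_pres X Y h"

text \<open>A locale is given by its frame of opens, and a map of locales \<open>X \<rightarrow> Y\<close> by its inverse image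
  map from the opens of \<open>Y\<close> to the opens of \<open>X\<close>. Below, \<open>X\<close> and \<open>Y\<close> stand for \<open>O(X)\<close> and \<open>O(Y)\<close>,
  and \<open>f\<close> stands for the inverse image map. Composition is therefore reversed, and maps
  of locales are equal when their inverse images agree on the carrier.\<close>

definition locale_map :: "'x gorder \<Rightarrow> 'y gorder \<Rightarrow> ('y \<Rightarrow> 'x) \<Rightarrow> bool" where
  "locale_map X Y f \<longleftrightarrow> frame X \<and> frame Y \<and> frame_map Y X f"

definition semiopen_map :: "'x gorder \<Rightarrow> 'y gorder \<Rightarrow> ('y \<Rightarrow> 'x) \<Rightarrow> bool" where
  "semiopen_map X Y f \<longleftrightarrow> locale_map X Y f \<and> preserves_infs Y X f"

text \<open>The left adjoint of the inverse image map of a semiopen map (lemma \<open>shriek_left_adjoint\<close>).\<close>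

definition shriek :: "'x gorder \<Rightarrow> 'y gorder \<Rightarrow> ('y \<Rightarrow> 'x) \<Rightarrow> 'x \<Rightarrow> 'y" where
  "shriek X Y f a = \<Sqinter>\<^bsub>Y\<^esub>{b \<in> carrier Y. a \<sqsubseteq>\<^bsub>X\<^esub> f b}"

lemma shriek_left_adjoint:
  assumes "semiopen_map X Y f"
  shows "galois_connection \<lparr>orderA = X, orderB = Y, lower = shriek X Y f, upper = f\<rparr>"
proof -
  have fr: "frame X" "frame Y" and fm: "f \<in> carrier Y \<rightarrow> carrier X" "inf_pres Y X f"
    "meet_pres Y X f"
    using assms by (auto simp: semiopen_map_def locale_map_def preserves_infs_def frame_map_def)
  interpret X: frame X by (rule fr)
  interpret Y: frame Y by (rule fr)
  have mono: "f b \<sqsubseteq>\<^bsub>X\<^esub> f c" if "b \<in> carrier Y" "c \<in> carrier Y" "b \<sqsubseteq>\<^bsub>Y\<^esub> c" for b c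
    using use_iso2[OF meet_pres_isotone[OF fm(1) fm(3)] that] .
  have adj: "shriek X Y f a \<sqsubseteq>\<^bsub>Y\<^esub> b \<longleftrightarrow> a \<sqsubseteq>\<^bsub>X\<^esub> f b" if ab: "a \<in> carrier X" "b \<in> carrier Y" for a b
  proof
    assume "a \<sqsubseteq>\<^bsub>X\<^esub> f b"
    then show "shriek X Y f a \<sqsubseteq>\<^bsub>Y\<^esub> b"
      unfolding shriek_def using ab by (intro Y.inf_lower) auto
  next
    let ?S = "{b \<in> carrier Y. a \<sqsubseteq>\<^bsub>X\<^esub> f b}"
    assume le: "shriek X Y f a \<sqsubseteq>\<^bsub>Y\<^esub> b"
    have S: "?S \<subseteq> carrier Y" by auto
    have "a \<sqsubseteq>\<^bsub>X\<^esub> \<Sqinter>\<^bsub>X\<^esub>(f ` ?S)"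
      using fm(1) ab by (intro X.inf_greatest) auto
    also have "\<Sqinter>\<^bsub>X\<^esub>(f ` ?S) = f (\<Sqinter>\<^bsub>Y\<^esub>?S)"
      using fm(2) S unfolding inf_pres_def by metis
    finally have 1: "a \<sqsubseteq>\<^bsub>X\<^esub> f (shriek X Y f a)" by (simp add: shriek_def)
    have 2: "shriek X Y f a \<in> carrier Y" using S by (simp add: shriek_def)
    have "f (shriek X Y f a) \<in> carrier X" "f b \<in> carrier X" using 2 ab fm(1) by auto
    then show "a \<sqsubseteq>\<^bsub>X\<^esub> f b"
      using X.le_trans[OF 1 mono[OF 2 ab(2) le] ab(1)] by blast
  qed
  have closed: "shriek X Y f a \<in> carrier Y" for a
    unfolding shriek_def by (rule Y.inf_closed) auto
  show ?thesis
    using fm(1) adj closed X.partial_order_axioms Y.partial_order_axioms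
    by (simp add: galois_connection_def galois_connection_axioms_def connection_def)
qed

definition open_map :: "'x gorder \<Rightarrow> 'y gorder \<Rightarrow> ('y \<Rightarrow> 'x) \<Rightarrow> bool" where
  "open_map X Y f \<longleftrightarrow> semiopen_map X Y f \<and>
     (\<forall>a\<in>carrier X. \<forall>b\<in>carrier Y. shriek X Y f (a \<sqinter>\<^bsub>X\<^esub> f b) = shriek X Y f a \<sqinter>\<^bsub>Y\<^esub> b)"

definition etale_map :: "'x gorder \<Rightarrow> 'y gorder \<Rightarrow> ('y \<Rightarrow> 'x) \<Rightarrow> bool" where
  "etale_map X Y f \<longleftrightarrow> open_map X Y f \<and>
     (\<exists>B. B \<subseteq> carrier X \<and> \<Squnion>\<^bsub>X\<^esub>B = \<top>\<^bsub>X\<^esub> \<and>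
        (\<forall>b\<in>B. (\<lambda>y. f y \<sqinter>\<^bsub>X\<^esub> b) ` carrier Y = {a \<in> carrier X. a \<sqsubseteq>\<^bsub>X\<^esub> b}))"


section \<open>Tensor products and pullbacks of locales\<close>

text \<open>The tensor product of the sup-lattices \<open>B\<close> and \<open>D\<close> modulo the relations
  \<open>x \<otimes> y = x' \<otimes> y'\<close>, for \<open>((x, y), (x', y')) \<in> R\<close>, is realised by the subsets \<open>I\<close> of \<open>B \<times> D\<close> whose
  membership predicate turns joins in each variable into conjunctions and respects \<open>R\<close>. Taking
  \<open>S\<close> to be empty or a pair, one sees that such \<open>I\<close> contain all \<open>(\<bottom>, y)\<close>, \<open>(x, \<bottom>)\<close> and are
  down-closed.\<close>

definition bi_ideal :: "('b, 'm) gorder_scheme \<Rightarrow> ('d, 'n) gorder_scheme \<Rightarrow>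
    (('b \<times> 'd) \<times> ('b \<times> 'd)) set \<Rightarrow> ('b \<times> 'd) set \<Rightarrow> bool" where
  "bi_ideal B D R I \<longleftrightarrow> I \<subseteq> carrier B \<times> carrier D \<and>
     (\<forall>S y. S \<subseteq> carrier B \<longrightarrow> y \<in> carrier D \<longrightarrow> ((\<Squnion>\<^bsub>B\<^esub>S, y) \<in> I \<longleftrightarrow> (\<forall>x\<in>S. (x, y) \<in> I))) \<and>
     (\<forall>x S. x \<in> carrier B \<longrightarrow> S \<subseteq> carrier D \<longrightarrow> ((x, \<Squnion>\<^bsub>D\<^esub>S) \<in> I \<longleftrightarrow> (\<forall>y\<in>S. (x, y) \<in> I))) \<and>
     (\<forall>(p, q)\<in>R. p \<in> I \<longleftrightarrow> q \<in> I)"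

definition tensor :: "('b, 'm) gorder_scheme \<Rightarrow> ('d, 'n) gorder_scheme \<Rightarrow>
    (('b \<times> 'd) \<times> ('b \<times> 'd)) set \<Rightarrow> ('b \<times> 'd) set gorder" where
  "tensor B D R = \<lparr>carrier = {I. bi_ideal B D R I}, eq = (=), le = (\<subseteq>)\<rparr>"

definition pure :: "('b, 'm) gorder_scheme \<Rightarrow> ('d, 'n) gorder_scheme \<Rightarrow>
    (('b \<times> 'd) \<times> ('b \<times> 'd)) set \<Rightarrow> 'b \<Rightarrow> 'd \<Rightarrow> ('b \<times> 'd) set" where
  "pure B D R x y = \<Inter>{I. bi_ideal B D R I \<and> (x, y) \<in> I}"

text \<open>The pullback of maps of locales \<open>f: B \<rightarrow> A\<close> and \<open>g: D \<rightarrow> A\<close>, that is, the pushout of the frame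
  maps \<open>f\<close> and \<open>g\<close>; its universal property is proved below.\<close>

definition pb_rel :: "'a gorder \<Rightarrow> 'b gorder \<Rightarrow> 'd gorder \<Rightarrow> ('a \<Rightarrow> 'b) \<Rightarrow> ('a \<Rightarrow> 'd) \<Rightarrow>
    (('b \<times> 'd) \<times> ('b \<times> 'd)) set" where
  "pb_rel A B D f g = {((x \<sqinter>\<^bsub>B\<^esub> f c, y), (x, g c \<sqinter>\<^bsub>D\<^esub> y)) | x y c.
     x \<in> carrier B \<and> y \<in> carrier D \<and> c \<in> carrier A}"

definition pullback :: "'a gorder \<Rightarrow> 'b gorder \<Rightarrow> 'd gorder \<Rightarrow> ('a \<Rightarrow> 'b) \<Rightarrow> ('a \<Rightarrow> 'd) \<Rightarrow>
    ('b \<times> 'd) set gorder" where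
  "pullback A B D f g = tensor B D (pb_rel A B D f g)"

definition proj1 :: "'a gorder \<Rightarrow> 'b gorder \<Rightarrow> 'd gorder \<Rightarrow> ('a \<Rightarrow> 'b) \<Rightarrow> ('a \<Rightarrow> 'd) \<Rightarrow>
    'b \<Rightarrow> ('b \<times> 'd) set" where
  "proj1 A B D f g x = pure B D (pb_rel A B D f g) x \<top>\<^bsub>D\<^esub>"

definition proj2 :: "'a gorder \<Rightarrow> 'b gorder \<Rightarrow> 'd gorder \<Rightarrow> ('a \<Rightarrow> 'b) \<Rightarrow> ('a \<Rightarrow> 'd) \<Rightarrow>
    'd \<Rightarrow> ('b \<times> 'd) set" where
  "proj2 A B D f g y = pure B D (pb_rel A B D f g) \<top>\<^bsub>B\<^esub> y"

text \<open>The map of locales from \<open>E\<close> into a pullback of \<open>B\<close> and \<open>D\<close> with components \<open>h: E \<rightarrow> B\<close> and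
  \<open>k: E \<rightarrow> D\<close>.\<close>

definition pairing :: "'e gorder \<Rightarrow> ('b \<Rightarrow> 'e) \<Rightarrow> ('d \<Rightarrow> 'e) \<Rightarrow> ('b \<times> 'd) set \<Rightarrow> 'e" where
  "pairing E h k I = \<Squnion>\<^bsub>E\<^esub>{h x \<sqinter>\<^bsub>E\<^esub> k y | x y. (x, y) \<in> I}"


subsection \<open>The tensor product is a complete lattice\<close>

locale sup_tensor = B: complete_lattice B + D: complete_lattice D
  for B :: "('b, 'm) gorder_scheme" and D :: "('d, 'n) gorder_scheme" +
  fixes R :: "(('b \<times> 'd) \<times> ('b \<times> 'd)) set"
  assumes R_sub: "R \<subseteq> (carrier B \<times> carrier D) \<times> (carrier B \<times> carrier D)"
begin

abbreviation "ideal \<equiv> bi_ideal B D R"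
abbreviation "T \<equiv> tensor B D R"

definition gen :: "('b \<times> 'd) set \<Rightarrow> ('b \<times> 'd) set" where
  "gen X = \<Inter>{I. ideal I \<and> X \<subseteq> I}"

lemma idealI:
  assumes "I \<subseteq> carrier B \<times> carrier D"
    "\<And>S y. S \<subseteq> carrier B \<Longrightarrow> y \<in> carrier D \<Longrightarrow> (\<Squnion>\<^bsub>B\<^esub>S, y) \<in> I \<longleftrightarrow> (\<forall>x\<in>S. (x, y) \<in> I)"
    "\<And>x S. x \<in> carrier B \<Longrightarrow> S \<subseteq> carrier D \<Longrightarrow> (x, \<Squnion>\<^bsub>D\<^esub>S) \<in> I \<longleftrightarrow> (\<forall>y\<in>S. (x, y) \<in> I)"
    "\<And>p q. (p, q) \<in> R \<Longrightarrow> p \<in> I \<longleftrightarrow> q \<in> I"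
  shows "ideal I"
proof -
  have "\<forall>(p, q)\<in>R. p \<in> I \<longleftrightarrow> q \<in> I" using assms(4) by fast
  then show ?thesis unfolding bi_ideal_def by (intro conjI allI impI assms(1-3))
qed

lemma ideal_carrier: "ideal I \<Longrightarrow> (x, y) \<in> I \<Longrightarrow> x \<in> carrier B \<and> y \<in> carrier D"
  unfolding bi_ideal_def by auto

lemma ideal_sup1: "ideal I \<Longrightarrow> S \<subseteq> carrier B \<Longrightarrow> y \<in> carrier D \<Longrightarrow>
    (\<Squnion>\<^bsub>B\<^esub>S, y) \<in> I \<longleftrightarrow> (\<forall>x\<in>S. (x, y) \<in> I)"
  unfolding bi_ideal_def by blast

lemma ideal_sup2: "ideal I \<Longrightarrow> x \<in> carrier B \<Longrightarrow> S \<subseteq> carrier D \<Longrightarrow>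
    (x, \<Squnion>\<^bsub>D\<^esub>S) \<in> I \<longleftrightarrow> (\<forall>y\<in>S. (x, y) \<in> I)"
  unfolding bi_ideal_def by blast

lemma ideal_R: "ideal I \<Longrightarrow> (p, q) \<in> R \<Longrightarrow> p \<in> I \<longleftrightarrow> q \<in> I"
  unfolding bi_ideal_def by blast

lemma ideal_down:
  assumes "ideal I" "(x, y) \<in> I" "x' \<in> carrier B" "y' \<in> carrier D" "x' \<sqsubseteq>\<^bsub>B\<^esub> x" "y' \<sqsubseteq>\<^bsub>D\<^esub> y"
  shows "(x', y') \<in> I"
proof -
  have c: "x \<in> carrier B" "y \<in> carrier D" using assms ideal_carrier by auto
  have "\<Squnion>\<^bsub>B\<^esub>{x', x} = x"
    using c assms by (intro B.le_antisym B.sup_least B.sup_upper) auto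
  then have "(\<Squnion>\<^bsub>B\<^esub>{x', x}, y) \<in> I" using assms by simp
  then have 1: "(x', y) \<in> I" using ideal_sup1[OF assms(1), of "{x', x}" y] c assms by auto
  have "\<Squnion>\<^bsub>D\<^esub>{y', y} = y"
    using c assms by (intro D.le_antisym D.sup_least D.sup_upper) auto
  then have "(x', \<Squnion>\<^bsub>D\<^esub>{y', y}) \<in> I" using 1 by simp
  then show ?thesis using ideal_sup2[OF assms(1), of x' "{y', y}"] c assms by auto
qed

lemma ideal_full: "ideal (carrier B \<times> carrier D)"
  by (rule idealI) (use R_sub in auto)

lemma ideal_Inter:
  assumes F: "\<And>I. I \<in> F \<Longrightarrow> ideal I" and ne: "F \<noteq> {}"
  shows "ideal (\<Inter>F)"
proof (rule idealI)
  show "\<Inter>F \<subseteq> carrier B \<times> carrier D"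
    using F ne ideal_carrier by fast
  show "(\<Squnion>\<^bsub>B\<^esub>S, y) \<in> \<Inter>F \<longleftrightarrow> (\<forall>x\<in>S. (x, y) \<in> \<Inter>F)" if "S \<subseteq> carrier B" "y \<in> carrier D" for S y
    unfolding Inter_iff using ideal_sup1[OF F that] by blast
  show "(x, \<Squnion>\<^bsub>D\<^esub>S) \<in> \<Inter>F \<longleftrightarrow> (\<forall>y\<in>S. (x, y) \<in> \<Inter>F)" if "x \<in> carrier B" "S \<subseteq> carrier D" for x S
    unfolding Inter_iff using ideal_sup2[OF F that] by blast
  show "p \<in> \<Inter>F \<longleftrightarrow> q \<in> \<Inter>F" if "(p, q) \<in> R" for p q
    unfolding Inter_iff using ideal_R[OF F that] by blast
qed

lemma ideal_gen: "X \<subseteq> carrier B \<times> carrier D \<Longrightarrow> ideal (gen X)"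
  unfolding gen_def by (rule ideal_Inter) (use ideal_full in auto)

lemma gen_upper: "X \<subseteq> gen X"
  unfolding gen_def by auto

lemma gen_least: "ideal I \<Longrightarrow> X \<subseteq> I \<Longrightarrow> gen X \<subseteq> I"
  unfolding gen_def by auto

lemma pure_gen: "pure B D R x y = gen {(x, y)}"
  unfolding pure_def gen_def by auto

lemma T_simps [simp]: "carrier T = {I. ideal I}" "I \<sqsubseteq>\<^bsub>T\<^esub> J \<longleftrightarrow> I \<subseteq> J" "I .=\<^bsub>T\<^esub> J \<longleftrightarrow> I = J"
  by (simp_all add: tensor_def)

lemma partial_order_T: "partial_order T"
  by unfold_locales (auto simp: tensor_def)

lemma Union_carrier: "F \<subseteq> carrier T \<Longrightarrow> \<Union>F \<subseteq> carrier B \<times> carrier D"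
  using ideal_carrier by (simp add: subset_iff) blast

lemma least_T:
  assumes F: "F \<subseteq> carrier T"
  shows "least T (gen (\<Union>F)) (Upper T F)"
proof -
  have g: "ideal (gen (\<Union>F))" by (rule ideal_gen[OF Union_carrier[OF F]])
  show ?thesis
    unfolding least_def
  proof (intro conjI ballI)
    show "Upper T F \<subseteq> carrier T" by (auto simp: Upper_def)
    show "gen (\<Union>F) \<in> Upper T F" using g gen_upper[of "\<Union>F"] by (simp add: Upper_def) blast
    fix J assume "J \<in> Upper T F"
    then have "ideal J" "\<Union>F \<subseteq> J" using F by (auto simp: Upper_def)
    then show "gen (\<Union>F) \<sqsubseteq>\<^bsub>T\<^esub> J" by (simp add: gen_least)
  qed
qed

lemma complete_T: "complete_lattice T"
proof -
  interpret partial_order T by (rule partial_order_T)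
  show ?thesis
  proof (rule complete_latticeI)
    fix F assume F: "F \<subseteq> carrier T"
    show "\<exists>s. is_lub T s F" using least_T[OF F] by auto
    let ?M = "\<Inter>(insert (carrier B \<times> carrier D) F)"
    have M: "ideal ?M" by (rule ideal_Inter) (use ideal_full F in auto)
    have "greatest T ?M (Lower T F)"
      unfolding greatest_def
    proof (intro conjI ballI)
      show "Lower T F \<subseteq> carrier T" by (auto simp: Lower_def)
      show "?M \<in> Lower T F" using M by (simp add: Lower_def) blast
      fix J assume J: "J \<in> Lower T F"
      then have "ideal J" "\<And>K. K \<in> F \<Longrightarrow> J \<subseteq> K" using F by (auto simp: Lower_def)
      moreover from this have "J \<subseteq> carrier B \<times> carrier D" by (simp add: bi_ideal_def)
      ultimately show "J \<sqsubseteq>\<^bsub>T\<^esub> ?M" by (simp add: le_Inf_iff)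
    qed
    then show "\<exists>i. is_glb T i F" by blast
  qed
qed

sublocale T: complete_lattice T by (rule complete_T)

lemma sup_T: "F \<subseteq> carrier T \<Longrightarrow> \<Squnion>\<^bsub>T\<^esub>F = gen (\<Union>F)"
  using T.least_unique[OF T.sup_lub least_T] .

lemma ideal_Int: "ideal I \<Longrightarrow> ideal J \<Longrightarrow> ideal (I \<inter> J)"
  using ideal_Inter[of "{I, J}"] by force

lemma meet_T:
  assumes "ideal I" "ideal J"
  shows "I \<sqinter>\<^bsub>T\<^esub> J = I \<inter> J"
proof -
  have c: "I \<in> carrier T" "J \<in> carrier T" "I \<inter> J \<in> carrier T"
    using assms ideal_Int by auto
  have "I \<inter> J \<sqsubseteq>\<^bsub>T\<^esub> I \<sqinter>\<^bsub>T\<^esub> J" by (rule T.meet_le) (use c in auto)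
  moreover have "I \<sqinter>\<^bsub>T\<^esub> J \<sqsubseteq>\<^bsub>T\<^esub> I" "I \<sqinter>\<^bsub>T\<^esub> J \<sqsubseteq>\<^bsub>T\<^esub> J"
    using T.meet_left[OF c(1,2)] T.meet_right[OF c(1,2)] by auto
  ultimately show ?thesis by (simp only: T_simps) blast
qed

lemma top_T: "\<top>\<^bsub>T\<^esub> = carrier B \<times> carrier D"
proof
  show "\<top>\<^bsub>T\<^esub> \<subseteq> carrier B \<times> carrier D"
    using T.top_closed by (simp add: bi_ideal_def)
  show "carrier B \<times> carrier D \<subseteq> \<top>\<^bsub>T\<^esub>"
    using T.top_higher[of "carrier B \<times> carrier D"] ideal_full by simp
qed

lemma ideal_pure: "x \<in> carrier B \<Longrightarrow> y \<in> carrier D \<Longrightarrow> ideal (pure B D R x y)"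
  by (simp add: pure_gen ideal_gen)

lemma pure_le: "ideal I \<Longrightarrow> pure B D R x y \<subseteq> I \<longleftrightarrow> (x, y) \<in> I"
  by (auto simp: pure_def)

lemma pure_family: "ideal I \<Longrightarrow> {pure B D R x y | x y. (x, y) \<in> I} \<subseteq> carrier T"
proof clarify
  fix x y assume "ideal I" "(x, y) \<in> I"
  then show "pure B D R x y \<in> carrier T" using ideal_pure ideal_carrier[of I x y] by simp
qed

lemma pure_mem: "(x, y) \<in> pure B D R x y"
  by (simp add: pure_def)

lemma ideal_eq_sup_pure:
  assumes I: "ideal I"
  shows "I = \<Squnion>\<^bsub>T\<^esub>{pure B D R x y | x y. (x, y) \<in> I}"
proof -
  let ?F = "{pure B D R x y | x y. (x, y) \<in> I}"
  have "K \<subseteq> I" if "K \<in> ?F" for K using that by (auto simp: pure_def I)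
  then have "gen (\<Union>?F) \<subseteq> I" by (intro gen_least[OF I] Union_least)
  moreover have "I \<subseteq> \<Union>?F" using pure_mem by fast
  then have "I \<subseteq> gen (\<Union>?F)" using gen_upper by (rule order_trans)
  ultimately show ?thesis using sup_T[OF pure_family[OF I]] by simp
qed

end


subsection \<open>The pullback is a pushout of frames\<close>

lemma frame_mapD:
  assumes "frame_map X Y h"
  shows "\<And>a. a \<in> carrier X \<Longrightarrow> h a \<in> carrier Y"
    "\<And>S. S \<subseteq> carrier X \<Longrightarrow> h (\<Squnion>\<^bsub>X\<^esub>S) = \<Squnion>\<^bsub>Y\<^esub>(h ` S)"
    "h \<top>\<^bsub>X\<^esub> = \<top>\<^bsub>Y\<^esub>"
    "\<And>a b. a \<in> carrier X \<Longrightarrow> b \<in> carrier X \<Longrightarrow> h (a \<sqinter>\<^bsub>X\<^esub> b) = h a \<sqinter>\<^bsub>Y\<^esub> h b"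
  using assms unfolding frame_map_def preserves_sups_def sup_pres_def meet_pres_def by auto

lemma frame_mapI:
  assumes "frame X" "frame Y" "\<And>a. a \<in> carrier X \<Longrightarrow> h a \<in> carrier Y"
    "\<And>S. S \<subseteq> carrier X \<Longrightarrow> h (\<Squnion>\<^bsub>X\<^esub>S) = \<Squnion>\<^bsub>Y\<^esub>(h ` S)"
    "h \<top>\<^bsub>X\<^esub> = \<top>\<^bsub>Y\<^esub>"
    "\<And>a b. a \<in> carrier X \<Longrightarrow> b \<in> carrier X \<Longrightarrow> h (a \<sqinter>\<^bsub>X\<^esub> b) = h a \<sqinter>\<^bsub>Y\<^esub> h b"
  shows "frame_map X Y h"
proof -
  interpret X: frame X by (rule assms)
  interpret Y: frame Y by (rule assms)
  show ?thesis
    using assms unfolding frame_map_def preserves_sups_def sup_pres_def meet_pres_def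
    by (auto simp: X.complete_lattice_axioms Y.complete_lattice_axioms X.lattice_axioms Y.lattice_axioms)
qed

lemma (in frame) frame_distrib': "\<lbrakk>x \<in> carrier L; A \<subseteq> carrier L\<rbrakk> \<Longrightarrow> \<Squnion>A \<sqinter> x = \<Squnion>((\<lambda>a. a \<sqinter> x) ` A)"
  using frame_distrib[of x A] by (simp add: meet_comm[of L])

lemma (in frame) meet_top [simp]: "x \<in> carrier L \<Longrightarrow> x \<sqinter> \<top> = x"
  using le_iff_join[of x \<top>, THEN iffD1, OF _ _ top_higher, symmetric] by simp

lemma (in frame) top_meet' [simp]: "x \<in> carrier L \<Longrightarrow> \<top> \<sqinter> x = x"
  using meet_top[of x] by (simp add: meet_comm[of L])

lemma (in frame) meet_idem [simp]: "x \<in> carrier L \<Longrightarrow> x \<sqinter> x = x"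
  using le_iff_join[of x x, THEN iffD1, OF _ _ le_refl, symmetric] by simp

locale frame_span = A: frame A + B: frame B + D: frame D
  for A :: "'a gorder" and B :: "'b gorder" and D :: "'d gorder" +
  fixes f :: "'a \<Rightarrow> 'b" and g :: "'a \<Rightarrow> 'd"
  assumes f_map: "frame_map A B f" and g_map: "frame_map A D g"
begin

abbreviation "R \<equiv> pb_rel A B D f g"
abbreviation "P \<equiv> pullback A B D f g"
abbreviation "p1 \<equiv> proj1 A B D f g"
abbreviation "p2 \<equiv> proj2 A B D f g"

sublocale sup_tensor B D "pb_rel A B D f g"
  using frame_mapD(1)[OF f_map] frame_mapD(1)[OF g_map]
  by unfold_locales (auto simp: pb_rel_def)

lemma pb_relI: "x \<in> carrier B \<Longrightarrow> y \<in> carrier D \<Longrightarrow> c \<in> carrier A \<Longrightarrow>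
    ((x \<sqinter>\<^bsub>B\<^esub> f c, y), (x, g c \<sqinter>\<^bsub>D\<^esub> y)) \<in> R"
  unfolding pb_rel_def by blast

lemma P_T: "P = tensor B D R"
  by (simp add: pullback_def)

lemma ideal_residual:
  assumes "ideal K" "I \<subseteq> carrier B \<times> carrier D"
  shows "ideal {(x, y). x \<in> carrier B \<and> y \<in> carrier D \<and> (\<forall>a b. (a, b) \<in> I \<longrightarrow> (x \<sqinter>\<^bsub>B\<^esub> a, y \<sqinter>\<^bsub>D\<^esub> b) \<in> K)}"
    (is "ideal ?H")
proof (rule idealI)
  show "?H \<subseteq> carrier B \<times> carrier D" by auto
next
  fix S y assume S: "S \<subseteq> carrier B" "y \<in> carrier D"
  have "(\<Squnion>\<^bsub>B\<^esub>S \<sqinter>\<^bsub>B\<^esub> a, y \<sqinter>\<^bsub>D\<^esub> b) \<in> K \<longleftrightarrow> (\<forall>x\<in>S. (x \<sqinter>\<^bsub>B\<^esub> a, y \<sqinter>\<^bsub>D\<^esub> b) \<in> K)"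
    if "(a, b) \<in> I" for a b
  proof -
    have ab: "a \<in> carrier B" "b \<in> carrier D" using that assms by auto
    have "(\<lambda>x. x \<sqinter>\<^bsub>B\<^esub> a) ` S \<subseteq> carrier B" using S ab by auto
    then show ?thesis using B.frame_distrib'[OF ab(1) S(1)] ideal_sup1[OF assms(1)] S ab by simp
  qed
  then show "(\<Squnion>\<^bsub>B\<^esub>S, y) \<in> ?H \<longleftrightarrow> (\<forall>x\<in>S. (x, y) \<in> ?H)"
    using S by (auto simp: subset_iff)
next
  fix x S assume S: "x \<in> carrier B" "S \<subseteq> carrier D"
  have "(x \<sqinter>\<^bsub>B\<^esub> a, \<Squnion>\<^bsub>D\<^esub>S \<sqinter>\<^bsub>D\<^esub> b) \<in> K \<longleftrightarrow> (\<forall>y\<in>S. (x \<sqinter>\<^bsub>B\<^esub> a, y \<sqinter>\<^bsub>D\<^esub> b) \<in> K)"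
    if "(a, b) \<in> I" for a b
  proof -
    have ab: "a \<in> carrier B" "b \<in> carrier D" using that assms by auto
    have "(\<lambda>y. y \<sqinter>\<^bsub>D\<^esub> b) ` S \<subseteq> carrier D" using S ab by auto
    then show ?thesis using D.frame_distrib'[OF ab(2) S(2)] ideal_sup2[OF assms(1)] S ab by simp
  qed
  then show "(x, \<Squnion>\<^bsub>D\<^esub>S) \<in> ?H \<longleftrightarrow> (\<forall>y\<in>S. (x, y) \<in> ?H)"
    using S by (auto simp: subset_iff)
next
  fix p q assume "(p, q) \<in> R"
  then obtain x y c where pq: "p = (x \<sqinter>\<^bsub>B\<^esub> f c, y)" "q = (x, g c \<sqinter>\<^bsub>D\<^esub> y)"
    and c: "x \<in> carrier B" "y \<in> carrier D" "c \<in> carrier A"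
    by (auto simp: pb_rel_def)
  have fg: "f c \<in> carrier B" "g c \<in> carrier D"
    using c frame_mapD(1)[OF f_map] frame_mapD(1)[OF g_map] by auto
  have "(x \<sqinter>\<^bsub>B\<^esub> f c \<sqinter>\<^bsub>B\<^esub> a, y \<sqinter>\<^bsub>D\<^esub> b) \<in> K \<longleftrightarrow> (x \<sqinter>\<^bsub>B\<^esub> a, g c \<sqinter>\<^bsub>D\<^esub> y \<sqinter>\<^bsub>D\<^esub> b) \<in> K"
    if "(a, b) \<in> I" for a b
  proof -
    have ab: "a \<in> carrier B" "b \<in> carrier D" using that assms by auto
    have "((x \<sqinter>\<^bsub>B\<^esub> a \<sqinter>\<^bsub>B\<^esub> f c, y \<sqinter>\<^bsub>D\<^esub> b), (x \<sqinter>\<^bsub>B\<^esub> a, g c \<sqinter>\<^bsub>D\<^esub> (y \<sqinter>\<^bsub>D\<^esub> b))) \<in> R"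
      using ab c by (intro pb_relI) auto
    moreover have "x \<sqinter>\<^bsub>B\<^esub> a \<sqinter>\<^bsub>B\<^esub> f c = x \<sqinter>\<^bsub>B\<^esub> f c \<sqinter>\<^bsub>B\<^esub> a"
      using ab c fg by (simp add: B.meet_assoc meet_comm[of B a])
    moreover have "g c \<sqinter>\<^bsub>D\<^esub> (y \<sqinter>\<^bsub>D\<^esub> b) = g c \<sqinter>\<^bsub>D\<^esub> y \<sqinter>\<^bsub>D\<^esub> b"
      using ab c fg by (simp add: D.meet_assoc)
    ultimately show ?thesis using ideal_R[OF assms(1)] by metis
  qed
  then show "p \<in> ?H \<longleftrightarrow> q \<in> ?H" using pq c fg by auto
qed

lemma gen_inter_subset:
  assumes "ideal I" "X \<subseteq> carrier B \<times> carrier D"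
  shows "I \<inter> gen X \<subseteq> gen {(a \<sqinter>\<^bsub>B\<^esub> x, b \<sqinter>\<^bsub>D\<^esub> y) | a b x y. (a, b) \<in> I \<and> (x, y) \<in> X}"
    (is "_ \<subseteq> gen ?Y")
proof -
  have "?Y \<subseteq> carrier B \<times> carrier D" using assms ideal_carrier by fastforce
  then have K: "ideal (gen ?Y)" by (rule ideal_gen)
  have I: "I \<subseteq> carrier B \<times> carrier D" using assms(1) ideal_carrier by auto
  let ?H = "{(x, y). x \<in> carrier B \<and> y \<in> carrier D \<and> (\<forall>a b. (a, b) \<in> I \<longrightarrow> (x \<sqinter>\<^bsub>B\<^esub> a, y \<sqinter>\<^bsub>D\<^esub> b) \<in> gen ?Y)}"
  have "X \<subseteq> ?H"
  proof clarify
    fix x y a b assume h: "(x, y) \<in> X"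
    have "(x \<sqinter>\<^bsub>B\<^esub> a, y \<sqinter>\<^bsub>D\<^esub> b) \<in> ?Y" if "(a, b) \<in> I" for a b
      using h that unfolding meet_comm[of B x] meet_comm[of D y] by blast
    then show "x \<in> carrier B \<and> y \<in> carrier D \<and> (\<forall>a b. (a, b) \<in> I \<longrightarrow> (x \<sqinter>\<^bsub>B\<^esub> a, y \<sqinter>\<^bsub>D\<^esub> b) \<in> gen ?Y)"
      using h assms(2) gen_upper by blast
  qed
  then have "gen X \<subseteq> ?H" by (rule gen_least[OF ideal_residual[OF K I]])
  show ?thesis
  proof (clarify)
    fix x y assume "(x, y) \<in> I" "(x, y) \<in> gen X"
    then have "(x \<sqinter>\<^bsub>B\<^esub> x, y \<sqinter>\<^bsub>D\<^esub> y) \<in> gen ?Y" "x \<in> carrier B" "y \<in> carrier D"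
      using \<open>gen X \<subseteq> ?H\<close> by auto
    then show "(x, y) \<in> gen ?Y"
      by simp
  qed
qed

lemma frame_P: "frame P"
  unfolding P_T
proof unfold_locales
  fix I F assume "I \<in> carrier T" and F: "F \<subseteq> carrier T"
  then have I: "ideal I" by simp
  have img: "(\<lambda>J. I \<sqinter>\<^bsub>T\<^esub> J) ` F = (\<lambda>J. I \<inter> J) ` F"
  proof (rule image_cong)
    fix J assume "J \<in> F"
    then have "ideal J" using F by auto
    then show "I \<sqinter>\<^bsub>T\<^esub> J = I \<inter> J" by (rule meet_T[OF I])
  qed simp
  have F': "(\<lambda>J. I \<inter> J) ` F \<subseteq> carrier T"
  proof
    fix K assume "K \<in> (\<lambda>J. I \<inter> J) ` F"
    then obtain J where "K = I \<inter> J" "J \<in> F" by auto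
    moreover from this have "ideal J" using F by auto
    ultimately show "K \<in> carrier T" using ideal_Int[OF I] by simp
  qed
  let ?Y = "{(a \<sqinter>\<^bsub>B\<^esub> x, b \<sqinter>\<^bsub>D\<^esub> y) | a b x y. (a, b) \<in> I \<and> (x, y) \<in> \<Union>F}"
  have Y: "?Y \<subseteq> \<Union>((\<lambda>J. I \<inter> J) ` F)"
  proof (clarify)
    fix a b x y J assume h: "(a, b) \<in> I" "J \<in> F" "(x, y) \<in> J"
    then have J: "ideal J" using F by auto
    have c: "a \<in> carrier B" "x \<in> carrier B" "b \<in> carrier D" "y \<in> carrier D"
      using h I J ideal_carrier by auto
    have "(a \<sqinter>\<^bsub>B\<^esub> x, b \<sqinter>\<^bsub>D\<^esub> y) \<in> I"
      using c by (intro ideal_down[OF I h(1)] B.meet_left D.meet_left) auto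
    moreover have "(a \<sqinter>\<^bsub>B\<^esub> x, b \<sqinter>\<^bsub>D\<^esub> y) \<in> J"
      using c by (intro ideal_down[OF J h(3)] B.meet_right D.meet_right) auto
    ultimately show "(a \<sqinter>\<^bsub>B\<^esub> x, b \<sqinter>\<^bsub>D\<^esub> y) \<in> \<Union>((\<lambda>J. I \<inter> J) ` F)" using h by auto
  qed
  have "I \<inter> gen (\<Union>F) \<subseteq> gen ?Y"
    by (rule gen_inter_subset[OF I Union_carrier[OF F]])
  also have "\<dots> \<subseteq> gen (\<Union>((\<lambda>J. I \<inter> J) ` F))"
    by (rule gen_least[OF ideal_gen[OF Union_carrier[OF F']] order_trans[OF Y gen_upper]])
  finally have 1: "I \<inter> gen (\<Union>F) \<subseteq> gen (\<Union>((\<lambda>J. I \<inter> J) ` F))" .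
  have "\<Union>((\<lambda>J. I \<inter> J) ` F) \<subseteq> I \<inter> gen (\<Union>F)" using gen_upper[of "\<Union>F"] by blast
  then have "gen (\<Union>((\<lambda>J. I \<inter> J) ` F)) \<subseteq> I \<inter> gen (\<Union>F)"
    by (rule gen_least[OF ideal_Int[OF I ideal_gen[OF Union_carrier[OF F]]]])
  with 1 have "I \<inter> gen (\<Union>F) = gen (\<Union>((\<lambda>J. I \<inter> J) ` F))" by (rule antisym)
  then show "I \<sqinter>\<^bsub>T\<^esub> \<Squnion>\<^bsub>T\<^esub>F = \<Squnion>\<^bsub>T\<^esub>((\<lambda>J. I \<sqinter>\<^bsub>T\<^esub> J) ` F)"
    using img sup_T[OF F] sup_T[OF F'] meet_T[OF I ideal_gen[OF Union_carrier[OF F]]] by simp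
qed

lemma pure_inter:
  assumes "x \<in> carrier B" "y \<in> carrier D" "x' \<in> carrier B" "y' \<in> carrier D"
  shows "pure B D R x y \<inter> pure B D R x' y' = pure B D R (x \<sqinter>\<^bsub>B\<^esub> x') (y \<sqinter>\<^bsub>D\<^esub> y')"
proof
  let ?K = "pure B D R (x \<sqinter>\<^bsub>B\<^esub> x') (y \<sqinter>\<^bsub>D\<^esub> y')"
  have I: "ideal (pure B D R x y)" "ideal (pure B D R x' y')"
    using assms by (simp_all add: ideal_pure)
  have K: "ideal ?K" using assms by (simp add: ideal_pure)
  let ?H = "{(u, v). u \<in> carrier B \<and> v \<in> carrier D \<and>
    (\<forall>a b. (a, b) \<in> {(x', y')} \<longrightarrow> (u \<sqinter>\<^bsub>B\<^esub> a, v \<sqinter>\<^bsub>D\<^esub> b) \<in> ?K)}"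
  have "ideal ?H" by (rule ideal_residual[OF K]) (simp add: assms)
  moreover have "(x, y) \<in> ?H" using assms pure_mem by simp
  ultimately have 1: "pure B D R x y \<subseteq> ?H" by (simp only: pure_le)
  let ?Y = "{(a \<sqinter>\<^bsub>B\<^esub> u, b \<sqinter>\<^bsub>D\<^esub> v) | a b u v. (a, b) \<in> pure B D R x y \<and> (u, v) \<in> {(x', y')}}"
  have "pure B D R x y \<inter> pure B D R x' y' \<subseteq> gen ?Y"
    unfolding pure_gen[of x' y'] by (rule gen_inter_subset[OF I(1)]) (simp add: assms)
  also have "gen ?Y \<subseteq> ?K"
  proof (rule gen_least[OF K], rule subsetI)
    fix z assume "z \<in> ?Y"
    then obtain a b where z: "z = (a \<sqinter>\<^bsub>B\<^esub> x', b \<sqinter>\<^bsub>D\<^esub> y')" "(a, b) \<in> pure B D R x y"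
      by auto
    have "(a, b) \<in> ?H" using z(2) 1 by (rule rev_subsetD)
    then show "z \<in> ?K" using z(1) by simp
  qed
  finally show "pure B D R x y \<inter> pure B D R x' y' \<subseteq> ?K" .
  have "(x \<sqinter>\<^bsub>B\<^esub> x', y \<sqinter>\<^bsub>D\<^esub> y') \<in> pure B D R x y"
    by (rule ideal_down[OF I(1) pure_mem]) (simp_all add: assms B.meet_left D.meet_left)
  moreover have "(x \<sqinter>\<^bsub>B\<^esub> x', y \<sqinter>\<^bsub>D\<^esub> y') \<in> pure B D R x' y'"
    by (rule ideal_down[OF I(2) pure_mem]) (simp_all add: assms B.meet_right D.meet_right)
  ultimately show "?K \<subseteq> pure B D R x y \<inter> pure B D R x' y'" using I pure_le by simp
qed

lemma pure_eq_meet: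
  assumes "x \<in> carrier B" "y \<in> carrier D"
  shows "pure B D R x y = p1 x \<sqinter>\<^bsub>P\<^esub> p2 y"
proof -
  have "ideal (p1 x)" "ideal (p2 y)" using assms by (simp_all add: proj1_def proj2_def ideal_pure)
  then have "p1 x \<sqinter>\<^bsub>P\<^esub> p2 y = p1 x \<inter> p2 y" unfolding P_T by (rule meet_T)
  also have "\<dots> = pure B D R (x \<sqinter>\<^bsub>B\<^esub> \<top>\<^bsub>B\<^esub>) (\<top>\<^bsub>D\<^esub> \<sqinter>\<^bsub>D\<^esub> y)"
    unfolding proj1_def proj2_def by (rule pure_inter) (simp_all add: assms)
  finally show ?thesis using assms by simp
qed

lemma p1_map: "frame_map B P p1"
proof (rule frame_mapI[OF B.frame_axioms frame_P])
  have ideal_p1: "ideal (p1 z)" if "z \<in> carrier B" for z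
    using that by (simp add: proj1_def ideal_pure)
  then show "p1 z \<in> carrier P" if "z \<in> carrier B" for z
    using that by (simp add: P_T)
  fix S assume S: "S \<subseteq> carrier B"
  have F: "p1 ` S \<subseteq> carrier T" using S ideal_p1 by auto
  let ?G = "gen (\<Union>(p1 ` S))" and ?s = "\<Squnion>\<^bsub>B\<^esub>S"
  have G: "ideal ?G" by (rule ideal_gen[OF Union_carrier[OF F]])
  have sc: "?s \<in> carrier B" by (rule B.sup_closed[OF S])
  have "(s, \<top>\<^bsub>D\<^esub>) \<in> ?G" if "s \<in> S" for s
    using that gen_upper[of "\<Union>(p1 ` S)"] pure_mem[of s "\<top>\<^bsub>D\<^esub>"] unfolding proj1_def by blast
  then have 1: "p1 ?s \<subseteq> ?G"
    using S G by (simp add: proj1_def pure_le ideal_sup1)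
  have "(?s, \<top>\<^bsub>D\<^esub>) \<in> p1 ?s" by (simp add: proj1_def pure_mem)
  then have "(s, \<top>\<^bsub>D\<^esub>) \<in> p1 ?s" if "s \<in> S" for s
    using ideal_sup1[OF ideal_p1[OF sc]] S that by simp
  then have "p1 s \<subseteq> p1 ?s" if "s \<in> S" for s
    using that by (simp add: proj1_def[of _ _ _ _ _ s] pure_le[OF ideal_p1[OF sc]])
  then have "?G \<subseteq> p1 ?s" by (intro gen_least[OF ideal_p1[OF sc]]) blast
  with 1 show "p1 ?s = \<Squnion>\<^bsub>P\<^esub>(p1 ` S)" using sup_T[OF F] by (simp add: P_T)
next
  have I: "ideal (p1 \<top>\<^bsub>B\<^esub>)" by (simp add: proj1_def ideal_pure)
  have "(\<top>\<^bsub>B\<^esub>, \<top>\<^bsub>D\<^esub>) \<in> p1 \<top>\<^bsub>B\<^esub>" by (simp add: proj1_def pure_mem)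
  then have "carrier B \<times> carrier D \<subseteq> p1 \<top>\<^bsub>B\<^esub>"
    using ideal_down[OF I, of "\<top>\<^bsub>B\<^esub>" "\<top>\<^bsub>D\<^esub>"] B.top_higher D.top_higher by (simp add: subset_iff)
  moreover have "p1 \<top>\<^bsub>B\<^esub> \<subseteq> carrier B \<times> carrier D" using I by (simp add: bi_ideal_def)
  ultimately show "p1 \<top>\<^bsub>B\<^esub> = \<top>\<^bsub>P\<^esub>" by (simp add: P_T top_T)
next
  fix a b assume ab: "a \<in> carrier B" "b \<in> carrier B"
  have "\<top>\<^bsub>D\<^esub> \<sqinter>\<^bsub>D\<^esub> \<top>\<^bsub>D\<^esub> = \<top>\<^bsub>D\<^esub>"
    by simp
  then show "p1 (a \<sqinter>\<^bsub>B\<^esub> b) = p1 a \<sqinter>\<^bsub>P\<^esub> p1 b"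
    using ab pure_inter[of a "\<top>\<^bsub>D\<^esub>" b "\<top>\<^bsub>D\<^esub>"] by (simp add: P_T proj1_def meet_T ideal_pure)
qed

lemma p2_map: "frame_map D P p2"
proof (rule frame_mapI[OF D.frame_axioms frame_P])
  have ideal_p2: "ideal (p2 z)" if "z \<in> carrier D" for z
    using that by (simp add: proj2_def ideal_pure)
  then show "p2 z \<in> carrier P" if "z \<in> carrier D" for z
    using that by (simp add: P_T)
  fix S assume S: "S \<subseteq> carrier D"
  have F: "p2 ` S \<subseteq> carrier T" using S ideal_p2 by auto
  let ?G = "gen (\<Union>(p2 ` S))" and ?s = "\<Squnion>\<^bsub>D\<^esub>S"
  have G: "ideal ?G" by (rule ideal_gen[OF Union_carrier[OF F]])
  have sc: "?s \<in> carrier D" by (rule D.sup_closed[OF S])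
  have "(\<top>\<^bsub>B\<^esub>, s) \<in> ?G" if "s \<in> S" for s
    using that gen_upper[of "\<Union>(p2 ` S)"] pure_mem[of "\<top>\<^bsub>B\<^esub>" s] unfolding proj2_def by blast
  then have 1: "p2 ?s \<subseteq> ?G"
    using S G by (simp add: proj2_def pure_le ideal_sup2)
  have "(\<top>\<^bsub>B\<^esub>, ?s) \<in> p2 ?s" by (simp add: proj2_def pure_mem)
  then have "(\<top>\<^bsub>B\<^esub>, s) \<in> p2 ?s" if "s \<in> S" for s
    using ideal_sup2[OF ideal_p2[OF sc]] S that by simp
  then have "p2 s \<subseteq> p2 ?s" if "s \<in> S" for s
    using that by (simp add: proj2_def[of _ _ _ _ _ s] pure_le[OF ideal_p2[OF sc]])
  then have "?G \<subseteq> p2 ?s" by (intro gen_least[OF ideal_p2[OF sc]]) blast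
  with 1 show "p2 ?s = \<Squnion>\<^bsub>P\<^esub>(p2 ` S)" using sup_T[OF F] by (simp add: P_T)
next
  have I: "ideal (p2 \<top>\<^bsub>D\<^esub>)" by (simp add: proj2_def ideal_pure)
  have "(\<top>\<^bsub>B\<^esub>, \<top>\<^bsub>D\<^esub>) \<in> p2 \<top>\<^bsub>D\<^esub>" by (simp add: proj2_def pure_mem)
  then have "carrier B \<times> carrier D \<subseteq> p2 \<top>\<^bsub>D\<^esub>"
    using ideal_down[OF I, of "\<top>\<^bsub>B\<^esub>" "\<top>\<^bsub>D\<^esub>"] B.top_higher D.top_higher by (simp add: subset_iff)
  moreover have "p2 \<top>\<^bsub>D\<^esub> \<subseteq> carrier B \<times> carrier D" using I by (simp add: bi_ideal_def)
  ultimately show "p2 \<top>\<^bsub>D\<^esub> = \<top>\<^bsub>P\<^esub>" by (simp add: P_T top_T)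
next
  fix a b assume ab: "a \<in> carrier D" "b \<in> carrier D"
  have "\<top>\<^bsub>B\<^esub> \<sqinter>\<^bsub>B\<^esub> \<top>\<^bsub>B\<^esub> = \<top>\<^bsub>B\<^esub>"
    by simp
  then show "p2 (a \<sqinter>\<^bsub>D\<^esub> b) = p2 a \<sqinter>\<^bsub>P\<^esub> p2 b"
    using ab pure_inter[of "\<top>\<^bsub>B\<^esub>" a "\<top>\<^bsub>B\<^esub>" b] by (simp add: P_T proj2_def meet_T ideal_pure)
qed

lemma square_commutes:
  assumes "c \<in> carrier A"
  shows "p1 (f c) = p2 (g c)"
proof -
  have fg: "f c \<in> carrier B" "g c \<in> carrier D"
    using assms frame_mapD(1)[OF f_map] frame_mapD(1)[OF g_map] by auto
  then have t: "\<top>\<^bsub>B\<^esub> \<sqinter>\<^bsub>B\<^esub> f c = f c" "g c \<sqinter>\<^bsub>D\<^esub> \<top>\<^bsub>D\<^esub> = g c"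
    by simp_all
  have "((\<top>\<^bsub>B\<^esub> \<sqinter>\<^bsub>B\<^esub> f c, \<top>\<^bsub>D\<^esub>), (\<top>\<^bsub>B\<^esub>, g c \<sqinter>\<^bsub>D\<^esub> \<top>\<^bsub>D\<^esub>)) \<in> R"
    using assms by (intro pb_relI) auto
  then have "(f c, \<top>\<^bsub>D\<^esub>) \<in> I \<longleftrightarrow> (\<top>\<^bsub>B\<^esub>, g c) \<in> I" if "ideal I" for I
    using that ideal_R t by metis
  then show ?thesis unfolding proj1_def proj2_def pure_def by metis
qed

context
  fixes E :: "'e gorder" and h :: "'b \<Rightarrow> 'e" and k :: "'d \<Rightarrow> 'e"
  assumes E: "frame E" and h: "frame_map B E h" and k: "frame_map D E k"
    and hk: "\<And>c. c \<in> carrier A \<Longrightarrow> h (f c) = k (g c)"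
begin

interpretation E: frame E by (rule E)

lemma ideal_below:
  assumes e: "e \<in> carrier E"
  shows "ideal {(x, y) \<in> carrier B \<times> carrier D. h x \<sqinter>\<^bsub>E\<^esub> k y \<sqsubseteq>\<^bsub>E\<^esub> e}" (is "ideal ?G")
proof (rule idealI)
  have sup_le: "\<Squnion>\<^bsub>E\<^esub>F \<sqsubseteq>\<^bsub>E\<^esub> e \<longleftrightarrow> (\<forall>z\<in>F. z \<sqsubseteq>\<^bsub>E\<^esub> e)" if F: "F \<subseteq> carrier E" for F
  proof
    show "\<Squnion>\<^bsub>E\<^esub>F \<sqsubseteq>\<^bsub>E\<^esub> e \<Longrightarrow> \<forall>z\<in>F. z \<sqsubseteq>\<^bsub>E\<^esub> e"
      using F e E.sup_upper[OF F] E.sup_closed[OF F] by (meson E.le_trans subsetD)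
    show "\<forall>z\<in>F. z \<sqsubseteq>\<^bsub>E\<^esub> e \<Longrightarrow> \<Squnion>\<^bsub>E\<^esub>F \<sqsubseteq>\<^bsub>E\<^esub> e" using E.sup_least[OF F e] by blast
  qed
  show "?G \<subseteq> carrier B \<times> carrier D" by auto
  fix S y assume S: "S \<subseteq> carrier B" "y \<in> carrier D"
  have "h ` S \<subseteq> carrier E" "(\<lambda>z. z \<sqinter>\<^bsub>E\<^esub> k y) ` h ` S \<subseteq> carrier E"
    using S frame_mapD(1)[OF h] frame_mapD(1)[OF k] by (auto intro!: E.meet_closed)
  then have "h (\<Squnion>\<^bsub>B\<^esub>S) \<sqinter>\<^bsub>E\<^esub> k y \<sqsubseteq>\<^bsub>E\<^esub> e \<longleftrightarrow> (\<forall>x\<in>S. h x \<sqinter>\<^bsub>E\<^esub> k y \<sqsubseteq>\<^bsub>E\<^esub> e)"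
    using S frame_mapD(2)[OF h S(1)] frame_mapD(1)[OF k S(2)] by (simp add: E.frame_distrib' sup_le)
  then show "(\<Squnion>\<^bsub>B\<^esub>S, y) \<in> ?G \<longleftrightarrow> (\<forall>x\<in>S. (x, y) \<in> ?G)" using S by auto
next
  have sup_le: "\<Squnion>\<^bsub>E\<^esub>F \<sqsubseteq>\<^bsub>E\<^esub> e \<longleftrightarrow> (\<forall>z\<in>F. z \<sqsubseteq>\<^bsub>E\<^esub> e)" if F: "F \<subseteq> carrier E" for F
  proof
    show "\<Squnion>\<^bsub>E\<^esub>F \<sqsubseteq>\<^bsub>E\<^esub> e \<Longrightarrow> \<forall>z\<in>F. z \<sqsubseteq>\<^bsub>E\<^esub> e"
      using F e E.sup_upper[OF F] E.sup_closed[OF F] by (meson E.le_trans subsetD)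
    show "\<forall>z\<in>F. z \<sqsubseteq>\<^bsub>E\<^esub> e \<Longrightarrow> \<Squnion>\<^bsub>E\<^esub>F \<sqsubseteq>\<^bsub>E\<^esub> e" using E.sup_least[OF F e] by blast
  qed
  fix x S assume S: "x \<in> carrier B" "S \<subseteq> carrier D"
  have "k ` S \<subseteq> carrier E" "(\<lambda>z. h x \<sqinter>\<^bsub>E\<^esub> z) ` k ` S \<subseteq> carrier E"
    using S frame_mapD(1)[OF h] frame_mapD(1)[OF k] by (auto intro!: E.meet_closed)
  then have "h x \<sqinter>\<^bsub>E\<^esub> k (\<Squnion>\<^bsub>D\<^esub>S) \<sqsubseteq>\<^bsub>E\<^esub> e \<longleftrightarrow> (\<forall>y\<in>S. h x \<sqinter>\<^bsub>E\<^esub> k y \<sqsubseteq>\<^bsub>E\<^esub> e)"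
    using S frame_mapD(2)[OF k S(2)] frame_mapD(1)[OF h S(1)] by (simp add: E.frame_distrib sup_le)
  then show "(x, \<Squnion>\<^bsub>D\<^esub>S) \<in> ?G \<longleftrightarrow> (\<forall>y\<in>S. (x, y) \<in> ?G)" using S by auto
next
  fix p q assume "(p, q) \<in> R"
  then obtain x y c where pq: "p = (x \<sqinter>\<^bsub>B\<^esub> f c, y)" "q = (x, g c \<sqinter>\<^bsub>D\<^esub> y)"
    and c: "x \<in> carrier B" "y \<in> carrier D" "c \<in> carrier A"
    by (auto simp: pb_rel_def)
  have fg: "f c \<in> carrier B" "g c \<in> carrier D"
    using c frame_mapD(1)[OF f_map] frame_mapD(1)[OF g_map] by auto
  have "h (x \<sqinter>\<^bsub>B\<^esub> f c) \<sqinter>\<^bsub>E\<^esub> k y = h x \<sqinter>\<^bsub>E\<^esub> k (g c \<sqinter>\<^bsub>D\<^esub> y)"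
    using c fg frame_mapD[OF h] frame_mapD[OF k] hk by (simp add: E.meet_assoc)
  then show "p \<in> ?G \<longleftrightarrow> q \<in> ?G" using pq c fg by auto
qed

lemma pairing_set: "ideal I \<Longrightarrow> {h x \<sqinter>\<^bsub>E\<^esub> k y | x y. (x, y) \<in> I} \<subseteq> carrier E"
  using frame_mapD(1)[OF h] frame_mapD(1)[OF k] by (auto dest!: ideal_carrier)

lemma pairing_closed: "ideal I \<Longrightarrow> pairing E h k I \<in> carrier E"
  unfolding pairing_def by (rule E.sup_closed[OF pairing_set])

lemma pairing_upper: "ideal I \<Longrightarrow> (x, y) \<in> I \<Longrightarrow> h x \<sqinter>\<^bsub>E\<^esub> k y \<sqsubseteq>\<^bsub>E\<^esub> pairing E h k I"
  unfolding pairing_def by (rule E.sup_upper[OF pairing_set]) auto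

lemma pairing_le_iff:
  assumes "ideal I" "e \<in> carrier E"
  shows "pairing E h k I \<sqsubseteq>\<^bsub>E\<^esub> e \<longleftrightarrow>
    I \<subseteq> {(x, y) \<in> carrier B \<times> carrier D. h x \<sqinter>\<^bsub>E\<^esub> k y \<sqsubseteq>\<^bsub>E\<^esub> e}" (is "_ \<longleftrightarrow> I \<subseteq> ?G")
proof
  assume le: "pairing E h k I \<sqsubseteq>\<^bsub>E\<^esub> e"
  show "I \<subseteq> ?G"
  proof
    fix p assume "p \<in> I"
    then obtain x y where p: "p = (x, y)" "(x, y) \<in> I" by (cases p) auto
    have c: "x \<in> carrier B" "y \<in> carrier D" using p assms ideal_carrier by auto
    have "h x \<sqinter>\<^bsub>E\<^esub> k y \<sqsubseteq>\<^bsub>E\<^esub> e"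
      using E.le_trans[OF pairing_upper[OF assms(1) p(2)] le] c pairing_closed[OF assms(1)] assms(2)
        frame_mapD(1)[OF h] frame_mapD(1)[OF k] by auto
    then show "p \<in> ?G" using p c by auto
  qed
next
  assume "I \<subseteq> ?G"
  then show "pairing E h k I \<sqsubseteq>\<^bsub>E\<^esub> e"
    unfolding pairing_def by (intro E.sup_least[OF pairing_set[OF assms(1)] assms(2)]) auto
qed

lemma pairing_mono:
  assumes "ideal I" "ideal J" "I \<subseteq> J"
  shows "pairing E h k I \<sqsubseteq>\<^bsub>E\<^esub> pairing E h k J"
proof -
  have c: "pairing E h k J \<in> carrier E" by (rule pairing_closed[OF assms(2)])
  have "pairing E h k J \<sqsubseteq>\<^bsub>E\<^esub> pairing E h k J" using c by simp
  then show ?thesis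
    unfolding pairing_le_iff[OF assms(1) c] pairing_le_iff[OF assms(2) c] by (rule order_trans[OF assms(3)])
qed

lemma pairing_pure:
  assumes "x \<in> carrier B" "y \<in> carrier D"
  shows "pairing E h k (pure B D R x y) = h x \<sqinter>\<^bsub>E\<^esub> k y"
proof (rule E.le_antisym)
  have c: "h x \<sqinter>\<^bsub>E\<^esub> k y \<in> carrier E"
    using assms frame_mapD(1)[OF h] frame_mapD(1)[OF k] by auto
  have I: "ideal (pure B D R x y)" using assms by (rule ideal_pure)
  show "pairing E h k (pure B D R x y) \<sqsubseteq>\<^bsub>E\<^esub> h x \<sqinter>\<^bsub>E\<^esub> k y"
    unfolding pairing_le_iff[OF I c] pure_le[OF ideal_below[OF c]] using assms c by simp
  show "h x \<sqinter>\<^bsub>E\<^esub> k y \<sqsubseteq>\<^bsub>E\<^esub> pairing E h k (pure B D R x y)"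
    by (rule pairing_upper[OF I]) (auto simp: pure_def)
  show "h x \<sqinter>\<^bsub>E\<^esub> k y \<in> carrier E" by (rule c)
  show "pairing E h k (pure B D R x y) \<in> carrier E" by (rule pairing_closed[OF I])
qed

lemma pairing_p1: "x \<in> carrier B \<Longrightarrow> pairing E h k (p1 x) = h x"
  using pairing_pure[of x "\<top>\<^bsub>D\<^esub>"] frame_mapD(1)[OF h] frame_mapD(3)[OF k]
  by (simp add: proj1_def)

lemma pairing_p2: "y \<in> carrier D \<Longrightarrow> pairing E h k (p2 y) = k y"
  using pairing_pure[of "\<top>\<^bsub>B\<^esub>" y] frame_mapD(1)[OF k] frame_mapD(3)[OF h]
  by (simp add: proj2_def)

lemma pairing_sup:
  assumes F: "F \<subseteq> carrier T"
  shows "pairing E h k (\<Squnion>\<^bsub>T\<^esub>F) = \<Squnion>\<^bsub>E\<^esub>(pairing E h k ` F)"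
proof -
  have I: "ideal (\<Squnion>\<^bsub>T\<^esub>F)" using T.sup_closed[OF F] by simp
  have img: "pairing E h k ` F \<subseteq> carrier E" using F pairing_closed by auto
  have up: "J \<subseteq> \<Squnion>\<^bsub>T\<^esub>F" if "J \<in> F" for J using T.sup_upper[OF F that] by simp
  show ?thesis
  proof (rule E.le_antisym)
    let ?e = "\<Squnion>\<^bsub>E\<^esub>(pairing E h k ` F)"
    have e: "?e \<in> carrier E" by (rule E.sup_closed[OF img])
    have "J \<subseteq> {(x, y) \<in> carrier B \<times> carrier D. h x \<sqinter>\<^bsub>E\<^esub> k y \<sqsubseteq>\<^bsub>E\<^esub> ?e}" if J: "J \<in> F" for J
    proof -
      have "ideal J" using J F by auto
      then show ?thesis
        using E.sup_upper[OF img imageI[OF J]] pairing_le_iff[of J ?e] e by blast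
    qed
    then have "\<Union>F \<subseteq> {(x, y) \<in> carrier B \<times> carrier D. h x \<sqinter>\<^bsub>E\<^esub> k y \<sqsubseteq>\<^bsub>E\<^esub> ?e}"
      by (rule Union_least)
    then have "\<Squnion>\<^bsub>T\<^esub>F \<subseteq> {(x, y) \<in> carrier B \<times> carrier D. h x \<sqinter>\<^bsub>E\<^esub> k y \<sqsubseteq>\<^bsub>E\<^esub> ?e}"
      unfolding sup_T[OF F] by (rule gen_least[OF ideal_below[OF e]])
    then show "pairing E h k (\<Squnion>\<^bsub>T\<^esub>F) \<sqsubseteq>\<^bsub>E\<^esub> ?e"
      unfolding pairing_le_iff[OF I e] .
    have "pairing E h k J \<sqsubseteq>\<^bsub>E\<^esub> pairing E h k (\<Squnion>\<^bsub>T\<^esub>F)" if "J \<in> F" for J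
      using that F by (intro pairing_mono I up) auto
    then show "?e \<sqsubseteq>\<^bsub>E\<^esub> pairing E h k (\<Squnion>\<^bsub>T\<^esub>F)"
      by (intro E.sup_least[OF img pairing_closed[OF I]]) auto
  qed (use I pairing_closed E.sup_closed[OF img] in auto)
qed

lemma pairing_meet:
  assumes "ideal I" "ideal J"
  shows "pairing E h k (I \<inter> J) = pairing E h k I \<sqinter>\<^bsub>E\<^esub> pairing E h k J"
proof (rule E.le_antisym)
  have IJ: "ideal (I \<inter> J)" using assms by (rule ideal_Int)
  let ?X = "\<lambda>I. {h x \<sqinter>\<^bsub>E\<^esub> k y | x y. (x, y) \<in> I}"
  note closed = pairing_closed[OF IJ] pairing_closed[OF assms(1)] pairing_closed[OF assms(2)]
  show "pairing E h k (I \<inter> J) \<sqsubseteq>\<^bsub>E\<^esub> pairing E h k I \<sqinter>\<^bsub>E\<^esub> pairing E h k J"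
    by (rule E.meet_le) (use closed IJ assms in \<open>auto intro: pairing_mono\<close>)
  have le: "(h x \<sqinter>\<^bsub>E\<^esub> k y) \<sqinter>\<^bsub>E\<^esub> (h x' \<sqinter>\<^bsub>E\<^esub> k y') \<sqsubseteq>\<^bsub>E\<^esub> pairing E h k (I \<inter> J)"
    if xy: "(x, y) \<in> I" "(x', y') \<in> J" for x y x' y'
  proof -
    have c: "x \<in> carrier B" "y \<in> carrier D" "x' \<in> carrier B" "y' \<in> carrier D"
      using xy assms ideal_carrier by auto
    have c': "h x \<in> carrier E" "k y \<in> carrier E" "h x' \<in> carrier E" "k y' \<in> carrier E"
      using c frame_mapD(1)[OF h] frame_mapD(1)[OF k] by auto
    have "(x \<sqinter>\<^bsub>B\<^esub> x', y \<sqinter>\<^bsub>D\<^esub> y') \<in> I \<inter> J"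
      using c xy ideal_down[OF assms(1)] ideal_down[OF assms(2)]
        B.meet_left B.meet_right D.meet_left D.meet_right by auto
    from pairing_upper[OF IJ this]
    have "(h x \<sqinter>\<^bsub>E\<^esub> h x') \<sqinter>\<^bsub>E\<^esub> (k y \<sqinter>\<^bsub>E\<^esub> k y') \<sqsubseteq>\<^bsub>E\<^esub> pairing E h k (I \<inter> J)"
      using c frame_mapD(4)[OF h] frame_mapD(4)[OF k] by simp
    moreover have "(h x \<sqinter>\<^bsub>E\<^esub> k y) \<sqinter>\<^bsub>E\<^esub> (h x' \<sqinter>\<^bsub>E\<^esub> k y') = (h x \<sqinter>\<^bsub>E\<^esub> h x') \<sqinter>\<^bsub>E\<^esub> (k y \<sqinter>\<^bsub>E\<^esub> k y')"
      using c' by (metis E.meet_assoc E.meet_closed meet_comm)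
    ultimately show ?thesis by simp
  qed
  have "pairing E h k I \<sqinter>\<^bsub>E\<^esub> z \<sqsubseteq>\<^bsub>E\<^esub> pairing E h k (I \<inter> J)" if z: "z \<in> ?X J" for z
  proof -
    have zc: "z \<in> carrier E" using z pairing_set[OF assms(2)] by blast
    have "(\<lambda>a. a \<sqinter>\<^bsub>E\<^esub> z) ` ?X I \<subseteq> carrier E"
      using subsetD[OF pairing_set[OF assms(1)]] zc by (intro image_subsetI E.meet_closed)
    then have "\<Squnion>\<^bsub>E\<^esub>((\<lambda>a. a \<sqinter>\<^bsub>E\<^esub> z) ` ?X I) \<sqsubseteq>\<^bsub>E\<^esub> pairing E h k (I \<inter> J)"
      by (rule E.sup_least[OF _ closed(1)]) (use le z in auto)
    then show ?thesis
      using E.frame_distrib'[OF zc pairing_set[OF assms(1)]] by (simp add: pairing_def[of _ _ _ I])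
  qed
  then have *: "w \<sqsubseteq>\<^bsub>E\<^esub> pairing E h k (I \<inter> J)"
    if "w \<in> (\<lambda>z. pairing E h k I \<sqinter>\<^bsub>E\<^esub> z) ` ?X J" for w
    using that by blast
  have "(\<lambda>z. pairing E h k I \<sqinter>\<^bsub>E\<^esub> z) ` ?X J \<subseteq> carrier E"
    using subsetD[OF pairing_set[OF assms(2)]] closed(2) by (intro image_subsetI E.meet_closed)
  then have "\<Squnion>\<^bsub>E\<^esub>((\<lambda>z. pairing E h k I \<sqinter>\<^bsub>E\<^esub> z) ` ?X J) \<sqsubseteq>\<^bsub>E\<^esub> pairing E h k (I \<inter> J)"
    by (rule E.sup_least[OF _ closed(1) *])
  then show "pairing E h k I \<sqinter>\<^bsub>E\<^esub> pairing E h k J \<sqsubseteq>\<^bsub>E\<^esub> pairing E h k (I \<inter> J)"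
    using E.frame_distrib[OF closed(2) pairing_set[OF assms(2)]] by (simp add: pairing_def[of _ _ _ J])
  show "pairing E h k (I \<inter> J) \<in> carrier E" by (rule closed)
  show "pairing E h k I \<sqinter>\<^bsub>E\<^esub> pairing E h k J \<in> carrier E" using closed by simp
qed

lemma pairing_map: "frame_map P E (pairing E h k)"
proof (rule frame_mapI[OF frame_P E])
  show "pairing E h k I \<in> carrier E" if "I \<in> carrier P" for I
    using that by (simp add: P_T pairing_closed)
  show "pairing E h k (\<Squnion>\<^bsub>P\<^esub>F) = \<Squnion>\<^bsub>E\<^esub>(pairing E h k ` F)" if "F \<subseteq> carrier P" for F
    using that unfolding P_T by (rule pairing_sup)
  show "pairing E h k \<top>\<^bsub>P\<^esub> = \<top>\<^bsub>E\<^esub>"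
    using pairing_p1[of "\<top>\<^bsub>B\<^esub>"] frame_mapD(3)[OF p1_map] frame_mapD(3)[OF h] by simp
  show "pairing E h k (I \<sqinter>\<^bsub>P\<^esub> J) = pairing E h k I \<sqinter>\<^bsub>E\<^esub> pairing E h k J"
    if "I \<in> carrier P" "J \<in> carrier P" for I J
    using that by (simp add: P_T meet_T pairing_meet)
qed

lemma pairing_unique:
  assumes w: "frame_map P E w" and w1: "\<And>x. x \<in> carrier B \<Longrightarrow> w (p1 x) = h x"
    and w2: "\<And>y. y \<in> carrier D \<Longrightarrow> w (p2 y) = k y" and I: "I \<in> carrier P"
  shows "w I = pairing E h k I"
proof -
  have I': "ideal I" using I by (simp add: P_T)
  let ?F = "{pure B D R x y | x y. (x, y) \<in> I}"
  have F: "?F \<subseteq> carrier P" using pure_family[OF I'] by (simp only: P_T)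
  have "w (pure B D R x y) = h x \<sqinter>\<^bsub>E\<^esub> k y" if "(x, y) \<in> I" for x y
  proof -
    have c: "x \<in> carrier B" "y \<in> carrier D" using that I' ideal_carrier by auto
    then show ?thesis
      using frame_mapD(4)[OF w] frame_mapD(1)[OF p1_map] frame_mapD(1)[OF p2_map] w1 w2
      by (simp add: pure_eq_meet)
  qed
  then have "w ` ?F = {h x \<sqinter>\<^bsub>E\<^esub> k y | x y. (x, y) \<in> I}" by (auto simp: image_iff) metis
  then have "w (\<Squnion>\<^bsub>P\<^esub>?F) = pairing E h k I"
    using frame_mapD(2)[OF w F] by (simp add: pairing_def)
  then show ?thesis using ideal_eq_sup_pure[OF I'] by (simp add: P_T)
qed

end

theorem pushout_universal:
  fixes E :: "'e gorder"
  assumes "frame E" "frame_map B E h" "frame_map D E k" "\<And>c. c \<in> carrier A \<Longrightarrow> h (f c) = k (g c)"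
  shows "frame_map P E (pairing E h k)"
    and "\<forall>x\<in>carrier B. pairing E h k (p1 x) = h x"
    and "\<forall>y\<in>carrier D. pairing E h k (p2 y) = k y"
    and "\<And>w. frame_map P E w \<Longrightarrow> \<forall>x\<in>carrier B. w (p1 x) = h x \<Longrightarrow>
          \<forall>y\<in>carrier D. w (p2 y) = k y \<Longrightarrow> \<forall>I\<in>carrier P. w I = pairing E h k I"
  using pairing_map[OF assms] pairing_p1[OF assms] pairing_p2[OF assms] pairing_unique[OF assms]
  by blast+

end


section \<open>Localic categories\<close>

text \<open>The frames \<open>O(C\<^sub>1)\<close> and \<open>O(C\<^sub>0)\<close> and the inverse images of the structure maps.\<close>

record ('a, 'b) localic_data =
  arrows :: "'a gorder"
  objects :: "'b gorder"
  ustar :: "'a \<Rightarrow> 'b"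
  dstar :: "'b \<Rightarrow> 'a"
  rstar :: "'b \<Rightarrow> 'a"
  mstar :: "'a \<Rightarrow> ('a \<times> 'a) set"

definition composable :: "('a, 'b) localic_data \<Rightarrow> ('a \<times> 'a) set gorder" where
  "composable C = pullback (objects C) (arrows C) (arrows C) (dstar C) (rstar C)"

definition pi1 :: "('a, 'b) localic_data \<Rightarrow> 'a \<Rightarrow> ('a \<times> 'a) set" where
  "pi1 C = proj1 (objects C) (arrows C) (arrows C) (dstar C) (rstar C)"

definition pi2 :: "('a, 'b) localic_data \<Rightarrow> 'a \<Rightarrow> ('a \<times> 'a) set" where
  "pi2 C = proj2 (objects C) (arrows C) (arrows C) (dstar C) (rstar C)"

text \<open>\<open>m(u \<times> id) = \<pi>\<^sub>2\<close> on the pullback of \<open>du = id\<close> and \<open>r\<close>.\<close>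

definition left_unit_law :: "('a, 'b) localic_data \<Rightarrow> bool" where
  "left_unit_law C \<longleftrightarrow>
     (let P = pullback (objects C) (objects C) (arrows C) id (rstar C);
          p1 = proj1 (objects C) (objects C) (arrows C) id (rstar C);
          p2 = proj2 (objects C) (objects C) (arrows C) id (rstar C)
      in \<forall>a\<in>carrier (arrows C). pairing P (p1 \<circ> ustar C) p2 (mstar C a) = p2 a)"

text \<open>\<open>m(id \<times> u) = \<pi>\<^sub>1\<close> on the pullback of \<open>d\<close> and \<open>ru = id\<close>.\<close>

definition right_unit_law :: "('a, 'b) localic_data \<Rightarrow> bool" where
  "right_unit_law C \<longleftrightarrow>
     (let P = pullback (objects C) (arrows C) (objects C) (dstar C) id;
          p1 = proj1 (objects C) (arrows C) (objects C) (dstar C) id;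
          p2 = proj2 (objects C) (arrows C) (objects C) (dstar C) id
      in \<forall>a\<in>carrier (arrows C). pairing P p1 (p2 \<circ> ustar C) (mstar C a) = p1 a)"

text \<open>\<open>m(id \<times> m) = m(m \<times> id)\<close>, where composable triples are taken in the form
  \<open>C\<^sub>1 \<times> (C\<^sub>1 \<times> C\<^sub>1)\<close> (pullback of \<open>d\<close> and \<open>r\<pi>\<^sub>1\<close>), so that
  \<open>id \<times> m = \<langle>p\<^sub>1, m p\<^sub>2\<rangle>\<close> and \<open>m \<times> id = \<langle>m\<langle>p\<^sub>1, \<pi>\<^sub>1 p\<^sub>2\<rangle>, \<pi>\<^sub>2 p\<^sub>2\<rangle>\<close>.\<close>

definition assoc_law :: "('a, 'b) localic_data \<Rightarrow> bool" where
  "assoc_law C \<longleftrightarrow>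
     (let T = pullback (objects C) (arrows C) (composable C) (dstar C) (pi1 C \<circ> rstar C);
          p1 = proj1 (objects C) (arrows C) (composable C) (dstar C) (pi1 C \<circ> rstar C);
          p2 = proj2 (objects C) (arrows C) (composable C) (dstar C) (pi1 C \<circ> rstar C)
      in \<forall>a\<in>carrier (arrows C).
           pairing T p1 (p2 \<circ> mstar C) (mstar C a) =
           pairing T (pairing T p1 (p2 \<circ> pi1 C) \<circ> mstar C) (p2 \<circ> pi2 C) (mstar C a))"

definition localic_category :: "('a, 'b) localic_data \<Rightarrow> bool" where
  "localic_category C \<longleftrightarrow>
     frame (arrows C) \<and> frame (objects C) \<and>
     locale_map (objects C) (arrows C) (ustar C) \<and>
     locale_map (arrows C) (objects C) (dstar C) \<and>
     locale_map (arrows C) (objects C) (rstar C) \<and>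
     locale_map (composable C) (arrows C) (mstar C) \<and>
     (\<forall>x\<in>carrier (objects C). ustar C (dstar C x) = x \<and> ustar C (rstar C x) = x) \<and>
     left_unit_law C \<and> right_unit_law C \<and>
     (\<forall>x\<in>carrier (objects C). pi1 C (rstar C x) = mstar C (rstar C x) \<and>
                              pi2 C (dstar C x) = mstar C (dstar C x)) \<and>
     assoc_law C"

definition etale_localic_category :: "('a, 'b) localic_data \<Rightarrow> bool" where
  "etale_localic_category C \<longleftrightarrow> localic_category C \<and>
     open_map (objects C) (arrows C) (ustar C) \<and>
     open_map (composable C) (arrows C) (mstar C) \<and>
     etale_map (arrows C) (objects C) (dstar C) \<and>
     etale_map (arrows C) (objects C) (rstar C)"

text \<open>Internal functors \<open>C \<rightarrow> D\<close>, with components \<open>F1: C\<^sub>1 \<rightarrow> D\<^sub>1\<close> and \<open>F0: C\<^sub>0 \<rightarrow> D\<^sub>0\<close> given by their inverse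
  images. The last clause is \<open>F1 m = m (F1 \<times> F1)\<close>.\<close>

definition localic_functor :: "('a, 'b) localic_data \<Rightarrow> ('c, 'd) localic_data \<Rightarrow>
    ('c \<Rightarrow> 'a) \<Rightarrow> ('d \<Rightarrow> 'b) \<Rightarrow> bool" where
  "localic_functor C D F1 F0 \<longleftrightarrow>
     locale_map (arrows C) (arrows D) F1 \<and> locale_map (objects C) (objects D) F0 \<and>
     (\<forall>a\<in>carrier (arrows D). ustar C (F1 a) = F0 (ustar D a)) \<and>
     (\<forall>x\<in>carrier (objects D). dstar C (F0 x) = F1 (dstar D x)) \<and>
     (\<forall>x\<in>carrier (objects D). rstar C (F0 x) = F1 (rstar D x)) \<and>
     (\<forall>a\<in>carrier (arrows D).
        mstar C (F1 a) = pairing (composable C) (pi1 C \<circ> F1) (pi2 C \<circ> F1) (mstar D a))"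

definition localic_isomorphic :: "('a, 'b) localic_data \<Rightarrow> ('c, 'd) localic_data \<Rightarrow> bool" where
  "localic_isomorphic C D \<longleftrightarrow>
     (\<exists>F1 F0 G1 G0. localic_functor C D F1 F0 \<and> localic_functor D C G1 G0 \<and>
        (\<forall>a\<in>carrier (arrows C). F1 (G1 a) = a) \<and> (\<forall>x\<in>carrier (objects C). F0 (G0 x) = x) \<and>
        (\<forall>a\<in>carrier (arrows D). G1 (F1 a) = a) \<and> (\<forall>x\<in>carrier (objects D). G0 (F0 x) = x))"


section \<open>Restriction quantal frames\<close>

record 'a quantale = "'a gorder" +
  qmult :: "'a \<Rightarrow> 'a \<Rightarrow> 'a" (infixl \<open>\<cdot>\<index>\<close> 75)
  qunit :: "'a" (\<open>\<e>\<index>\<close>)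

record 'a equantale = "'a quantale" +
  lam :: "'a \<Rightarrow> 'a"
  rho :: "'a \<Rightarrow> 'a"

locale unital_quantale = complete_lattice Q for Q (structure) +
  assumes qmult_closed: "\<lbrakk>a \<in> carrier Q; b \<in> carrier Q\<rbrakk> \<Longrightarrow> a \<cdot> b \<in> carrier Q"
    and qunit_closed: "\<e> \<in> carrier Q"
    and qmult_assoc: "\<lbrakk>a \<in> carrier Q; b \<in> carrier Q; c \<in> carrier Q\<rbrakk> \<Longrightarrow> (a \<cdot> b) \<cdot> c = a \<cdot> (b \<cdot> c)"
    and qunit_left: "a \<in> carrier Q \<Longrightarrow> \<e> \<cdot> a = a"
    and qunit_right: "a \<in> carrier Q \<Longrightarrow> a \<cdot> \<e> = a"
    and qmult_sup_left:
      "\<lbrakk>a \<in> carrier Q; S \<subseteq> carrier Q\<rbrakk> \<Longrightarrow> a \<cdot> \<Squnion>S = \<Squnion>((\<lambda>s. a \<cdot> s) ` S)"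
    and qmult_sup_right:
      "\<lbrakk>a \<in> carrier Q; S \<subseteq> carrier Q\<rbrakk> \<Longrightarrow> \<Squnion>S \<cdot> a = \<Squnion>((\<lambda>s. s \<cdot> a) ` S)"

definition down :: "('a, 'm) gorder_scheme \<Rightarrow> 'a \<Rightarrow> 'a gorder" where
  "down L x = \<lparr>carrier = {a \<in> carrier L. a \<sqsubseteq>\<^bsub>L\<^esub> x}, eq = eq L, le = le L\<rparr>"

locale ehresmann_quantale = unital_quantale Q for Q :: "('a, 'm) equantale_scheme" (structure) +
  assumes lam_sups: "preserves_sups Q (down Q \<e>) (lam Q)"
    and rho_sups: "preserves_sups Q (down Q \<e>) (rho Q)"
    and lam_proj: "\<lbrakk>a \<in> carrier Q; a \<sqsubseteq> \<e>\<rbrakk> \<Longrightarrow> lam Q a = a"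
    and rho_proj: "\<lbrakk>a \<in> carrier Q; a \<sqsubseteq> \<e>\<rbrakk> \<Longrightarrow> rho Q a = a"
    and rho_mult: "a \<in> carrier Q \<Longrightarrow> a = rho Q a \<cdot> a"
    and mult_lam: "a \<in> carrier Q \<Longrightarrow> a = a \<cdot> lam Q a"
    and lam_mult: "\<lbrakk>a \<in> carrier Q; b \<in> carrier Q\<rbrakk> \<Longrightarrow> lam Q (a \<cdot> b) = lam Q (lam Q a \<cdot> b)"
    and rho_mult_rho: "\<lbrakk>a \<in> carrier Q; b \<in> carrier Q\<rbrakk> \<Longrightarrow> rho Q (a \<cdot> b) = rho Q (a \<cdot> rho Q b)"

locale ehresmann_quantal_frame = ehresmann_quantale Q + frame Q
  for Q :: "('a, 'm) equantale_scheme" (structure)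

definition natural_le :: "('a, 'm) equantale_scheme \<Rightarrow> 'a \<Rightarrow> 'a \<Rightarrow> bool" where
  "natural_le Q a b \<longleftrightarrow>
     (\<exists>f g. f \<in> carrier Q \<and> g \<in> carrier Q \<and> f \<sqsubseteq>\<^bsub>Q\<^esub> \<e>\<^bsub>Q\<^esub> \<and> g \<sqsubseteq>\<^bsub>Q\<^esub> \<e>\<^bsub>Q\<^esub> \<and>
        a = g \<cdot>\<^bsub>Q\<^esub> b \<and> a = b \<cdot>\<^bsub>Q\<^esub> f)"

definition partial_isometries :: "('a, 'm) equantale_scheme \<Rightarrow> 'a set" where
  "partial_isometries Q =
     {a \<in> carrier Q. \<forall>b\<in>carrier Q. b \<sqsubseteq>\<^bsub>Q\<^esub> a \<longrightarrow> natural_le Q b a}"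

locale restriction_quantal_frame = ehresmann_quantal_frame Q
  for Q :: "('a, 'm) equantale_scheme" (structure) +
  assumes top_join: "\<exists>S. S \<subseteq> partial_isometries Q \<and> \<top> = \<Squnion>S"
    and partial_isometries_mult:
      "\<lbrakk>a \<in> partial_isometries Q; b \<in> partial_isometries Q\<rbrakk> \<Longrightarrow> a \<cdot> b \<in> partial_isometries Q"


section \<open>The two constructions\<close>

definition balanced_rel :: "('a, 'm) equantale_scheme \<Rightarrow> (('a \<times> 'a) \<times> ('a \<times> 'a)) set" where
  "balanced_rel Q = {((a \<cdot>\<^bsub>Q\<^esub> f, b), (a, f \<cdot>\<^bsub>Q\<^esub> b)) | a b f.
     a \<in> carrier Q \<and> b \<in> carrier Q \<and> f \<in> carrier Q \<and> f \<sqsubseteq>\<^bsub>Q\<^esub> \<e>\<^bsub>Q\<^esub>}"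

text \<open>The frame of \<open>C\<^sub>1 \<times> C\<^sub>1\<close> for \<open>\<C>(Q)\<close>; it coincides with the pullback used in the definition
  of a localic category (lemma \<open>composable_cat_of\<close>).\<close>

definition balanced_tensor :: "('a, 'm) equantale_scheme \<Rightarrow> ('a \<times> 'a) set gorder" where
  "balanced_tensor Q = tensor Q Q (balanced_rel Q)"

definition mult_adj :: "('a, 'm) equantale_scheme \<Rightarrow> 'a \<Rightarrow> ('a \<times> 'a) set" where
  "mult_adj Q a = \<Squnion>\<^bsub>balanced_tensor Q\<^esub>{pure Q Q (balanced_rel Q) x y | x y.
     x \<in> carrier Q \<and> y \<in> carrier Q \<and> x \<cdot>\<^bsub>Q\<^esub> y \<sqsubseteq>\<^bsub>Q\<^esub> a}"

definition multiplicative :: "('a, 'm) equantale_scheme \<Rightarrow> bool" where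
  "multiplicative Q \<longleftrightarrow> preserves_sups Q (balanced_tensor Q) (mult_adj Q)"

definition cat_of :: "'a equantale \<Rightarrow> ('a, 'a) localic_data" where
  "cat_of Q = \<lparr>arrows = gorder.truncate Q, objects = down Q \<e>\<^bsub>Q\<^esub>,
     ustar = (\<lambda>a. a \<sqinter>\<^bsub>Q\<^esub> \<e>\<^bsub>Q\<^esub>),
     dstar = (\<lambda>f. \<top>\<^bsub>Q\<^esub> \<cdot>\<^bsub>Q\<^esub> f),
     rstar = (\<lambda>f. f \<cdot>\<^bsub>Q\<^esub> \<top>\<^bsub>Q\<^esub>),
     mstar = mult_adj Q\<rparr>"

definition quantale_of :: "('a, 'b) localic_data \<Rightarrow> 'a equantale" where
  "quantale_of C = \<lparr>carrier = carrier (arrows C), eq = eq (arrows C), le = le (arrows C),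
     qmult = (\<lambda>a b. shriek (composable C) (arrows C) (mstar C)
                      (pi1 C a \<sqinter>\<^bsub>composable C\<^esub> pi2 C b)),
     qunit = shriek (objects C) (arrows C) (ustar C) \<top>\<^bsub>objects C\<^esub>,
     lam = (\<lambda>a. shriek (objects C) (arrows C) (ustar C)
                  (shriek (arrows C) (objects C) (dstar C) a)),
     rho = (\<lambda>a. shriek (objects C) (arrows C) (ustar C)
                  (shriek (arrows C) (objects C) (rstar C) a))\<rparr>"

text \<open>Equality of quantales: records may differ in irrelevant values outside the carrier.\<close>

definition same_quantale :: "'a equantale \<Rightarrow> 'a equantale \<Rightarrow> bool" where
  "same_quantale Q Q' \<longleftrightarrow> carrier Q = carrier Q' \<and>
     (\<forall>a\<in>carrier Q. \<forall>b\<in>carrier Q. (a \<sqsubseteq>\<^bsub>Q\<^esub> b \<longleftrightarrow> a \<sqsubseteq>\<^bsub>Q'\<^esub> b) \<and> a \<cdot>\<^bsub>Q\<^esub> b = a \<cdot>\<^bsub>Q'\<^esub> b) \<and>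
     \<e>\<^bsub>Q\<^esub> = \<e>\<^bsub>Q'\<^esub> \<and>
     (\<forall>a\<in>carrier Q. lam Q a = lam Q' a \<and> rho Q a = rho Q' a)"

subsection \<open>The tensor product over \<open>e\<down>\<close> is the pullback, and \<open>m*\<close> is right adjoint to \<open>a \<otimes> b \<mapsto> ab\<close>\<close>

lemma sup_truncate: "\<Squnion>\<^bsub>gorder.truncate Q\<^esub>S = \<Squnion>\<^bsub>Q\<^esub>S"
  by (simp add: sup_def least_def Upper_def gorder.truncate_def)

lemma meet_truncate: "x \<sqinter>\<^bsub>gorder.truncate Q\<^esub> y = x \<sqinter>\<^bsub>Q\<^esub> y"
  by (simp add: meet_def inf_def greatest_def Lower_def gorder.truncate_def)

lemma carrier_truncate: "carrier (gorder.truncate Q) = carrier Q"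
  by (simp add: gorder.truncate_def)

lemma (in unital_quantale) le_iff_sup: "x \<in> carrier Q \<Longrightarrow> y \<in> carrier Q \<Longrightarrow> x \<sqsubseteq> y \<Longrightarrow> \<Squnion>{x, y} = y"
  by (intro le_antisym sup_least sup_upper) auto

lemma (in unital_quantale) qmult_mono:
  assumes "x \<in> carrier Q" "x' \<in> carrier Q" "y \<in> carrier Q" "y' \<in> carrier Q" "x \<sqsubseteq> x'" "y \<sqsubseteq> y'"
  shows "x \<cdot> y \<sqsubseteq> x' \<cdot> y'"
proof -
  have c: "x \<cdot> y \<in> carrier Q" "x \<cdot> y' \<in> carrier Q" "x' \<cdot> y' \<in> carrier Q"
    using assms qmult_closed by auto
  have "x \<cdot> \<Squnion>{y, y'} = \<Squnion>{x \<cdot> y, x \<cdot> y'}" using assms qmult_sup_left[of x "{y, y'}"] by simp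
  then have e1: "x \<cdot> y' = \<Squnion>{x \<cdot> y, x \<cdot> y'}" unfolding le_iff_sup[OF assms(3,4,6)] .
  have 1: "x \<cdot> y \<sqsubseteq> x \<cdot> y'" by (subst e1, rule sup_upper) (use c in auto)
  have "\<Squnion>{x, x'} \<cdot> y' = \<Squnion>{x \<cdot> y', x' \<cdot> y'}" using assms qmult_sup_right[of y' "{x, x'}"] by simp
  then have e2: "x' \<cdot> y' = \<Squnion>{x \<cdot> y', x' \<cdot> y'}" unfolding le_iff_sup[OF assms(1,2,5)] .
  have 2: "x \<cdot> y' \<sqsubseteq> x' \<cdot> y'" by (subst e2, rule sup_upper) (use c in auto)
  show ?thesis by (rule le_trans[OF 1 2 c])
qed

context ehresmann_quantale
begin

lemma lam_closed: "a \<in> carrier Q \<Longrightarrow> lam Q a \<in> carrier Q \<and> lam Q a \<sqsubseteq> \<e>"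
  using lam_sups funcset_mem[of "lam Q" "carrier Q" "carrier (down Q \<e>)" a]
  by (simp add: preserves_sups_def down_def)

lemma rho_closed: "a \<in> carrier Q \<Longrightarrow> rho Q a \<in> carrier Q \<and> rho Q a \<sqsubseteq> \<e>"
  using rho_sups funcset_mem[of "rho Q" "carrier Q" "carrier (down Q \<e>)" a]
  by (simp add: preserves_sups_def down_def)

lemma sup_pair_mono:
  assumes h: "sup_pres Q (down Q \<e>) h" and cl: "\<And>a. a \<in> carrier Q \<Longrightarrow> h a \<in> carrier Q \<and> h a \<sqsubseteq> \<e>"
    and ab: "a \<in> carrier Q" "b \<in> carrier Q" "a \<sqsubseteq> b"
  shows "h a \<sqsubseteq> h b"
proof -
  interpret O: complete_lattice "down Q \<e>" using h by (simp add: sup_pres_def)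
  have "h (\<Squnion>{a, b}) = \<Squnion>\<^bsub>down Q \<e>\<^esub>(h ` {a, b})"
    using h ab(1,2) by (simp add: sup_pres_def)
  then have "h b = \<Squnion>\<^bsub>down Q \<e>\<^esub>{h a, h b}" unfolding le_iff_sup[OF ab] by simp
  moreover have "h a \<sqsubseteq>\<^bsub>down Q \<e>\<^esub> \<Squnion>\<^bsub>down Q \<e>\<^esub>{h a, h b}"
    using cl ab by (intro O.sup_upper) (auto simp: down_def)
  ultimately have "h a \<sqsubseteq>\<^bsub>down Q \<e>\<^esub> h b" by (rule ssubst)
  then show ?thesis by (simp add: down_def)
qed

lemma lam_mono: "a \<in> carrier Q \<Longrightarrow> b \<in> carrier Q \<Longrightarrow> a \<sqsubseteq> b \<Longrightarrow> lam Q a \<sqsubseteq> lam Q b"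
  by (rule sup_pair_mono[of "lam Q"]) (use lam_sups lam_closed in \<open>simp_all add: preserves_sups_def\<close>)

lemma rho_mono: "a \<in> carrier Q \<Longrightarrow> b \<in> carrier Q \<Longrightarrow> a \<sqsubseteq> b \<Longrightarrow> rho Q a \<sqsubseteq> rho Q b"
  by (rule sup_pair_mono[of "rho Q"]) (use rho_sups rho_closed in \<open>simp_all add: preserves_sups_def\<close>)

lemma lam_top: "lam Q \<top> = \<e>"
  using lam_mono[of \<e> \<top>] lam_proj[of \<e>] lam_closed[of \<top>] qunit_closed by (simp add: le_antisym)

lemma rho_top: "rho Q \<top> = \<e>"
  using rho_mono[of \<e> \<top>] rho_proj[of \<e>] rho_closed[of \<top>] qunit_closed by (simp add: le_antisym)

lemma meet_dstar:
  assumes a: "a \<in> carrier Q" and f: "f \<in> carrier Q" "f \<sqsubseteq> \<e>"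
  shows "a \<sqinter> (\<top> \<cdot> f) = a \<cdot> f"
proof (rule le_antisym)
  let ?c = "a \<sqinter> (\<top> \<cdot> f)"
  have tf: "\<top> \<cdot> f \<in> carrier Q" using f qmult_closed by simp
  have c: "?c \<in> carrier Q" using a tf by simp
  have "lam Q ?c \<sqsubseteq> lam Q (\<top> \<cdot> f)" using a tf by (intro lam_mono meet_right) simp_all
  also have "lam Q (\<top> \<cdot> f) = f" using f lam_mult[of \<top> f] lam_top qunit_left lam_proj by simp
  finally have "?c \<cdot> lam Q ?c \<sqsubseteq> a \<cdot> f"
    using a f c tf lam_closed[OF c] by (intro qmult_mono meet_left) simp_all
  then show "?c \<sqsubseteq> a \<cdot> f" using mult_lam[OF c] by simp
  have "a \<cdot> f \<sqsubseteq> a" using qmult_mono[of a a f \<e>] a f qunit_closed qunit_right by simp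
  moreover have "a \<cdot> f \<sqsubseteq> \<top> \<cdot> f" using a f by (intro qmult_mono) simp_all
  ultimately show "a \<cdot> f \<sqsubseteq> ?c" using a f tf qmult_closed by (intro meet_le) simp_all
qed (use a f qmult_closed in simp_all)

lemma meet_rstar:
  assumes a: "a \<in> carrier Q" and f: "f \<in> carrier Q" "f \<sqsubseteq> \<e>"
  shows "(f \<cdot> \<top>) \<sqinter> a = f \<cdot> a"
proof (rule le_antisym)
  let ?c = "(f \<cdot> \<top>) \<sqinter> a"
  have ft: "f \<cdot> \<top> \<in> carrier Q" using f qmult_closed by simp
  have c: "?c \<in> carrier Q" using a ft by simp
  have "rho Q ?c \<sqsubseteq> rho Q (f \<cdot> \<top>)" using a ft by (intro rho_mono meet_left) simp_all
  also have "rho Q (f \<cdot> \<top>) = f" using f rho_mult_rho[of f \<top>] rho_top qunit_right rho_proj by simp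
  finally have "rho Q ?c \<cdot> ?c \<sqsubseteq> f \<cdot> a"
    using a f c ft rho_closed[OF c] by (intro qmult_mono meet_right) simp_all
  then show "?c \<sqsubseteq> f \<cdot> a" using rho_mult[OF c] by simp
  have "f \<cdot> a \<sqsubseteq> a" using qmult_mono[of f \<e> a a] a f qunit_closed qunit_left by simp
  moreover have "f \<cdot> a \<sqsubseteq> f \<cdot> \<top>" using a f by (intro qmult_mono) simp_all
  ultimately show "f \<cdot> a \<sqsubseteq> ?c" using a f ft qmult_closed by (intro meet_le) simp_all
qed (use a f qmult_closed in simp_all)

sublocale balanced: sup_tensor Q Q "balanced_rel Q"
  using qmult_closed by unfold_locales (auto simp: balanced_rel_def)

lemma ideal_mult_below:
  assumes a: "a \<in> carrier Q"
  shows "bi_ideal Q Q (balanced_rel Q) {(x, y). x \<in> carrier Q \<and> y \<in> carrier Q \<and> x \<cdot> y \<sqsubseteq> a}"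
    (is "bi_ideal _ _ _ ?G")
proof (rule balanced.idealI)
  have sup_le: "\<Squnion>F \<sqsubseteq> a \<longleftrightarrow> (\<forall>z\<in>F. z \<sqsubseteq> a)" if F: "F \<subseteq> carrier Q" for F
  proof
    assume le: "\<Squnion>F \<sqsubseteq> a"
    show "\<forall>z\<in>F. z \<sqsubseteq> a"
      using le_trans[OF sup_upper[OF F] le] F a sup_closed[OF F] by blast
  next
    show "\<forall>z\<in>F. z \<sqsubseteq> a \<Longrightarrow> \<Squnion>F \<sqsubseteq> a" using sup_least[OF F a] by blast
  qed
  show "?G \<subseteq> carrier Q \<times> carrier Q" by auto
  show "(\<Squnion>S, y) \<in> ?G \<longleftrightarrow> (\<forall>x\<in>S. (x, y) \<in> ?G)" if S: "S \<subseteq> carrier Q" "y \<in> carrier Q" for S y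
  proof -
    have "(\<lambda>s. s \<cdot> y) ` S \<subseteq> carrier Q" using S qmult_closed by auto
    then have "\<Squnion>S \<cdot> y \<sqsubseteq> a \<longleftrightarrow> (\<forall>x\<in>S. x \<cdot> y \<sqsubseteq> a)" using S by (simp add: qmult_sup_right sup_le)
    then show ?thesis using S by auto
  qed
  show "(x, \<Squnion>S) \<in> ?G \<longleftrightarrow> (\<forall>y\<in>S. (x, y) \<in> ?G)" if S: "x \<in> carrier Q" "S \<subseteq> carrier Q" for x S
  proof -
    have "(\<lambda>s. x \<cdot> s) ` S \<subseteq> carrier Q" using S qmult_closed by auto
    then have "x \<cdot> \<Squnion>S \<sqsubseteq> a \<longleftrightarrow> (\<forall>y\<in>S. x \<cdot> y \<sqsubseteq> a)" using S by (simp add: qmult_sup_left sup_le)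
    then show ?thesis using S by auto
  qed
  show "p \<in> ?G \<longleftrightarrow> q \<in> ?G" if "(p, q) \<in> balanced_rel Q" for p q
    using that qmult_closed by (auto simp: balanced_rel_def qmult_assoc)
qed

lemma mult_adj_eq:
  assumes a: "a \<in> carrier Q"
  shows "mult_adj Q a = {(x, y). x \<in> carrier Q \<and> y \<in> carrier Q \<and> x \<cdot> y \<sqsubseteq> a}"
proof -
  let ?G = "{(x, y). x \<in> carrier Q \<and> y \<in> carrier Q \<and> x \<cdot> y \<sqsubseteq> a}"
  have "{pure Q Q (balanced_rel Q) x y | x y. x \<in> carrier Q \<and> y \<in> carrier Q \<and> x \<cdot> y \<sqsubseteq> a} =
      {pure Q Q (balanced_rel Q) x y | x y. (x, y) \<in> ?G}"
    by simp
  then show ?thesis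
    using balanced.ideal_eq_sup_pure[OF ideal_mult_below[OF a]]
    by (simp only: mult_adj_def balanced_tensor_def)
qed

lemma mult_adj_right_adjoint:
  "galois_connection \<lparr>orderA = balanced_tensor Q, orderB = gorder.truncate Q,
     lower = (\<lambda>I. \<Squnion>{x \<cdot> y | x y. (x, y) \<in> I}), upper = mult_adj Q\<rparr>"
proof -
  have po: "partial_order (gorder.truncate Q)"
    by unfold_locales
      (simp_all add: carrier_truncate gorder.truncate_def eq_is_equal le_antisym, blast intro: le_trans)
  have sub: "{x \<cdot> y | x y. (x, y) \<in> I} \<subseteq> carrier Q" if I: "bi_ideal Q Q (balanced_rel Q) I" for I
    using balanced.ideal_carrier[OF I] qmult_closed by auto
  have adj: "\<Squnion>{x \<cdot> y | x y. (x, y) \<in> I} \<sqsubseteq> a \<longleftrightarrow> I \<subseteq> mult_adj Q a" (is "\<Squnion>?X \<sqsubseteq> a \<longleftrightarrow> _")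
    if I: "bi_ideal Q Q (balanced_rel Q) I" and a: "a \<in> carrier Q" for I a
  proof
    assume le: "\<Squnion>?X \<sqsubseteq> a"
    show "I \<subseteq> mult_adj Q a"
    proof
      fix p assume "p \<in> I"
      then obtain x y where p: "p = (x, y)" "(x, y) \<in> I" by (cases p) simp
      have c: "x \<in> carrier Q" "y \<in> carrier Q" using balanced.ideal_carrier[OF I p(2)] by auto
      have "x \<cdot> y \<in> ?X" using p(2) by blast
      then have "x \<cdot> y \<sqsubseteq> \<Squnion>?X" by (rule sup_upper[OF sub[OF I]])
      then have "x \<cdot> y \<sqsubseteq> a"
        by (rule le_trans[OF _ le qmult_closed[OF c] sup_closed[OF sub[OF I]] a])
      then show "p \<in> mult_adj Q a" using p c a by (simp add: mult_adj_eq)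
    qed
  next
    assume le: "I \<subseteq> mult_adj Q a"
    show "\<Squnion>?X \<sqsubseteq> a"
    proof (rule sup_least[OF sub[OF I] a])
      fix z assume "z \<in> ?X"
      then obtain x y where z: "z = x \<cdot> y" "(x, y) \<in> I" by blast
      then have "(x, y) \<in> mult_adj Q a" using le by (auto dest: subsetD)
      then show "z \<sqsubseteq> a" using z(1) by (simp add: mult_adj_eq[OF a])
    qed
  qed
  have "mult_adj Q a \<in> carrier (balanced_tensor Q)" if "a \<in> carrier Q" for a
    using mult_adj_eq[OF that] ideal_mult_below[OF that] by (simp add: balanced_tensor_def)
  moreover have "\<Squnion>{x \<cdot> y | x y. (x, y) \<in> I} \<in> carrier Q"
    if "bi_ideal Q Q (balanced_rel Q) I" for I
    by (rule sup_closed[OF sub[OF that]])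
  moreover have "partial_order (balanced_tensor Q)"
    unfolding balanced_tensor_def by (rule balanced.partial_order_T)
  ultimately show ?thesis
    using adj po unfolding galois_connection_def galois_connection_axioms_def connection_def
    by (simp add: balanced_tensor_def gorder.truncate_def)
qed

end

lemma composable_cat_of:
  fixes Q :: "'a equantale" (structure)
  assumes "ehresmann_quantale Q"
  shows "composable (cat_of Q) = balanced_tensor Q"
    and "\<And>x y. pure (arrows (cat_of Q)) (arrows (cat_of Q))
           (pb_rel (objects (cat_of Q)) (arrows (cat_of Q)) (arrows (cat_of Q))
             (dstar (cat_of Q)) (rstar (cat_of Q))) x y =
         pure Q Q (balanced_rel Q) x y"
proof -
  interpret ehresmann_quantale Q by (rule assms)
  have "pb_rel (down Q \<e>) (gorder.truncate Q) (gorder.truncate Q) (\<lambda>f. \<top> \<cdot> f) (\<lambda>f. f \<cdot> \<top>) =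
      balanced_rel Q" (is "?L = ?R")
  proof (intro equalityI subrelI)
    fix p q assume "(p, q) \<in> ?L"
    then obtain x y c where c: "x \<in> carrier Q" "y \<in> carrier Q" "c \<in> carrier Q" "c \<sqsubseteq> \<e>"
      and pq: "p = (x \<sqinter> (\<top> \<cdot> c), y)" "q = (x, (c \<cdot> \<top>) \<sqinter> y)"
      by (auto simp: pb_rel_def carrier_truncate meet_truncate down_def)
    then have "p = (x \<cdot> c, y)" "q = (x, c \<cdot> y)" by (simp_all add: meet_dstar meet_rstar)
    with c show "(p, q) \<in> ?R" unfolding balanced_rel_def by blast
  next
    fix p q assume "(p, q) \<in> ?R"
    then obtain x y c where c: "x \<in> carrier Q" "y \<in> carrier Q" "c \<in> carrier Q" "c \<sqsubseteq> \<e>"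
      and pq: "p = (x \<cdot> c, y)" "q = (x, c \<cdot> y)"
      unfolding balanced_rel_def by blast
    then have "p = (x \<sqinter> (\<top> \<cdot> c), y)" "q = (x, (c \<cdot> \<top>) \<sqinter> y)" by (simp_all add: meet_dstar meet_rstar)
    moreover have "c \<in> carrier (down Q \<e>)" using c by (simp add: down_def)
    ultimately show "(p, q) \<in> ?L"
      unfolding pb_rel_def carrier_truncate meet_truncate using c by blast
  qed
  moreover have bi: "bi_ideal (gorder.truncate Q) (gorder.truncate Q) R = bi_ideal Q Q R" for R
    by (simp add: fun_eq_iff bi_ideal_def carrier_truncate sup_truncate)
  ultimately show "composable (cat_of Q) = balanced_tensor Q"
    and "\<And>x y. pure (arrows (cat_of Q)) (arrows (cat_of Q))
           (pb_rel (objects (cat_of Q)) (arrows (cat_of Q)) (arrows (cat_of Q))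
             (dstar (cat_of Q)) (rstar (cat_of Q))) x y =
         pure Q Q (balanced_rel Q) x y"
    by (simp_all add: composable_def pullback_def balanced_tensor_def tensor_def pure_def cat_of_def)
qed

end

theory Submission
  imports Defs
begin

text \<open>Both sides of the correspondence are a frame of arrows \<open>A\<close> with an operation \<open>\<odot>\<close> that preserves joins in
each variable and is balanced over the frame of objects. Such an operation is the same thing as the family
of bi-ideals \<open>m b = {(x, y). x \<odot> y \<sqsubseteq> b}\<close>, which is to be the inverse image of the composition map. Under this
dictionary the laws of a category become elementary: the unit laws say that every \<open>a\<close> is the join of the
\<open>x \<sqinter> d (u y)\<close>, respectively of the \<open>r (u x) \<sqinter> y\<close>, with \<open>x \<odot> y \<sqsubseteq> a\<close> (\<open>right_unit_law_iff\<close>,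
\<open>left_unit_law_iff\<close>), and associativity of composition is associativity of \<open>\<odot>\<close>
(\<open>assoc_law_iff\<close>).

From a restriction quantal frame to a category, the point is that \<open>m\<close> preserves joins and satisfies the
Frobenius law. Both are tested on pairs of partial isometries \<open>s, t\<close>, which suffices because every
element is a join of partial isometries. The product \<open>st\<close> is again a partial isometry, so each of its
parts \<open>st \<sqinter> b\<close> is a restriction \<open>st f\<close> with \<open>f \<sqsubseteq> e\<close>, and therefore the product of
\<open>s\<close> with \<open>tf \<sqsubseteq> t\<close> (\<open>mult_adj_sup_subset\<close>, \<open>mult_frobenius\<close>). The maps \<open>d\<close> and \<open>r\<close> have
\<open>\<lambda>\<close> and \<open>\<rho>\<close> as direct images, and partial isometries are the cover that makes them etale.

From a category to a quantale, the unit laws and the openness of \<open>u\<close> give \<open>a \<odot> u\<^sub>! z = a \<sqinter> d z\<close> and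
\<open>u\<^sub>! z \<odot> a = r z \<sqinter> a\<close> (\<open>prod_ush\<close>, \<open>ush_prod\<close>). The axioms on the unit and the supports follow from
these two formulas, the adjunctions and the Beck-Chevalley condition for the square of composable pairs
(\<open>prod_le_d_iff\<close>, \<open>prod_le_r_iff\<close>). The partial isometries turn out to be the opens that \<open>d\<close> and \<open>r\<close>
embed into the objects (\<open>partial_isometries_Q\<close>). They cover because \<open>d\<close> and \<open>r\<close> are etale, and
they are closed under products because \<open>m\<close> is open, so that an open below \<open>s \<odot> t\<close> is a join of products
of opens below \<open>s\<close> and \<open>t\<close> (\<open>sup_of_products\<close>).

The two round trips leave the frame of arrows and the multiplication unchanged; objects are
identified with the opens below the unit by \<open>u\<^sub>!\<close> and \<open>u\<close>.\<close>

section \<open>Lattices, frames and adjoints\<close>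

context complete_lattice
begin

lemma sup_le_iff:
  assumes "S \<subseteq> carrier L" "b \<in> carrier L"
  shows "\<Squnion>S \<sqsubseteq> b \<longleftrightarrow> (\<forall>x\<in>S. x \<sqsubseteq> b)"
  using assms sup_upper[OF assms(1)] sup_closed[OF assms(1)] sup_least[OF assms]
  by (meson le_trans subsetD)

lemma le_meet_iff:
  assumes "x \<in> carrier L" "y \<in> carrier L" "z \<in> carrier L"
  shows "z \<sqsubseteq> x \<sqinter> y \<longleftrightarrow> z \<sqsubseteq> x \<and> z \<sqsubseteq> y"
  using assms meet_left[of x y] meet_right[of x y] meet_le[of z x y] meet_closed[of x y]
  by (meson le_trans)

lemma eq_iff_same_upper:
  assumes "x \<in> carrier L" "y \<in> carrier L" "\<And>b. b \<in> carrier L \<Longrightarrow> x \<sqsubseteq> b \<longleftrightarrow> y \<sqsubseteq> b"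
  shows "x = y"
  using assms by (intro le_antisym) auto

lemma sup_eqI:
  assumes "S \<subseteq> carrier L" "s \<in> carrier L"
    "\<And>b. b \<in> carrier L \<Longrightarrow> s \<sqsubseteq> b \<longleftrightarrow> (\<forall>x\<in>S. x \<sqsubseteq> b)"
  shows "\<Squnion>S = s"
  using assms by (intro eq_iff_same_upper) (simp_all add: sup_le_iff)

lemma meet_eqI:
  assumes "x \<in> carrier L" "y \<in> carrier L" "m \<in> carrier L"
    "\<And>z. z \<in> carrier L \<Longrightarrow> z \<sqsubseteq> m \<longleftrightarrow> z \<sqsubseteq> x \<and> z \<sqsubseteq> y"
  shows "x \<sqinter> y = m"
proof (rule le_antisym)
  show "x \<sqinter> y \<sqsubseteq> m" using assms by (simp add: meet_left meet_right)
  show "m \<sqsubseteq> x \<sqinter> y" using assms(4)[OF assms(3)] assms by (simp add: le_meet_iff)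
qed (use assms in simp_all)

lemma meet_mono:
  assumes "x \<in> carrier L" "y \<in> carrier L" "x' \<in> carrier L" "y' \<in> carrier L" "x \<sqsubseteq> x'" "y \<sqsubseteq> y'"
  shows "x \<sqinter> y \<sqsubseteq> x' \<sqinter> y'"
  using assms meet_left[of x y] meet_right[of x y] meet_le[of "x \<sqinter> y" x' y'] meet_closed[of x y]
  by (meson le_trans)

lemma meet_absorb1: "x \<in> carrier L \<Longrightarrow> y \<in> carrier L \<Longrightarrow> x \<sqsubseteq> y \<Longrightarrow> x \<sqinter> y = x"
  using le_iff_join[of x y] by simp

lemma meet_absorb2: "x \<in> carrier L \<Longrightarrow> y \<in> carrier L \<Longrightarrow> y \<sqsubseteq> x \<Longrightarrow> x \<sqinter> y = y"
  using meet_absorb1[of y x] by (simp add: meet_comm[of L x])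

lemma inf_le_iff:
  assumes "S \<subseteq> carrier L" "b \<in> carrier L"
  shows "b \<sqsubseteq> \<Sqinter>S \<longleftrightarrow> (\<forall>x\<in>S. b \<sqsubseteq> x)"
  using assms inf_lower[OF assms(1)] inf_closed[OF assms(1)] inf_greatest[OF assms(1,2)]
  by (meson le_trans subsetD)

end

lemma frame_map_mono:
  assumes "frame X" "frame Y" "frame_map X Y h" "x \<in> carrier X" "y \<in> carrier X" "x \<sqsubseteq>\<^bsub>X\<^esub> y"
  shows "h x \<sqsubseteq>\<^bsub>Y\<^esub> h y"
proof -
  interpret X: frame X by (rule assms)
  interpret Y: frame Y by (rule assms)
  have "x = x \<sqinter>\<^bsub>X\<^esub> y" using assms by (simp add: X.meet_absorb1)
  then have "h x = h x \<sqinter>\<^bsub>Y\<^esub> h y" using frame_mapD(4)[OF assms(3), of x y] assms by simp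
  then show ?thesis
    using Y.le_iff_join[of "h x" "h y"] frame_mapD(1)[OF assms(3)] assms by simp
qed

text \<open>Joins and binary meets below \<open>x\<close> are those of the whole lattice; only the top element, the empty meet,
  changes. This identifies the lattice operations of the frame of objects of \<open>\<C>(Q)\<close>.\<close>

lemma complete_lattice_down:
  assumes "complete_lattice L" and x: "x \<in> carrier L"
  shows "complete_lattice (down L x)"
    and "S \<subseteq> carrier (down L x) \<Longrightarrow> \<Squnion>\<^bsub>down L x\<^esub>S = \<Squnion>\<^bsub>L\<^esub>S"
    and "a \<in> carrier (down L x) \<Longrightarrow> b \<in> carrier (down L x) \<Longrightarrow> a \<sqinter>\<^bsub>down L x\<^esub> b = a \<sqinter>\<^bsub>L\<^esub> b"
    and "\<top>\<^bsub>down L x\<^esub> = x"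
proof -
  interpret L: complete_lattice L by (rule assms)
  interpret po: partial_order "down L x"
    by unfold_locales (auto simp: down_def L.eq_is_equal intro: L.le_antisym L.le_trans)
  have lub: "least (down L x) (\<Squnion>\<^bsub>L\<^esub>S) (Upper (down L x) S)" if S: "S \<subseteq> carrier (down L x)" for S
  proof -
    have S': "S \<subseteq> carrier L" "\<forall>s\<in>S. s \<sqsubseteq>\<^bsub>L\<^esub> x" using S by (auto simp: down_def)
    then have "\<Squnion>\<^bsub>L\<^esub>S \<sqsubseteq>\<^bsub>L\<^esub> x" using x by (simp add: L.sup_le_iff)
    then show ?thesis
      using S' x L.sup_upper[of S] L.sup_closed[of S]
      by (simp add: least_def Upper_def down_def subset_iff) (simp add: L.sup_le_iff subset_iff)
  qed
  show c: "complete_lattice (down L x)"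
  proof (rule po.complete_latticeI)
    fix S assume S: "S \<subseteq> carrier (down L x)"
    then show "\<exists>s. is_lub (down L x) s S" using lub by blast
    have S': "S \<subseteq> carrier L" using S by (auto simp: down_def)
    have "greatest (down L x) (x \<sqinter>\<^bsub>L\<^esub> \<Sqinter>\<^bsub>L\<^esub>S) (Lower (down L x) S)"
      using x S S' L.inf_closed[OF S']
      by (auto simp: greatest_def Lower_def down_def L.inf_le_iff L.le_meet_iff
          intro: L.meet_left L.le_trans[OF L.meet_right L.inf_lower])
    then show "\<exists>i. is_glb (down L x) i S" by blast
  qed
  then interpret D: complete_lattice "down L x" .
  show "\<Squnion>\<^bsub>down L x\<^esub>S = \<Squnion>\<^bsub>L\<^esub>S" if "S \<subseteq> carrier (down L x)"
    using po.least_unique[OF D.sup_lub lub] that by blast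
  show "a \<sqinter>\<^bsub>down L x\<^esub> b = a \<sqinter>\<^bsub>L\<^esub> b" if "a \<in> carrier (down L x)" "b \<in> carrier (down L x)"
    by (rule D.meet_eqI)
      (use that x in \<open>auto simp: down_def L.le_meet_iff intro: L.le_trans[OF L.meet_left]\<close>)
  show "\<top>\<^bsub>down L x\<^esub> = x"
    by (rule po.le_antisym) (use x D.top_closed D.top_higher[of x] in \<open>auto simp: down_def\<close>)
qed

lemma frame_down:
  assumes "frame L" and x: "x \<in> carrier L"
  shows "frame (down L x)"
proof -
  interpret L: frame L by (rule assms)
  note D = complete_lattice_down[OF L.complete_lattice_axioms x]
  interpret D: complete_lattice "down L x" by (rule D)
  show ?thesis
  proof unfold_locales
    fix a S assume h: "a \<in> carrier (down L x)" "S \<subseteq> carrier (down L x)"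
    have "a \<in> carrier L" "S \<subseteq> carrier L" "\<And>s. s \<in> S \<Longrightarrow> s \<in> carrier (down L x)"
      using h by (auto simp: down_def)
    moreover have "\<Squnion>\<^bsub>L\<^esub>S \<in> carrier (down L x)" using D.sup_closed[OF h(2)] D(2)[OF h(2)] by simp
    moreover have "(\<lambda>s. a \<sqinter>\<^bsub>L\<^esub> s) ` S = (\<lambda>s. a \<sqinter>\<^bsub>down L x\<^esub> s) ` S"
      using h by (intro image_cong) (auto simp: D(3))
    moreover have "(\<lambda>s. a \<sqinter>\<^bsub>down L x\<^esub> s) ` S \<subseteq> carrier (down L x)"
      using h by (intro image_subsetI D.meet_closed) auto
    ultimately show "a \<sqinter>\<^bsub>down L x\<^esub> \<Squnion>\<^bsub>down L x\<^esub>S = \<Squnion>\<^bsub>down L x\<^esub>((\<lambda>s. a \<sqinter>\<^bsub>down L x\<^esub> s) ` S)"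
      using h D(2)[OF h(2)] D(2)[of "(\<lambda>s. a \<sqinter>\<^bsub>down L x\<^esub> s) ` S"] L.frame_distrib[of a S]
      by (simp add: D(3))
  qed
qed

lemma le_truncate: "x \<sqsubseteq>\<^bsub>gorder.truncate Q\<^esub> y \<longleftrightarrow> x \<sqsubseteq>\<^bsub>Q\<^esub> y"
  by (simp add: gorder.truncate_def)

lemma top_truncate: "\<top>\<^bsub>gorder.truncate Q\<^esub> = \<top>\<^bsub>Q\<^esub>"
  by (simp add: top_def greatest_def gorder.truncate_def)

lemmas truncate_simps = carrier_truncate meet_truncate sup_truncate le_truncate top_truncate

lemma complete_lattice_transfer:
  assumes "complete_lattice L" "carrier M = carrier L" "eq M = eq L" "le M = le L"
  shows "complete_lattice M"
proof -
  interpret L: complete_lattice L by (rule assms)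
  interpret po: partial_order M
    by unfold_locales (auto simp: assms L.eq_is_equal intro: L.le_antisym L.le_trans)
  have "Upper M = Upper L" "Lower M = Lower L" "least M = least L" "greatest M = greatest L"
    by (simp_all add: fun_eq_iff Upper_def Lower_def least_def greatest_def assms)
  then show ?thesis
    by (intro po.complete_latticeI) (auto simp: assms intro: L.sup_lub L.inf_glb)
qed

lemma frame_transfer:
  assumes "frame L" "carrier M = carrier L" "eq M = eq L" "le M = le L"
  shows "frame M" "\<And>S. \<Squnion>\<^bsub>M\<^esub>S = \<Squnion>\<^bsub>L\<^esub>S" "\<And>x y. x \<sqinter>\<^bsub>M\<^esub> y = x \<sqinter>\<^bsub>L\<^esub> y"
    "\<top>\<^bsub>M\<^esub> = \<top>\<^bsub>L\<^esub>"
proof -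
  interpret L: frame L by (rule assms)
  interpret M: complete_lattice M by (rule complete_lattice_transfer[OF L.complete_lattice_axioms assms(2-)])
  have "Upper M = Upper L" "Lower M = Lower L" "least M = least L" "greatest M = greatest L"
    by (simp_all add: fun_eq_iff Upper_def Lower_def least_def greatest_def assms)
  then show s: "\<And>S. \<Squnion>\<^bsub>M\<^esub>S = \<Squnion>\<^bsub>L\<^esub>S" "\<And>x y. x \<sqinter>\<^bsub>M\<^esub> y = x \<sqinter>\<^bsub>L\<^esub> y"
    "\<top>\<^bsub>M\<^esub> = \<top>\<^bsub>L\<^esub>"
    by (simp_all add: sup_def meet_def inf_def top_def assms)
  show "frame M"
    by unfold_locales (use L.frame_distrib in \<open>simp add: s assms\<close>)
qed

lemma frame_truncate: "frame L \<Longrightarrow> frame (gorder.truncate L)"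
  by (rule frame_transfer) (auto simp: gorder.truncate_def)

text \<open>An inverse image map with a left adjoint preserves meets, and the left adjoint is unique.\<close>

lemma semiopen_of_adjoint:
  assumes f: "locale_map X Y f" and g: "\<And>a. a \<in> carrier X \<Longrightarrow> g a \<in> carrier Y"
    and adj: "\<And>a b. a \<in> carrier X \<Longrightarrow> b \<in> carrier Y \<Longrightarrow> g a \<sqsubseteq>\<^bsub>Y\<^esub> b \<longleftrightarrow> a \<sqsubseteq>\<^bsub>X\<^esub> f b"
  shows "semiopen_map X Y f" "a \<in> carrier X \<Longrightarrow> shriek X Y f a = g a"
proof -
  have fr: "frame X" "frame Y" and fc: "f \<in> carrier Y \<rightarrow> carrier X"
    using f by (auto simp: locale_map_def frame_map_def preserves_sups_def)
  interpret X: frame X by (rule fr)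
  interpret Y: frame Y by (rule fr)
  have "f (\<Sqinter>\<^bsub>Y\<^esub>S) = \<Sqinter>\<^bsub>X\<^esub>(f ` S)" if S: "S \<subseteq> carrier Y" for S
  proof -
    have "f ` S \<subseteq> carrier X" using fc S by auto
    moreover have "a \<sqsubseteq>\<^bsub>X\<^esub> f (\<Sqinter>\<^bsub>Y\<^esub>S) \<longleftrightarrow> (\<forall>y\<in>f ` S. a \<sqsubseteq>\<^bsub>X\<^esub> y)" if "a \<in> carrier X" for a
    proof -
      have "a \<sqsubseteq>\<^bsub>X\<^esub> f (\<Sqinter>\<^bsub>Y\<^esub>S) \<longleftrightarrow> (\<forall>y\<in>S. g a \<sqsubseteq>\<^bsub>Y\<^esub> y)"
        using that g Y.inf_closed[OF S] by (simp add: adj[symmetric] Y.inf_le_iff[OF S])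
      also have "\<dots> \<longleftrightarrow> (\<forall>y\<in>S. a \<sqsubseteq>\<^bsub>X\<^esub> f y)" using that S adj by blast
      finally show ?thesis by blast
    qed
    moreover have "\<Sqinter>\<^bsub>X\<^esub>(f ` S) \<in> carrier X" "f (\<Sqinter>\<^bsub>Y\<^esub>S) \<in> carrier X"
      using fc S Y.inf_closed[OF S] by (auto intro!: X.inf_closed)
    ultimately show ?thesis
      using X.inf_le_iff by (metis X.le_antisym X.le_refl)
  qed
  then show "semiopen_map X Y f"
    using f fc by (simp add: semiopen_map_def preserves_infs_def inf_pres_def
        X.complete_lattice_axioms Y.complete_lattice_axioms)
  show "shriek X Y f a = g a" if a: "a \<in> carrier X"
    unfolding shriek_def
  proof (rule Y.le_antisym)
    have sub: "{b \<in> carrier Y. a \<sqsubseteq>\<^bsub>X\<^esub> f b} \<subseteq> carrier Y" by auto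
    have "a \<sqsubseteq>\<^bsub>X\<^esub> f (g a)" using adj[OF a g[OF a]] g[OF a] by simp
    then show "\<Sqinter>\<^bsub>Y\<^esub>{b \<in> carrier Y. a \<sqsubseteq>\<^bsub>X\<^esub> f b} \<sqsubseteq>\<^bsub>Y\<^esub> g a"
      using a g by (intro Y.inf_lower[OF sub]) simp
    show "g a \<sqsubseteq>\<^bsub>Y\<^esub> \<Sqinter>\<^bsub>Y\<^esub>{b \<in> carrier Y. a \<sqsubseteq>\<^bsub>X\<^esub> f b}"
      using adj[OF a] by (simp add: Y.inf_le_iff[OF sub] g[OF a])
  qed (use a g in auto)
qed

lemma open_of_adjoint:
  assumes f: "locale_map X Y f" and g: "\<And>a. a \<in> carrier X \<Longrightarrow> g a \<in> carrier Y"
    and adj: "\<And>a b. a \<in> carrier X \<Longrightarrow> b \<in> carrier Y \<Longrightarrow> g a \<sqsubseteq>\<^bsub>Y\<^esub> b \<longleftrightarrow> a \<sqsubseteq>\<^bsub>X\<^esub> f b"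
    and frob: "\<And>a b. a \<in> carrier X \<Longrightarrow> b \<in> carrier Y \<Longrightarrow> g (a \<sqinter>\<^bsub>X\<^esub> f b) = g a \<sqinter>\<^bsub>Y\<^esub> b"
  shows "open_map X Y f"
proof -
  have fr: "frame X" and fc: "f \<in> carrier Y \<rightarrow> carrier X"
    using f by (auto simp: locale_map_def frame_map_def preserves_sups_def)
  interpret X: frame X by (rule fr)
  show ?thesis
    unfolding open_map_def
    using semiopen_of_adjoint[OF f g adj] frob fc by (simp add: Pi_iff)
qed

lemma shriek_adj:
  assumes "semiopen_map X Y f" "a \<in> carrier X" "b \<in> carrier Y"
  shows "shriek X Y f a \<sqsubseteq>\<^bsub>Y\<^esub> b \<longleftrightarrow> a \<sqsubseteq>\<^bsub>X\<^esub> f b" "shriek X Y f a \<in> carrier Y"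
  using shriek_left_adjoint[OF assms(1)] assms(2,3)
  by (auto simp: galois_connection_def galois_connection_axioms_def connection_def)

section \<open>Multiplications on a reflexive graph of locales\<close>

lemma pair_image_cong:
  assumes "\<And>x y. (x, y) \<in> I \<Longrightarrow> f x y = h (g x y)"
  shows "{f x y | x y. (x, y) \<in> I} = h ` {g x y | x y. (x, y) \<in> I}"
  using assms by (auto simp: image_iff) metis

lemma frame_map_comp:
  assumes "frame X" "frame Y" "frame Z" "frame_map X Y h" "frame_map Y Z k"
  shows "frame_map X Z (k \<circ> h)"
proof -
  have "h ` S \<subseteq> carrier Y" if "S \<subseteq> carrier X" for S using that frame_mapD(1)[OF assms(4)] by auto
  then show ?thesis
    by (intro frame_mapI assms(1,3))
      (simp_all add: frame_mapD[OF assms(4)] frame_mapD[OF assms(5)] image_image)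
qed

lemma frame_map_id: "frame X \<Longrightarrow> frame_map X X id"
  by (intro frame_mapI) simp_all

text \<open>The pairs whose meet with every member of \<open>I\<close> lies in \<open>K\<close> form a bi-ideal, the implication from \<open>I\<close> to \<open>K\<close>;
  the inclusion on the left says that it contains \<open>(a, b)\<close>.\<close>

lemma (in frame_span) pure_Int_subset_iff:
  assumes I: "ideal I" and K: "ideal K" and ab: "a \<in> carrier B" "b \<in> carrier D"
  shows "pure B D R a b \<inter> I \<subseteq> K \<longleftrightarrow> (\<forall>(x, y)\<in>I. (a \<sqinter>\<^bsub>B\<^esub> x, b \<sqinter>\<^bsub>D\<^esub> y) \<in> K)"
proof
  assume le: "pure B D R a b \<inter> I \<subseteq> K"
  show "\<forall>(x, y)\<in>I. (a \<sqinter>\<^bsub>B\<^esub> x, b \<sqinter>\<^bsub>D\<^esub> y) \<in> K"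
  proof clarify
    fix x y assume xy: "(x, y) \<in> I"
    have c: "x \<in> carrier B" "y \<in> carrier D" using ideal_carrier[OF I xy] by auto
    have "(a \<sqinter>\<^bsub>B\<^esub> x, b \<sqinter>\<^bsub>D\<^esub> y) \<in> pure B D R a b"
      by (rule ideal_down[OF ideal_pure[OF ab] pure_mem]) (use c ab in \<open>auto intro: B.meet_left D.meet_left\<close>)
    moreover have "(a \<sqinter>\<^bsub>B\<^esub> x, b \<sqinter>\<^bsub>D\<^esub> y) \<in> I"
      by (rule ideal_down[OF I xy]) (use c ab in \<open>auto intro: B.meet_right D.meet_right\<close>)
    ultimately show "(a \<sqinter>\<^bsub>B\<^esub> x, b \<sqinter>\<^bsub>D\<^esub> y) \<in> K" using le by blast
  qed
next
  assume le: "\<forall>(x, y)\<in>I. (a \<sqinter>\<^bsub>B\<^esub> x, b \<sqinter>\<^bsub>D\<^esub> y) \<in> K"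
  let ?H = "{(u, v). u \<in> carrier B \<and> v \<in> carrier D \<and>
    (\<forall>x y. (x, y) \<in> I \<longrightarrow> (u \<sqinter>\<^bsub>B\<^esub> x, v \<sqinter>\<^bsub>D\<^esub> y) \<in> K)}"
  have "ideal ?H" by (rule ideal_residual[OF K]) (use ideal_carrier[OF I] in auto)
  moreover have "(a, b) \<in> ?H" using le ab by auto
  ultimately have sub: "pure B D R a b \<subseteq> ?H" by (simp only: pure_le)
  show "pure B D R a b \<inter> I \<subseteq> K"
  proof clarify
    fix x y assume xy: "(x, y) \<in> pure B D R a b" "(x, y) \<in> I"
    have "(x \<sqinter>\<^bsub>B\<^esub> x, y \<sqinter>\<^bsub>D\<^esub> y) \<in> K" using subsetD[OF sub xy(1)] xy(2) by blast
    then show "(x, y) \<in> K" using ideal_carrier[OF I xy(2)] by simp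
  qed
qed

locale reflexive_span = frame A + Ob: frame Ob
  for A :: "'a gorder" (structure) and Ob :: "'b gorder" +
  fixes d r :: "'b \<Rightarrow> 'a" and u :: "'a \<Rightarrow> 'b"
  assumes d_map: "frame_map Ob A d" and r_map: "frame_map Ob A r" and u_map: "frame_map A Ob u"
    and u_d: "z \<in> carrier Ob \<Longrightarrow> u (d z) = z" and u_r: "z \<in> carrier Ob \<Longrightarrow> u (r z) = z"
begin

sublocale span: frame_span Ob A A d r
  by unfold_locales (rule d_map r_map)+

lemmas d_closed [simp] = frame_mapD(1)[OF d_map]
lemmas r_closed [simp] = frame_mapD(1)[OF r_map]
lemmas u_closed [simp] = frame_mapD(1)[OF u_map]

end

text \<open>The comultiplication \<open>m\<close> is stored as the family of bi-ideals
  \<open>{(x, y). x \<odot> y \<sqsubseteq> b}\<close>, so the operation \<open>\<odot>\<close> is the left adjoint of \<open>m\<close> on pure tensors. In this form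
  the laws of a category, which are equations between maps out of a tensor product, become
  elementary statements on \<open>\<odot>\<close>, and the two constructions share the translation. The last two
  assumptions express that source and target of a composite are those of its outer factors,
  together with the Frobenius law for \<open>m\<close>.\<close>

locale span_multiplication = reflexive_span A Ob d r u
  for A :: "'a gorder" (structure) and Ob :: "'b gorder" and d r :: "'b \<Rightarrow> 'a" and u :: "'a \<Rightarrow> 'b" +
  fixes mul :: "'a \<Rightarrow> 'a \<Rightarrow> 'a" (infixl \<open>\<odot>\<close> 75) and m :: "'a \<Rightarrow> ('a \<times> 'a) set"
  assumes mul_closed [simp]: "x \<in> carrier A \<Longrightarrow> y \<in> carrier A \<Longrightarrow> x \<odot> y \<in> carrier A"
    and m_ideal: "b \<in> carrier A \<Longrightarrow> span.ideal (m b)"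
    and m_mem: "b \<in> carrier A \<Longrightarrow> x \<in> carrier A \<Longrightarrow> y \<in> carrier A \<Longrightarrow> (x, y) \<in> m b \<longleftrightarrow> x \<odot> y \<sqsubseteq> b"
    and r_mul: "z \<in> carrier Ob \<Longrightarrow> x \<in> carrier A \<Longrightarrow> y \<in> carrier A \<Longrightarrow> (r z \<sqinter> x) \<odot> y = r z \<sqinter> (x \<odot> y)"
    and mul_d: "x \<in> carrier A \<Longrightarrow> y \<in> carrier A \<Longrightarrow> z \<in> carrier Ob \<Longrightarrow> x \<odot> (y \<sqinter> d z) = (x \<odot> y) \<sqinter> d z"
begin

abbreviation graph :: "('a, 'b) localic_data" where
  "graph \<equiv> \<lparr>arrows = A, objects = Ob, ustar = u, dstar = d, rstar = r, mstar = m\<rparr>"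

lemma m_carrier: "b \<in> carrier A \<Longrightarrow> (x, y) \<in> m b \<Longrightarrow> x \<in> carrier A \<and> y \<in> carrier A"
  by (rule span.ideal_carrier[OF m_ideal])

lemma m_eq:
  assumes b: "b \<in> carrier A"
  shows "m b = {(x, y). x \<in> carrier A \<and> y \<in> carrier A \<and> x \<odot> y \<sqsubseteq> b}" (is "_ = ?G")
proof (intro equalityI subrelI)
  show "(x, y) \<in> ?G" if "(x, y) \<in> m b" for x y using m_carrier[OF b that] m_mem[OF b] that by blast
  show "(x, y) \<in> m b" if "(x, y) \<in> ?G" for x y using m_mem[OF b] that by blast
qed

lemma mul_sup_right:
  assumes x: "x \<in> carrier A" and S: "S \<subseteq> carrier A"
  shows "x \<odot> \<Squnion>S = \<Squnion>((\<lambda>s. x \<odot> s) ` S)"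
proof (rule sup_eqI[symmetric])
  show "(\<lambda>s. x \<odot> s) ` S \<subseteq> carrier A" using x S by (intro image_subsetI mul_closed) auto
  show "x \<odot> \<Squnion>S \<in> carrier A" by (intro mul_closed x sup_closed S)
  fix b assume b: "b \<in> carrier A"
  have "x \<odot> \<Squnion>S \<sqsubseteq> b \<longleftrightarrow> (\<forall>s\<in>S. (x, s) \<in> m b)"
    unfolding m_mem[OF b x sup_closed[OF S], symmetric] by (rule span.ideal_sup2[OF m_ideal[OF b] x S])
  also have "\<dots> \<longleftrightarrow> (\<forall>y\<in>(\<lambda>s. x \<odot> s) ` S. y \<sqsubseteq> b)"
  proof -
    have "(x, s) \<in> m b \<longleftrightarrow> x \<odot> s \<sqsubseteq> b" if "s \<in> S" for s
      by (rule m_mem[OF b x subsetD[OF S that]])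
    then show ?thesis by simp
  qed
  finally show "x \<odot> \<Squnion>S \<sqsubseteq> b \<longleftrightarrow> (\<forall>y\<in>(\<lambda>s. x \<odot> s) ` S. y \<sqsubseteq> b)" .
qed

lemma mul_sup_left:
  assumes x: "x \<in> carrier A" and S: "S \<subseteq> carrier A"
  shows "\<Squnion>S \<odot> x = \<Squnion>((\<lambda>s. s \<odot> x) ` S)"
proof (rule sup_eqI[symmetric])
  show "(\<lambda>s. s \<odot> x) ` S \<subseteq> carrier A" using x S by (intro image_subsetI mul_closed) auto
  show "\<Squnion>S \<odot> x \<in> carrier A" by (intro mul_closed x sup_closed S)
  fix b assume b: "b \<in> carrier A"
  have "\<Squnion>S \<odot> x \<sqsubseteq> b \<longleftrightarrow> (\<forall>s\<in>S. (s, x) \<in> m b)"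
    unfolding m_mem[OF b sup_closed[OF S] x, symmetric] by (rule span.ideal_sup1[OF m_ideal[OF b] S x])
  also have "\<dots> \<longleftrightarrow> (\<forall>y\<in>(\<lambda>s. s \<odot> x) ` S. y \<sqsubseteq> b)"
  proof -
    have "(s, x) \<in> m b \<longleftrightarrow> s \<odot> x \<sqsubseteq> b" if "s \<in> S" for s
      by (rule m_mem[OF b subsetD[OF S that] x])
    then show ?thesis by simp
  qed
  finally show "\<Squnion>S \<odot> x \<sqsubseteq> b \<longleftrightarrow> (\<forall>y\<in>(\<lambda>s. s \<odot> x) ` S. y \<sqsubseteq> b)" .
qed

lemma mul_mono:
  assumes "x \<in> carrier A" "y \<in> carrier A" "x' \<in> carrier A" "y' \<in> carrier A" "x \<sqsubseteq> x'" "y \<sqsubseteq> y'"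
  shows "x \<odot> y \<sqsubseteq> x' \<odot> y'"
proof -
  have "(x', y') \<in> m (x' \<odot> y')" using assms by (simp add: m_mem)
  then have "(x, y) \<in> m (x' \<odot> y')"
    using span.ideal_down[OF m_ideal[of "x' \<odot> y'"], of x' y' x y] assms by simp
  then show ?thesis using assms by (simp add: m_mem)
qed

lemma mul_balanced:
  assumes "x \<in> carrier A" "y \<in> carrier A" "z \<in> carrier Ob"
  shows "(x \<sqinter> d z) \<odot> y = x \<odot> (r z \<sqinter> y)"
proof (rule eq_iff_same_upper)
  have c: "x \<sqinter> d z \<in> carrier A" "r z \<sqinter> y \<in> carrier A" using assms by simp_all
  then show "(x \<sqinter> d z) \<odot> y \<in> carrier A" "x \<odot> (r z \<sqinter> y) \<in> carrier A"
    using assms by simp_all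
  show "(x \<sqinter> d z) \<odot> y \<sqsubseteq> b \<longleftrightarrow> x \<odot> (r z \<sqinter> y) \<sqsubseteq> b" if b: "b \<in> carrier A" for b
    using span.ideal_R[OF m_ideal[OF b] span.pb_relI[OF assms]]
    unfolding m_mem[OF b c(1) assms(2)] m_mem[OF b assms(1) c(2)] .
qed

text \<open>The pullback of \<open>d\<close> along the identity is \<open>A\<close> itself: \<open>p1\<close> has the left inverse \<open>\<langle>id, d\<rangle>\<close>, and
  \<open>p2 (u y) = p1 (d (u y))\<close> moves the second factor to the first.\<close>

lemma right_unit_law_iff:
  "right_unit_law graph \<longleftrightarrow> (\<forall>a\<in>carrier A. \<Squnion>{x \<sqinter> d (u y) | x y. (x, y) \<in> m a} = a)"
proof -
  interpret S: frame_span Ob A Ob d id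
    by (intro frame_span.intro frame_span_axioms.intro frame_axioms Ob.frame_axioms d_map frame_map_id)
  have inj: "s = t" if "S.p1 s = S.p1 t" "s \<in> carrier A" "t \<in> carrier A" for s t
  proof -
    have "pairing A id d (S.p1 a) = id a" if "a \<in> carrier A" for a
      by (rule S.pairing_p1[OF frame_axioms frame_map_id[OF frame_axioms] d_map]) (simp_all add: that)
    from this[OF that(2)] this[OF that(3)] show "s = t" unfolding that(1) by simp
  qed
  have "pairing S.P S.p1 (S.p2 \<circ> u) (m a) = S.p1 a \<longleftrightarrow> \<Squnion>{x \<sqinter> d (u y) | x y. (x, y) \<in> m a} = a"
    if a: "a \<in> carrier A" for a
  proof -
    let ?X = "{x \<sqinter> d (u y) | x y. (x, y) \<in> m a}"
    have X: "?X \<subseteq> carrier A"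
    proof clarify
      fix x y assume "(x, y) \<in> m a"
      from m_carrier[OF a this] show "x \<sqinter> d (u y) \<in> carrier A" by simp
    qed
    have "{S.p1 x \<sqinter>\<^bsub>S.P\<^esub> (S.p2 \<circ> u) y | x y. (x, y) \<in> m a} = S.p1 ` ?X"
    proof (rule pair_image_cong)
      fix x y assume "(x, y) \<in> m a"
      from m_carrier[OF a this] show "S.p1 x \<sqinter>\<^bsub>S.P\<^esub> (S.p2 \<circ> u) y = S.p1 (x \<sqinter> d (u y))"
        using S.square_commutes[of "u y"] frame_mapD(4)[OF S.p1_map] by simp
    qed
    then have "pairing S.P S.p1 (S.p2 \<circ> u) (m a) = S.p1 (\<Squnion>?X)"
      unfolding pairing_def using frame_mapD(2)[OF S.p1_map X] by simp
    then show ?thesis using inj[of "\<Squnion>?X" a] sup_closed[OF X] a by auto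
  qed
  then show ?thesis by (simp add: right_unit_law_def Let_def)
qed

lemma left_unit_law_iff:
  "left_unit_law graph \<longleftrightarrow> (\<forall>a\<in>carrier A. \<Squnion>{r (u x) \<sqinter> y | x y. (x, y) \<in> m a} = a)"
proof -
  interpret S: frame_span Ob Ob A id r
    by (intro frame_span.intro frame_span_axioms.intro frame_axioms Ob.frame_axioms r_map frame_map_id)
  have inj: "s = t" if "S.p2 s = S.p2 t" "s \<in> carrier A" "t \<in> carrier A" for s t
  proof -
    have "pairing A r id (S.p2 a) = id a" if "a \<in> carrier A" for a
      by (rule S.pairing_p2[OF frame_axioms r_map frame_map_id[OF frame_axioms]]) (simp_all add: that)
    from this[OF that(2)] this[OF that(3)] show "s = t" unfolding that(1) by simp
  qed
  have "pairing S.P (S.p1 \<circ> u) S.p2 (m a) = S.p2 a \<longleftrightarrow> \<Squnion>{r (u x) \<sqinter> y | x y. (x, y) \<in> m a} = a"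
    if a: "a \<in> carrier A" for a
  proof -
    let ?X = "{r (u x) \<sqinter> y | x y. (x, y) \<in> m a}"
    have X: "?X \<subseteq> carrier A"
    proof clarify
      fix x y assume "(x, y) \<in> m a"
      from m_carrier[OF a this] show "r (u x) \<sqinter> y \<in> carrier A" by simp
    qed
    have "{(S.p1 \<circ> u) x \<sqinter>\<^bsub>S.P\<^esub> S.p2 y | x y. (x, y) \<in> m a} = S.p2 ` ?X"
    proof (rule pair_image_cong)
      fix x y assume "(x, y) \<in> m a"
      from m_carrier[OF a this] show "(S.p1 \<circ> u) x \<sqinter>\<^bsub>S.P\<^esub> S.p2 y = S.p2 (r (u x) \<sqinter> y)"
        using S.square_commutes[of "u x"] frame_mapD(4)[OF S.p2_map] by simp
    qed
    then have "pairing S.P (S.p1 \<circ> u) S.p2 (m a) = S.p2 (\<Squnion>?X)"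
      unfolding pairing_def using frame_mapD(2)[OF S.p2_map X] by simp
    then show ?thesis using inj[of "\<Squnion>?X" a] sup_closed[OF X] a by auto
  qed
  then show ?thesis by (simp add: left_unit_law_def Let_def)
qed

sublocale triples: frame_span Ob A "pullback Ob A A d r" d "proj1 Ob A A d r \<circ> r"
  by (intro frame_span.intro frame_span_axioms.intro frame_axioms Ob.frame_axioms span.frame_P d_map
      frame_map_comp[OF Ob.frame_axioms frame_axioms span.frame_P r_map span.p1_map])

text \<open>A ternary relation that is a bi-ideal in its last two arguments gives an open of the locale of
  composable triples. Applied to the two ways of bracketing, this is what separates the two
  sides of the associative law.\<close>

lemma ideal_triples:
  assumes tw: "\<And>s. s \<in> carrier A \<Longrightarrow> span.ideal {(t, w). t \<in> carrier A \<and> w \<in> carrier A \<and> W s t w}"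
    and sup: "\<And>S t w. S \<subseteq> carrier A \<Longrightarrow> t \<in> carrier A \<Longrightarrow> w \<in> carrier A \<Longrightarrow> W (\<Squnion>S) t w \<longleftrightarrow> (\<forall>s\<in>S. W s t w)"
    and bal: "\<And>s t w z. s \<in> carrier A \<Longrightarrow> t \<in> carrier A \<Longrightarrow> w \<in> carrier A \<Longrightarrow> z \<in> carrier Ob \<Longrightarrow>
       W (s \<sqinter> d z) t w \<longleftrightarrow> W s (r z \<sqinter> t) w"
  shows "triples.ideal {(s, I). s \<in> carrier A \<and> span.ideal I \<and> (\<forall>(t, w)\<in>I. W s t w)}" (is "triples.ideal ?E")
proof (rule triples.idealI)
  have E: "(s, I) \<in> ?E \<longleftrightarrow> I \<subseteq> {(t, w). t \<in> carrier A \<and> w \<in> carrier A \<and> W s t w}"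
    if "s \<in> carrier A" "span.ideal I" for s I
    using that span.ideal_carrier[OF that(2)] by auto
  show "?E \<subseteq> carrier A \<times> carrier span.P" by (auto simp: span.P_T)
  show "(\<Squnion>S, I) \<in> ?E \<longleftrightarrow> (\<forall>s\<in>S. (s, I) \<in> ?E)" if "S \<subseteq> carrier A" "I \<in> carrier span.P" for S I
  proof -
    have I: "span.ideal I" using that by (simp add: span.P_T)
    have "W (\<Squnion>S) t w \<longleftrightarrow> (\<forall>s\<in>S. W s t w)" if "(t, w) \<in> I" for t w
      using sup[OF \<open>S \<subseteq> carrier A\<close>] span.ideal_carrier[OF I that] by blast
    then have "(\<forall>(t, w)\<in>I. W (\<Squnion>S) t w) \<longleftrightarrow> (\<forall>s\<in>S. \<forall>(t, w)\<in>I. W s t w)" by blast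
    moreover have "\<forall>s\<in>S. s \<in> carrier A" "\<Squnion>S \<in> carrier A" using \<open>S \<subseteq> carrier A\<close> by auto
    ultimately show ?thesis using I by simp
  qed
  show "(s, \<Squnion>\<^bsub>span.P\<^esub>F) \<in> ?E \<longleftrightarrow> (\<forall>I\<in>F. (s, I) \<in> ?E)" if s: "s \<in> carrier A" and F: "F \<subseteq> carrier span.P" for s F
  proof -
    let ?K = "{(t, w). t \<in> carrier A \<and> w \<in> carrier A \<and> W s t w}"
    have F': "F \<subseteq> carrier span.T" using F by (simp only: span.P_T)
    have "span.ideal (\<Squnion>\<^bsub>span.T\<^esub>F)" using span.T.sup_closed[OF F'] by simp
    then have "(s, \<Squnion>\<^bsub>span.P\<^esub>F) \<in> ?E \<longleftrightarrow> \<Squnion>\<^bsub>span.T\<^esub>F \<subseteq> ?K" using E s by (simp add: span.P_T)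
    also have "\<dots> \<longleftrightarrow> (\<forall>I\<in>F. I \<subseteq> ?K)" using span.T.sup_le_iff[OF F', of ?K] tw[OF s] by simp
    also have "\<dots> \<longleftrightarrow> (\<forall>I\<in>F. (s, I) \<in> ?E)"
    proof (rule ball_cong[OF HOL.refl])
      fix I assume "I \<in> F"
      then have "span.ideal I" using F' by auto
      then show "I \<subseteq> ?K \<longleftrightarrow> (s, I) \<in> ?E" using E[OF s] by blast
    qed
    finally show ?thesis .
  qed
  fix p q assume "(p, q) \<in> triples.R"
  then obtain s I z where p: "p = (s \<sqinter> d z, I)" and q: "q = (s, (span.p1 \<circ> r) z \<sqinter>\<^bsub>span.P\<^esub> I)"
    and c: "s \<in> carrier A" "I \<in> carrier span.P" "z \<in> carrier Ob"
    unfolding pb_rel_def by blast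
  let ?K = "{(t, w). t \<in> carrier A \<and> w \<in> carrier A \<and> W s t w}"
  have I: "span.ideal I" using c by (simp add: span.P_T)
  have pi: "span.ideal (pure A A span.R (r z) \<top>)" using c by (intro span.ideal_pure) simp_all
  have q': "q = (s, pure A A span.R (r z) \<top> \<inter> I)"
    using q span.meet_T[OF pi I] by (simp add: span.P_T proj1_def)
  have "q \<in> ?E \<longleftrightarrow> pure A A span.R (r z) \<top> \<inter> I \<subseteq> ?K"
    unfolding q' using E[OF c(1) span.ideal_Int[OF pi I]] .
  also have "\<dots> \<longleftrightarrow> (\<forall>(t, w)\<in>I. (r z \<sqinter> t, \<top> \<sqinter> w) \<in> ?K)"
    using c by (intro span.pure_Int_subset_iff[OF I tw]) simp_all
  also have "\<dots> \<longleftrightarrow> (\<forall>(t, w)\<in>I. W (s \<sqinter> d z) t w)"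
  proof (intro ball_cong[OF HOL.refl], clarify)
    fix t w assume "(t, w) \<in> I"
    then have "t \<in> carrier A" "w \<in> carrier A" using span.ideal_carrier[OF I] by auto
    then show "(r z \<sqinter> t, \<top> \<sqinter> w) \<in> ?K \<longleftrightarrow> W (s \<sqinter> d z) t w" using c by (simp add: bal)
  qed
  also have "\<dots> \<longleftrightarrow> p \<in> ?E" using p c I by simp
  finally show "p \<in> ?E \<longleftrightarrow> q \<in> ?E" by simp
qed

text \<open>An open of the triples defined by a relation \<open>W\<close> remembers \<open>W\<close>, and it is generated by
  the pure tensors \<open>s \<otimes> (t \<otimes> w)\<close> with \<open>W s t w\<close>.\<close>

lemma pure_triple_mem:
  assumes "s \<in> carrier A" "t \<in> carrier A" "w \<in> carrier A"
    and W: "span.ideal {(t, w). t \<in> carrier A \<and> w \<in> carrier A \<and> W s t w}"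
  shows "(s, pure A A span.R t w) \<in> {(s, I). s \<in> carrier A \<and> span.ideal I \<and> (\<forall>(t, w)\<in>I. W s t w)}
    \<longleftrightarrow> W s t w"
proof -
  let ?K = "{(t, w). t \<in> carrier A \<and> w \<in> carrier A \<and> W s t w}"
  have I: "span.ideal (pure A A span.R t w)" using assms by (intro span.ideal_pure)
  have "(\<forall>(t', w')\<in>pure A A span.R t w. W s t' w') \<longleftrightarrow> pure A A span.R t w \<subseteq> ?K"
    using span.ideal_carrier[OF I] by blast
  also have "\<dots> \<longleftrightarrow> (t, w) \<in> ?K" by (rule span.pure_le[OF W])
  also have "\<dots> \<longleftrightarrow> W s t w" using assms(2,3) by simp
  finally show ?thesis using assms(1) I by simp
qed

lemma triples_ideal_le:
  assumes W: "\<And>s. s \<in> carrier A \<Longrightarrow> span.ideal {(t, w). t \<in> carrier A \<and> w \<in> carrier A \<and> W s t w}"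
    and J: "triples.ideal J"
    and gen: "\<And>s t w. s \<in> carrier A \<Longrightarrow> t \<in> carrier A \<Longrightarrow> w \<in> carrier A \<Longrightarrow> W s t w \<Longrightarrow>
      (s, pure A A span.R t w) \<in> J"
  shows "{(s, I). s \<in> carrier A \<and> span.ideal I \<and> (\<forall>(t, w)\<in>I. W s t w)} \<subseteq> J"
proof clarify
  fix s I assume s: "s \<in> carrier A" and I: "span.ideal I" and W: "\<forall>(t, w)\<in>I. W s t w"
  let ?F = "{pure A A span.R t w | t w. (t, w) \<in> I}"
  have "(s, pure A A span.R t w) \<in> J" if "(t, w) \<in> I" for t w
    using span.ideal_carrier[OF I that] W that by (intro gen s) auto
  then have "\<forall>K\<in>?F. (s, K) \<in> J" by blast
  then have "(s, \<Squnion>\<^bsub>span.P\<^esub>?F) \<in> J"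
    using triples.ideal_sup2[OF J s, of ?F] span.pure_family[OF I] unfolding span.P_T by blast
  then show "(s, I) \<in> J" using span.ideal_eq_sup_pure[OF I] by (simp only: span.P_T)
qed

text \<open>Besides the two bracketings of a product, \<open>h\<close> will be a meet of one argument with the image of the
  other under a direct and an inverse image.\<close>

lemma ideal_mul_le:
  assumes "s \<in> carrier A" "a \<in> carrier A"
    and h: "\<And>t w. t \<in> carrier A \<Longrightarrow> w \<in> carrier A \<Longrightarrow> h t w \<in> carrier A"
    and sup1: "\<And>S w. S \<subseteq> carrier A \<Longrightarrow> w \<in> carrier A \<Longrightarrow> h (\<Squnion>S) w = \<Squnion>((\<lambda>t. h t w) ` S)"
    and sup2: "\<And>S t. S \<subseteq> carrier A \<Longrightarrow> t \<in> carrier A \<Longrightarrow> h t (\<Squnion>S) = \<Squnion>((\<lambda>w. h t w) ` S)"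
    and bal: "\<And>t w z. t \<in> carrier A \<Longrightarrow> w \<in> carrier A \<Longrightarrow> z \<in> carrier Ob \<Longrightarrow> h (t \<sqinter> d z) w = h t (r z \<sqinter> w)"
  shows "span.ideal {(t, w). t \<in> carrier A \<and> w \<in> carrier A \<and> h t w \<sqsubseteq> a}" (is "span.ideal ?K")
proof (rule span.idealI)
  show "?K \<subseteq> carrier A \<times> carrier A" by auto
  show "(\<Squnion>S, w) \<in> ?K \<longleftrightarrow> (\<forall>t\<in>S. (t, w) \<in> ?K)" if S: "S \<subseteq> carrier A" "w \<in> carrier A" for S w
  proof -
    have "(\<lambda>t. h t w) ` S \<subseteq> carrier A" using S by (intro image_subsetI h) auto
    then have "h (\<Squnion>S) w \<sqsubseteq> a \<longleftrightarrow> (\<forall>t\<in>S. h t w \<sqsubseteq> a)"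
      by (simp add: sup1[OF S] sup_le_iff[OF _ assms(2)])
    then show ?thesis using S by (simp add: subset_iff)
  qed
  show "(t, \<Squnion>S) \<in> ?K \<longleftrightarrow> (\<forall>w\<in>S. (t, w) \<in> ?K)" if S: "t \<in> carrier A" "S \<subseteq> carrier A" for t S
  proof -
    have "(\<lambda>w. h t w) ` S \<subseteq> carrier A" using S by (intro image_subsetI h) auto
    then have "h t (\<Squnion>S) \<sqsubseteq> a \<longleftrightarrow> (\<forall>w\<in>S. h t w \<sqsubseteq> a)"
      by (simp add: sup2[OF S(2,1)] sup_le_iff[OF _ assms(2)])
    then show ?thesis using S by (simp add: subset_iff)
  qed
  fix p q assume "(p, q) \<in> span.R"
  then obtain t w z where "p = (t \<sqinter> d z, w)" "q = (t, r z \<sqinter> w)"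
    and "t \<in> carrier A" "w \<in> carrier A" "z \<in> carrier Ob"
    unfolding pb_rel_def by blast
  then show "p \<in> ?K \<longleftrightarrow> q \<in> ?K" by (simp add: bal)
qed

lemma ideal_bracket_right:
  assumes "s \<in> carrier A" "a \<in> carrier A"
  shows "span.ideal {(t, w). t \<in> carrier A \<and> w \<in> carrier A \<and> s \<odot> (t \<odot> w) \<sqsubseteq> a}"
proof (rule ideal_mul_le[OF assms])
  fix S x assume S: "S \<subseteq> carrier A" and x: "x \<in> carrier A"
  have "(\<lambda>t. t \<odot> x) ` S \<subseteq> carrier A" using S x by (intro image_subsetI mul_closed) auto
  then show "s \<odot> (\<Squnion>S \<odot> x) = \<Squnion>((\<lambda>t. s \<odot> (t \<odot> x)) ` S)"
    using assms S x by (simp add: mul_sup_left mul_sup_right image_image)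
  have "(\<lambda>w. x \<odot> w) ` S \<subseteq> carrier A" using S x by (intro image_subsetI mul_closed) auto
  then show "s \<odot> (x \<odot> \<Squnion>S) = \<Squnion>((\<lambda>w. s \<odot> (x \<odot> w)) ` S)"
    using assms S x by (simp add: mul_sup_right image_image)
qed (use assms in \<open>simp_all add: mul_balanced\<close>)

lemma ideal_bracket_left:
  assumes "s \<in> carrier A" "a \<in> carrier A"
  shows "span.ideal {(t, w). t \<in> carrier A \<and> w \<in> carrier A \<and> (s \<odot> t) \<odot> w \<sqsubseteq> a}"
proof (rule ideal_mul_le[OF assms])
  fix S x assume S: "S \<subseteq> carrier A" and x: "x \<in> carrier A"
  have "(\<lambda>t. s \<odot> t) ` S \<subseteq> carrier A" using S assms by (intro image_subsetI mul_closed) auto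
  then show "(s \<odot> \<Squnion>S) \<odot> x = \<Squnion>((\<lambda>t. (s \<odot> t) \<odot> x) ` S)"
    using assms S x by (simp add: mul_sup_left mul_sup_right image_image)
  show "(s \<odot> x) \<odot> \<Squnion>S = \<Squnion>((\<lambda>w. (s \<odot> x) \<odot> w) ` S)"
    using assms S x by (simp add: mul_sup_right)
next
  fix t w z assume c: "t \<in> carrier A" "w \<in> carrier A" "z \<in> carrier Ob"
  have "s \<odot> (t \<sqinter> d z) = (s \<odot> t) \<sqinter> d z" using c assms by (intro mul_d)
  then show "s \<odot> (t \<sqinter> d z) \<odot> w = s \<odot> t \<odot> (r z \<sqinter> w)"
    using c assms by (simp add: mul_balanced)
qed (use assms in simp_all)

text \<open>The inverse images of \<open>a\<close> under \<open>m (id \<times> m)\<close> and \<open>m (m \<times> id)\<close>.\<close>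

abbreviation (input) right_bracket :: "'a \<Rightarrow> ('a \<times> ('a \<times> 'a) set) set" where
  "right_bracket a \<equiv> {(s, I). s \<in> carrier A \<and> span.ideal I \<and> (\<forall>(t, w)\<in>I. s \<odot> (t \<odot> w) \<sqsubseteq> a)}"

abbreviation (input) left_bracket :: "'a \<Rightarrow> ('a \<times> ('a \<times> 'a) set) set" where
  "left_bracket a \<equiv> {(s, I). s \<in> carrier A \<and> span.ideal I \<and> (\<forall>(t, w)\<in>I. (s \<odot> t) \<odot> w \<sqsubseteq> a)}"

lemma ideal_right_bracket:
  assumes a: "a \<in> carrier A"
  shows "triples.ideal (right_bracket a)"
proof (rule ideal_triples)
  show "span.ideal {(t, w). t \<in> carrier A \<and> w \<in> carrier A \<and> s \<odot> (t \<odot> w) \<sqsubseteq> a}"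
    if "s \<in> carrier A" for s using ideal_bracket_right[OF that a] .
  show "\<Squnion>S \<odot> (t \<odot> w) \<sqsubseteq> a \<longleftrightarrow> (\<forall>s\<in>S. s \<odot> (t \<odot> w) \<sqsubseteq> a)"
    if S: "S \<subseteq> carrier A" "t \<in> carrier A" "w \<in> carrier A" for S t w
  proof -
    have "(\<lambda>s. s \<odot> (t \<odot> w)) ` S \<subseteq> carrier A" using S by (intro image_subsetI mul_closed) auto
    then show ?thesis using S a by (simp add: mul_sup_left sup_le_iff)
  qed
  show "(s \<sqinter> d z) \<odot> (t \<odot> w) \<sqsubseteq> a \<longleftrightarrow> s \<odot> ((r z \<sqinter> t) \<odot> w) \<sqsubseteq> a"
    if "s \<in> carrier A" "t \<in> carrier A" "w \<in> carrier A" "z \<in> carrier Ob" for s t w z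
    using that by (simp add: mul_balanced r_mul)
qed

lemma ideal_left_bracket:
  assumes a: "a \<in> carrier A"
  shows "triples.ideal (left_bracket a)"
proof (rule ideal_triples)
  show "span.ideal {(t, w). t \<in> carrier A \<and> w \<in> carrier A \<and> (s \<odot> t) \<odot> w \<sqsubseteq> a}"
    if "s \<in> carrier A" for s using ideal_bracket_left[OF that a] .
  show "(\<Squnion>S \<odot> t) \<odot> w \<sqsubseteq> a \<longleftrightarrow> (\<forall>s\<in>S. (s \<odot> t) \<odot> w \<sqsubseteq> a)"
    if S: "S \<subseteq> carrier A" "t \<in> carrier A" "w \<in> carrier A" for S t w
  proof -
    have st: "(\<lambda>s. s \<odot> t) ` S \<subseteq> carrier A" using S by (intro image_subsetI mul_closed) auto
    have "(\<lambda>s. (s \<odot> t) \<odot> w) ` S \<subseteq> carrier A" using S by (intro image_subsetI mul_closed) auto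
    then show ?thesis using S a st by (simp add: mul_sup_left image_image sup_le_iff)
  qed
  show "((s \<sqinter> d z) \<odot> t) \<odot> w \<sqsubseteq> a \<longleftrightarrow> (s \<odot> (r z \<sqinter> t)) \<odot> w \<sqsubseteq> a"
    if "s \<in> carrier A" "t \<in> carrier A" "w \<in> carrier A" "z \<in> carrier Ob" for s t w z
    using that by (simp add: mul_balanced)
qed

lemma m_mul_mem: "t \<in> carrier A \<Longrightarrow> w \<in> carrier A \<Longrightarrow> (t, w) \<in> m (t \<odot> w)"
  by (simp add: m_mem)

lemma le_triples: "I \<sqsubseteq>\<^bsub>triples.P\<^esub> J \<longleftrightarrow> I \<subseteq> J" "carrier triples.P = {I. triples.ideal I}"
  by (simp_all add: triples.P_T)

text \<open>Among the pairs \<open>(s, I)\<close> with \<open>s \<otimes> I\<close> below the inverse image, the generators are those of the form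
  \<open>(x, m y)\<close> with \<open>x \<odot> y \<sqsubseteq> a\<close>; the pure tensor \<open>t \<otimes> w\<close> enters through \<open>y = t \<odot> w\<close>, the least \<open>y\<close> for which \<open>m y\<close>
  contains it.\<close>

lemma pairing_right_bracket:
  assumes a: "a \<in> carrier A"
  shows "pairing triples.P triples.p1 (triples.p2 \<circ> m) (m a) = right_bracket a" (is "?L = ?E")
proof
  interpret TP: frame triples.P by (rule triples.frame_P)
  let ?X = "{triples.p1 x \<sqinter>\<^bsub>triples.P\<^esub> (triples.p2 \<circ> m) y | x y. (x, y) \<in> m a}"
  note E = ideal_right_bracket[OF a]
  have mc: "m y \<in> carrier span.P" if "y \<in> carrier A" for y
    using m_ideal[OF that] by (simp add: span.P_T)
  have pure: "triples.p1 x \<sqinter>\<^bsub>triples.P\<^esub> (triples.p2 \<circ> m) y = pure A span.P triples.R x (m y)"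
    if "x \<in> carrier A" "y \<in> carrier A" for x y
    using triples.pure_eq_meet[OF that(1) mc[OF that(2)]] by simp
  have X: "?X \<subseteq> carrier triples.P"
  proof clarify
    fix x y assume xy: "(x, y) \<in> m a"
    then have c: "x \<in> carrier A" "y \<in> carrier A" using m_carrier[OF a xy] by blast+
    show "triples.p1 x \<sqinter>\<^bsub>triples.P\<^esub> (triples.p2 \<circ> m) y \<in> carrier triples.P"
      unfolding pure[OF c] le_triples using triples.ideal_pure[OF c(1) mc[OF c(2)]] by simp
  qed
  have LX: "?L = \<Squnion>\<^bsub>triples.P\<^esub>?X" by (simp add: pairing_def)
  have "?L \<sqsubseteq>\<^bsub>triples.P\<^esub> ?E"
    unfolding LX
  proof (rule TP.sup_least[OF X])
    show "?E \<in> carrier triples.P" using E by (simp add: le_triples)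
    fix K assume "K \<in> ?X"
    then obtain x y where K: "K = triples.p1 x \<sqinter>\<^bsub>triples.P\<^esub> (triples.p2 \<circ> m) y" and xy: "(x, y) \<in> m a"
      by blast
    have c: "x \<in> carrier A" "y \<in> carrier A" using m_carrier[OF a xy] by blast+
    have le: "x \<odot> y \<sqsubseteq> a" using m_mem[OF a c] xy by blast
    have "x \<odot> (t \<odot> w) \<sqsubseteq> a" if "(t, w) \<in> m y" for t w
    proof -
      have tw: "t \<in> carrier A" "w \<in> carrier A" using m_carrier[OF c(2) that] by blast+
      have "t \<odot> w \<sqsubseteq> y" using m_mem[OF c(2) tw] that by blast
      then have "x \<odot> (t \<odot> w) \<sqsubseteq> x \<odot> y" using c tw by (intro mul_mono) simp_all
      then show ?thesis by (rule le_trans[OF _ le]) (use c tw a in simp_all)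
    qed
    then have "(x, m y) \<in> ?E" using c m_ideal[OF c(2)] by blast
    then show "K \<sqsubseteq>\<^bsub>triples.P\<^esub> ?E" unfolding K pure[OF c] le_triples triples.pure_le[OF E] .
  qed
  then show "?L \<subseteq> ?E" by (simp only: le_triples)
  have J: "triples.ideal ?L" using TP.sup_closed[OF X] LX by (simp add: le_triples)
  show "?E \<subseteq> ?L"
  proof (rule triples_ideal_le[OF _ J])
    show "span.ideal {(t, w). t \<in> carrier A \<and> w \<in> carrier A \<and> s \<odot> (t \<odot> w) \<sqsubseteq> a}"
      if "s \<in> carrier A" for s using ideal_bracket_right[OF that a] .
    fix s t w assume c: "s \<in> carrier A" "t \<in> carrier A" "w \<in> carrier A" and le: "s \<odot> (t \<odot> w) \<sqsubseteq> a"
    have tw: "t \<odot> w \<in> carrier A" using c by simp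
    have "(s, t \<odot> w) \<in> m a" using m_mem[OF a c(1) tw] le by blast
    then have "triples.p1 s \<sqinter>\<^bsub>triples.P\<^esub> (triples.p2 \<circ> m) (t \<odot> w) \<in> ?X" by blast
    from TP.sup_upper[OF X this] have "pure A span.P triples.R s (m (t \<odot> w)) \<subseteq> ?L"
      unfolding LX pure[OF c(1) tw] le_triples .
    then have "(s, m (t \<odot> w)) \<in> ?L" unfolding triples.pure_le[OF J] .
    moreover have "pure A A span.R t w \<subseteq> m (t \<odot> w)"
      unfolding span.pure_le[OF m_ideal[OF tw]] using c by (intro m_mul_mem)
    ultimately show "(s, pure A A span.R t w) \<in> ?L"
      using triples.ideal_down[OF J _ c(1), of s "m (t \<odot> w)" "pure A A span.R t w"] c
        span.ideal_pure[OF c(2,3)] by (simp add: span.P_T)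
  qed
qed

lemma triple_meet:
  assumes "s \<in> carrier A" "t \<in> carrier A" "w \<in> carrier A"
  shows "(triples.p1 s \<sqinter>\<^bsub>triples.P\<^esub> triples.p2 (span.p1 t)) \<sqinter>\<^bsub>triples.P\<^esub> triples.p2 (span.p2 w) =
    pure A span.P triples.R s (pure A A span.R t w)"
proof -
  interpret TP: frame triples.P by (rule triples.frame_P)
  have c: "span.p1 t \<in> carrier span.P" "span.p2 w \<in> carrier span.P"
    using assms frame_mapD(1)[OF span.p1_map] frame_mapD(1)[OF span.p2_map] by blast+
  have c': "triples.p1 s \<in> carrier triples.P" "triples.p2 (span.p1 t) \<in> carrier triples.P"
    "triples.p2 (span.p2 w) \<in> carrier triples.P"
    using assms c frame_mapD(1)[OF triples.p1_map] frame_mapD(1)[OF triples.p2_map] by blast+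
  have "triples.p2 (pure A A span.R t w) = triples.p2 (span.p1 t) \<sqinter>\<^bsub>triples.P\<^esub> triples.p2 (span.p2 w)"
    unfolding span.pure_eq_meet[OF assms(2,3)] by (rule frame_mapD(4)[OF triples.p2_map c])
  moreover have "pure A A span.R t w \<in> carrier span.P"
    using span.ideal_pure[OF assms(2,3)] by (simp add: span.P_T)
  ultimately show ?thesis
    using triples.pure_eq_meet[OF assms(1), of "pure A A span.R t w"] TP.meet_assoc[OF c'] by simp
qed

text \<open>The same argument with \<open>x = s \<odot> t\<close>. Here \<open>m x\<close> first has to be pulled back to the triples
  along \<open>m \<times> id\<close>, which makes the generators joins that are expanded with the frame law.\<close>

lemma pairing_left_bracket:
  assumes a: "a \<in> carrier A"
  shows "pairing triples.P (pairing triples.P triples.p1 (triples.p2 \<circ> span.p1) \<circ> m)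
      (triples.p2 \<circ> span.p2) (m a) = left_bracket a" (is "?L = ?E")
proof
  interpret TP: frame triples.P by (rule triples.frame_P)
  let ?N = "\<lambda>x. pairing triples.P triples.p1 (triples.p2 \<circ> span.p1) (m x)"
  let ?Y = "\<lambda>x. {triples.p1 s \<sqinter>\<^bsub>triples.P\<^esub> triples.p2 (span.p1 t) | s t. (s, t) \<in> m x}"
  let ?X = "{?N x \<sqinter>\<^bsub>triples.P\<^esub> triples.p2 (span.p2 y) | x y. (x, y) \<in> m a}"
  note E = ideal_left_bracket[OF a]
  have p2: "triples.p2 (span.p2 y) \<in> carrier triples.P" if "y \<in> carrier A" for y
    using that frame_mapD(1)[OF span.p2_map] frame_mapD(1)[OF triples.p2_map] by blast
  have Y: "?Y x \<subseteq> carrier triples.P" if "x \<in> carrier A" for x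
  proof clarify
    fix s t assume st: "(s, t) \<in> m x"
    then have "s \<in> carrier A" "t \<in> carrier A" using m_carrier[OF that st] by blast+
    then show "triples.p1 s \<sqinter>\<^bsub>triples.P\<^esub> triples.p2 (span.p1 t) \<in> carrier triples.P"
      using frame_mapD(1)[OF span.p1_map] frame_mapD(1)[OF triples.p1_map] frame_mapD(1)[OF triples.p2_map]
      by (intro TP.meet_closed) blast+
  qed
  have N: "?N x = \<Squnion>\<^bsub>triples.P\<^esub>(?Y x)" for x by (simp add: pairing_def)
  have Nc: "?N x \<in> carrier triples.P" if "x \<in> carrier A" for x
    unfolding N using TP.sup_closed[OF Y[OF that]] .
  have X: "?X \<subseteq> carrier triples.P"
  proof clarify
    fix x y assume xy: "(x, y) \<in> m a"
    then have c: "x \<in> carrier A" "y \<in> carrier A" using m_carrier[OF a xy] by blast+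
    show "?N x \<sqinter>\<^bsub>triples.P\<^esub> triples.p2 (span.p2 y) \<in> carrier triples.P"
      by (rule TP.meet_closed[OF Nc[OF c(1)] p2[OF c(2)]])
  qed
  have LX: "?L = \<Squnion>\<^bsub>triples.P\<^esub>?X" by (simp add: pairing_def)
  have Ec: "?E \<in> carrier triples.P" using E by (simp add: le_triples)
  have "?L \<sqsubseteq>\<^bsub>triples.P\<^esub> ?E"
    unfolding LX
  proof (rule TP.sup_least[OF X Ec])
    fix K assume "K \<in> ?X"
    then obtain x y where K: "K = ?N x \<sqinter>\<^bsub>triples.P\<^esub> triples.p2 (span.p2 y)" and xy: "(x, y) \<in> m a"
      by blast
    have c: "x \<in> carrier A" "y \<in> carrier A" using m_carrier[OF a xy] by blast+
    have le: "x \<odot> y \<sqsubseteq> a" using m_mem[OF a c] xy by blast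
    let ?Z = "(\<lambda>n. n \<sqinter>\<^bsub>triples.P\<^esub> triples.p2 (span.p2 y)) ` ?Y x"
    have Z: "?Z \<subseteq> carrier triples.P" using Y[OF c(1)] p2[OF c(2)] by (intro image_subsetI TP.meet_closed) blast+
    have KZ: "K = \<Squnion>\<^bsub>triples.P\<^esub>?Z" unfolding K N by (rule TP.frame_distrib'[OF p2[OF c(2)] Y[OF c(1)]])
    show "K \<sqsubseteq>\<^bsub>triples.P\<^esub> ?E"
      unfolding KZ
    proof (rule TP.sup_least[OF Z Ec])
      fix n assume "n \<in> ?Z"
      then obtain s t where n: "n = (triples.p1 s \<sqinter>\<^bsub>triples.P\<^esub> triples.p2 (span.p1 t)) \<sqinter>\<^bsub>triples.P\<^esub>
        triples.p2 (span.p2 y)" and st: "(s, t) \<in> m x" by blast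
      have c': "s \<in> carrier A" "t \<in> carrier A" using m_carrier[OF c(1) st] by blast+
      have "s \<odot> t \<sqsubseteq> x" using m_mem[OF c(1) c'] st by blast
      then have "s \<odot> t \<odot> y \<sqsubseteq> x \<odot> y" using c c' by (intro mul_mono) simp_all
      then have "s \<odot> t \<odot> y \<sqsubseteq> a" by (rule le_trans[OF _ le]) (use c c' a in simp_all)
      then have "(s, pure A A span.R t y) \<in> ?E"
        using pure_triple_mem[where W = "\<lambda>s t w. (s \<odot> t) \<odot> w \<sqsubseteq> a", OF c' c(2) ideal_bracket_left[OF c'(1) a]] by blast
      then show "n \<sqsubseteq>\<^bsub>triples.P\<^esub> ?E"
        unfolding n triple_meet[OF c' c(2)] le_triples triples.pure_le[OF E] .
    qed
  qed
  then show "?L \<subseteq> ?E" by (simp only: le_triples)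
  have J: "triples.ideal ?L" using TP.sup_closed[OF X] LX by (simp add: le_triples)
  show "?E \<subseteq> ?L"
  proof (rule triples_ideal_le[OF _ J])
    show "span.ideal {(t, w). t \<in> carrier A \<and> w \<in> carrier A \<and> s \<odot> t \<odot> w \<sqsubseteq> a}"
      if "s \<in> carrier A" for s using ideal_bracket_left[OF that a] .
    fix s t w assume c: "s \<in> carrier A" "t \<in> carrier A" "w \<in> carrier A" and le: "s \<odot> t \<odot> w \<sqsubseteq> a"
    have st: "s \<odot> t \<in> carrier A" using c by simp
    have "(s \<odot> t, w) \<in> m a" using m_mem[OF a st c(3)] le by blast
    then have inX: "?N (s \<odot> t) \<sqinter>\<^bsub>triples.P\<^esub> triples.p2 (span.p2 w) \<in> ?X" by blast
    have "(s, t) \<in> m (s \<odot> t)" using c by (intro m_mul_mem)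
    then have inY: "triples.p1 s \<sqinter>\<^bsub>triples.P\<^esub> triples.p2 (span.p1 t) \<in> ?Y (s \<odot> t)" by blast
    then have sY: "triples.p1 s \<sqinter>\<^bsub>triples.P\<^esub> triples.p2 (span.p1 t) \<sqsubseteq>\<^bsub>triples.P\<^esub> ?N (s \<odot> t)"
      unfolding N by (rule TP.sup_upper[OF Y[OF st]])
    have "pure A span.P triples.R s (pure A A span.R t w) \<sqsubseteq>\<^bsub>triples.P\<^esub>
        ?N (s \<odot> t) \<sqinter>\<^bsub>triples.P\<^esub> triples.p2 (span.p2 w)"
      unfolding triple_meet[OF c, symmetric]
      using sY subsetD[OF Y[OF st] inY] Nc[OF st] p2[OF c(3)] by (intro TP.meet_mono) simp_all
    moreover have "\<dots> \<sqsubseteq>\<^bsub>triples.P\<^esub> ?L" unfolding LX by (rule TP.sup_upper[OF X inX])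
    ultimately have "pure A span.P triples.R s (pure A A span.R t w) \<subseteq> ?L"
      by (simp only: le_triples)
    then show "(s, pure A A span.R t w) \<in> ?L" unfolding triples.pure_le[OF J] .
  qed
qed

lemma assoc_law_iff:
  "assoc_law graph \<longleftrightarrow>
    (\<forall>s\<in>carrier A. \<forall>t\<in>carrier A. \<forall>w\<in>carrier A. (s \<odot> t) \<odot> w = s \<odot> (t \<odot> w))"
proof -
  have "assoc_law graph \<longleftrightarrow> (\<forall>a\<in>carrier A. right_bracket a = left_bracket a)"
    unfolding assoc_law_def Let_def
    by (simp add: composable_def pi1_def pi2_def pairing_right_bracket pairing_left_bracket)
  also have "\<dots> \<longleftrightarrow> (\<forall>s\<in>carrier A. \<forall>t\<in>carrier A. \<forall>w\<in>carrier A. (s \<odot> t) \<odot> w = s \<odot> (t \<odot> w))"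
  proof (intro iffI ballI)
    fix s t w assume eq: "\<forall>a\<in>carrier A. right_bracket a = left_bracket a"
      and c: "s \<in> carrier A" "t \<in> carrier A" "w \<in> carrier A"
    show "(s \<odot> t) \<odot> w = s \<odot> (t \<odot> w)"
    proof (rule eq_iff_same_upper)
      fix a assume a: "a \<in> carrier A"
      show "(s \<odot> t) \<odot> w \<sqsubseteq> a \<longleftrightarrow> s \<odot> (t \<odot> w) \<sqsubseteq> a"
        using pure_triple_mem[where W = "\<lambda>s t w. s \<odot> (t \<odot> w) \<sqsubseteq> a", OF c ideal_bracket_right[OF c(1) a]]
        unfolding bspec[OF eq a]
          pure_triple_mem[where W = "\<lambda>s t w. (s \<odot> t) \<odot> w \<sqsubseteq> a", OF c ideal_bracket_left[OF c(1) a]] .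
    qed (use c in simp_all)
  next
    fix a assume eq: "\<forall>s\<in>carrier A. \<forall>t\<in>carrier A. \<forall>w\<in>carrier A. (s \<odot> t) \<odot> w = s \<odot> (t \<odot> w)"
      and a: "a \<in> carrier A"
    have "(\<forall>(t, w)\<in>I. s \<odot> (t \<odot> w) \<sqsubseteq> a) \<longleftrightarrow> (\<forall>(t, w)\<in>I. (s \<odot> t) \<odot> w \<sqsubseteq> a)"
      if "s \<in> carrier A" "span.ideal I" for s I
    proof (intro ball_cong[OF HOL.refl], clarify)
      fix t w assume "(t, w) \<in> I"
      then have "t \<in> carrier A" "w \<in> carrier A" using span.ideal_carrier[OF that(2)] by blast+
      then show "s \<odot> (t \<odot> w) \<sqsubseteq> a \<longleftrightarrow> (s \<odot> t) \<odot> w \<sqsubseteq> a" using eq that(1) by simp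
    qed
    then show "right_bracket a = left_bracket a"
      by (intro Collect_cong prod.case_cong HOL.refl conj_cong)
  qed
  finally show ?thesis .
qed

end

section \<open>Supports and partial isometries in a quantal frame\<close>

context ehresmann_quantal_frame
begin

lemma down_unit_simps [simp]:
  "f \<in> carrier (down Q \<e>) \<longleftrightarrow> f \<in> carrier Q \<and> f \<sqsubseteq> \<e>" "f \<sqsubseteq>\<^bsub>down Q \<e>\<^esub> g \<longleftrightarrow> f \<sqsubseteq> g"
  by (simp_all add: down_def)

lemma mult_below_unit:
  assumes "a \<in> carrier Q" "f \<in> carrier Q" "f \<sqsubseteq> \<e>"
  shows "a \<cdot> f \<sqsubseteq> a" "f \<cdot> a \<sqsubseteq> a"
  using qmult_mono[of a a f \<e>] qmult_mono[of f \<e> a a] assms qunit_closed qunit_right qunit_left by simp_all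

lemma unit_meet:
  assumes "f \<in> carrier Q" "f \<sqsubseteq> \<e>" "g \<in> carrier Q" "g \<sqsubseteq> \<e>"
  shows "f \<sqinter> g = f \<cdot> g"
proof (rule le_antisym)
  have c: "f \<sqinter> g \<in> carrier Q" "f \<sqinter> g \<sqsubseteq> f" "f \<sqinter> g \<sqsubseteq> g" using assms meet_left meet_right by simp_all
  then have "f \<sqinter> g \<sqsubseteq> \<e>" using assms qunit_closed le_trans by metis
  then have "f \<sqinter> g = (f \<sqinter> g) \<cdot> (f \<sqinter> g)" using c mult_lam[of "f \<sqinter> g"] lam_proj[of "f \<sqinter> g"] by simp
  also have "\<dots> \<sqsubseteq> f \<cdot> g" using c assms by (intro qmult_mono) simp_all
  finally show "f \<sqinter> g \<sqsubseteq> f \<cdot> g" .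
  show "f \<cdot> g \<sqsubseteq> f \<sqinter> g"
    using mult_below_unit[of f g] mult_below_unit[of g f] assms qmult_closed by (intro meet_le) simp_all
qed (use assms qmult_closed in simp_all)

lemma unit_mult_below: "f \<in> carrier Q \<Longrightarrow> f \<sqsubseteq> \<e> \<Longrightarrow> g \<in> carrier Q \<Longrightarrow> g \<sqsubseteq> \<e> \<Longrightarrow> f \<cdot> g \<sqsubseteq> \<e>"
  using mult_below_unit(2)[of g f] le_trans[of "f \<cdot> g" g \<e>] qmult_closed qunit_closed by simp

text \<open>The support \<open>\<lambda>\<close> is the direct image along the source map \<open>d\<close> of \<open>\<C>(Q)\<close>, and \<open>\<rho>\<close> along the
  target map.\<close>

lemma lam_adj:
  assumes "a \<in> carrier Q" "f \<in> carrier Q" "f \<sqsubseteq> \<e>"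
  shows "lam Q a \<sqsubseteq> f \<longleftrightarrow> a \<sqsubseteq> \<top> \<cdot> f"
proof
  assume "lam Q a \<sqsubseteq> f"
  then have "a \<cdot> lam Q a \<sqsubseteq> \<top> \<cdot> f" using assms lam_closed by (intro qmult_mono) simp_all
  then show "a \<sqsubseteq> \<top> \<cdot> f" using mult_lam[OF assms(1)] by simp
next
  assume "a \<sqsubseteq> \<top> \<cdot> f"
  then have "lam Q a \<sqsubseteq> lam Q (\<top> \<cdot> f)" using assms qmult_closed by (intro lam_mono) simp_all
  also have "lam Q (\<top> \<cdot> f) = f" using assms lam_mult[of \<top> f] lam_top qunit_left lam_proj by simp
  finally show "lam Q a \<sqsubseteq> f" .
qed

lemma rho_adj:
  assumes "a \<in> carrier Q" "f \<in> carrier Q" "f \<sqsubseteq> \<e>"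
  shows "rho Q a \<sqsubseteq> f \<longleftrightarrow> a \<sqsubseteq> f \<cdot> \<top>"
proof
  assume "rho Q a \<sqsubseteq> f"
  then have "rho Q a \<cdot> a \<sqsubseteq> f \<cdot> \<top>" using assms rho_closed by (intro qmult_mono) simp_all
  then show "a \<sqsubseteq> f \<cdot> \<top>" using rho_mult[OF assms(1)] by simp
next
  assume "a \<sqsubseteq> f \<cdot> \<top>"
  then have "rho Q a \<sqsubseteq> rho Q (f \<cdot> \<top>)" using assms qmult_closed by (intro rho_mono) simp_all
  also have "rho Q (f \<cdot> \<top>) = f" using assms rho_mult_rho[of f \<top>] rho_top qunit_right rho_proj by simp
  finally show "rho Q a \<sqsubseteq> f" .
qed

lemma lam_mult_unit: "a \<in> carrier Q \<Longrightarrow> f \<in> carrier Q \<Longrightarrow> f \<sqsubseteq> \<e> \<Longrightarrow> lam Q (a \<cdot> f) = lam Q a \<cdot> f"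
  using lam_mult[of a f] lam_closed[of a] unit_mult_below[of "lam Q a" f] lam_proj[of "lam Q a \<cdot> f"] qmult_closed
  by simp

lemma rho_unit_mult: "a \<in> carrier Q \<Longrightarrow> f \<in> carrier Q \<Longrightarrow> f \<sqsubseteq> \<e> \<Longrightarrow> rho Q (f \<cdot> a) = f \<cdot> rho Q a"
  using rho_mult_rho[of f a] rho_closed[of a] unit_mult_below[of f "rho Q a"] rho_proj[of "f \<cdot> rho Q a"] qmult_closed
  by simp

lemma lam_sup: "S \<subseteq> carrier Q \<Longrightarrow> lam Q (\<Squnion>S) = \<Squnion>(lam Q ` S)"
proof -
  assume S: "S \<subseteq> carrier Q"
  have "lam Q ` S \<subseteq> carrier (down Q \<e>)" using S lam_closed by auto
  then show ?thesis
    using lam_sups S complete_lattice_down(2)[OF complete_lattice_axioms qunit_closed]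
    by (simp add: preserves_sups_def sup_pres_def)
qed

lemma frame_objects: "frame (down Q \<e>)"
  by (rule frame_down[OF frame_axioms qunit_closed])

lemma objects_sup: "S \<subseteq> carrier (down Q \<e>) \<Longrightarrow> \<Squnion>\<^bsub>down Q \<e>\<^esub>S = \<Squnion>S"
  by (rule complete_lattice_down(2)[OF complete_lattice_axioms qunit_closed])

lemma objects_meet:
  "f \<in> carrier (down Q \<e>) \<Longrightarrow> g \<in> carrier (down Q \<e>) \<Longrightarrow> f \<sqinter>\<^bsub>down Q \<e>\<^esub> g = f \<sqinter> g"
  by (rule complete_lattice_down(3)[OF complete_lattice_axioms qunit_closed])

lemma objects_top: "\<top>\<^bsub>down Q \<e>\<^esub> = \<e>"
  by (rule complete_lattice_down(4)[OF complete_lattice_axioms qunit_closed])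

text \<open>A balanced ideal contains \<open>(x, y)\<close> as soon as it contains \<open>(x, y \<lambda>(xy))\<close>: the support
  \<open>\<lambda>(x)\<close> can be carried across to \<open>y\<close>, and \<open>\<lambda>(xy) = \<lambda>(\<lambda>(x) y)\<close> is the support of what results.\<close>

lemma ideal_restrict_support:
  assumes K: "balanced.ideal K" and c: "x \<in> carrier Q" "y \<in> carrier Q"
    and mem: "(x, y \<cdot> lam Q (x \<cdot> y)) \<in> K"
  shows "(x, y) \<in> K"
proof -
  have l: "lam Q x \<in> carrier Q" "lam Q x \<sqsubseteq> \<e>" "lam Q (x \<cdot> y) \<in> carrier Q" "lam Q (x \<cdot> y) \<sqsubseteq> \<e>"
    using c lam_closed qmult_closed by simp_all
  have move: "(x, z) \<in> K \<longleftrightarrow> (x, lam Q x \<cdot> z) \<in> K" if z: "z \<in> carrier Q" for z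
  proof -
    have "((x \<cdot> lam Q x, z), (x, lam Q x \<cdot> z)) \<in> balanced_rel Q"
      unfolding balanced_rel_def using c z l by blast
    from balanced.ideal_R[OF K this] show ?thesis using mult_lam[OF c(1)] by simp
  qed
  have "lam Q x \<cdot> y = (lam Q x \<cdot> y) \<cdot> lam Q (lam Q x \<cdot> y)" using l c qmult_closed by (intro mult_lam) simp
  also have "\<dots> = lam Q x \<cdot> (y \<cdot> lam Q (x \<cdot> y))" using l c lam_mult[OF c] by (simp add: qmult_assoc)
  finally show ?thesis using move[OF c(2)] move[of "y \<cdot> lam Q (x \<cdot> y)"] mem c l qmult_closed by simp
qed

lemma ideal_restrict_range:
  assumes K: "balanced.ideal K" and c: "x \<in> carrier Q" "y \<in> carrier Q"
    and mem: "(rho Q (x \<cdot> y) \<cdot> x, y) \<in> K"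
  shows "(x, y) \<in> K"
proof -
  have l: "rho Q y \<in> carrier Q" "rho Q y \<sqsubseteq> \<e>" "rho Q (x \<cdot> y) \<in> carrier Q" "rho Q (x \<cdot> y) \<sqsubseteq> \<e>"
    using c rho_closed qmult_closed by simp_all
  have move: "(z, y) \<in> K \<longleftrightarrow> (z \<cdot> rho Q y, y) \<in> K" if z: "z \<in> carrier Q" for z
  proof -
    have "((z \<cdot> rho Q y, y), (z, rho Q y \<cdot> y)) \<in> balanced_rel Q"
      unfolding balanced_rel_def using c z l by blast
    from balanced.ideal_R[OF K this] show ?thesis using rho_mult[OF c(2)] by simp
  qed
  have "x \<cdot> rho Q y = rho Q (x \<cdot> rho Q y) \<cdot> (x \<cdot> rho Q y)" using l c qmult_closed by (intro rho_mult) simp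
  also have "\<dots> = (rho Q (x \<cdot> y) \<cdot> x) \<cdot> rho Q y" using l c rho_mult_rho[OF c] by (simp add: qmult_assoc)
  finally show ?thesis using move[OF c(1)] move[of "rho Q (x \<cdot> y) \<cdot> x"] mem c l qmult_closed by simp
qed

text \<open>If \<open>b = sf\<close> with \<open>f \<sqsubseteq> e\<close>, then \<open>\<lambda>(b) = \<lambda>(s) f\<close>, so the witness \<open>f\<close> of the natural order can be replaced by the
  support of \<open>b\<close>, which involves no choice and is compatible with joins.\<close>

lemma partial_isometry_restrict:
  assumes s: "s \<in> partial_isometries Q" and b: "b \<in> carrier Q" "b \<sqsubseteq> s"
  shows "b = s \<cdot> lam Q b" "b = rho Q b \<cdot> s"
proof -
  have sc: "s \<in> carrier Q" using s by (simp add: partial_isometries_def)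
  obtain f g where fg: "f \<in> carrier Q" "g \<in> carrier Q" "f \<sqsubseteq> \<e>" "g \<sqsubseteq> \<e>" "b = g \<cdot> s" "b = s \<cdot> f"
    using s b unfolding partial_isometries_def natural_le_def by blast
  have "s \<cdot> lam Q b = s \<cdot> (lam Q s \<cdot> f)" using lam_mult_unit[OF sc, of f] fg by simp
  also have "\<dots> = b" using mult_lam[OF sc] lam_closed[OF sc] sc fg by (simp add: qmult_assoc[symmetric])
  finally show "b = s \<cdot> lam Q b" by simp
  have "rho Q b \<cdot> s = (g \<cdot> rho Q s) \<cdot> s" using rho_unit_mult[OF sc, of g] fg by simp
  also have "\<dots> = b" using rho_mult[OF sc] rho_closed[OF sc] sc fg by (simp add: qmult_assoc)
  finally show "b = rho Q b \<cdot> s" by simp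
qed

lemma partial_isometry_down:
  assumes s: "s \<in> partial_isometries Q" and b: "b \<in> carrier Q" "b \<sqsubseteq> s"
  shows "b \<in> partial_isometries Q"
proof -
  have sc: "s \<in> carrier Q" using s by (simp add: partial_isometries_def)
  have "natural_le Q c b" if c: "c \<in> carrier Q" "c \<sqsubseteq> b" for c
  proof -
    have cs: "c \<sqsubseteq> s" using le_trans[OF c(2) b(2) c(1) b(1) sc] .
    have l: "lam Q c \<in> carrier Q" "lam Q c \<sqsubseteq> \<e>" "lam Q b \<in> carrier Q" "lam Q b \<sqsubseteq> \<e>" "lam Q c \<sqsubseteq> lam Q b"
      using lam_closed c b lam_mono by simp_all
    have r: "rho Q c \<in> carrier Q" "rho Q c \<sqsubseteq> \<e>" "rho Q b \<in> carrier Q" "rho Q b \<sqsubseteq> \<e>" "rho Q c \<sqsubseteq> rho Q b"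
      using rho_closed c b rho_mono by simp_all
    have "lam Q b \<cdot> lam Q c = lam Q c"
      using unit_meet[of "lam Q b" "lam Q c"] l meet_absorb2[of "lam Q b" "lam Q c"] by simp
    then have "c = (s \<cdot> lam Q b) \<cdot> lam Q c"
      using partial_isometry_restrict(1)[OF s c(1) cs] l sc by (simp add: qmult_assoc)
    moreover have "rho Q c \<cdot> rho Q b = rho Q c"
      using unit_meet[of "rho Q c" "rho Q b"] r meet_absorb1[of "rho Q c" "rho Q b"] by simp
    then have "c = rho Q c \<cdot> (rho Q b \<cdot> s)"
      using partial_isometry_restrict(2)[OF s c(1) cs] r sc by (simp add: qmult_assoc[symmetric])
    ultimately have "c = b \<cdot> lam Q c" "c = rho Q c \<cdot> b"
      using partial_isometry_restrict[OF s b] by simp_all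
    then show ?thesis unfolding natural_le_def using l r by blast
  qed
  then show ?thesis using b by (simp add: partial_isometries_def)
qed

end

context restriction_quantal_frame
begin

lemma sup_partial_isometries:
  assumes "a \<in> carrier Q"
  obtains S where "S \<subseteq> partial_isometries Q" "S \<subseteq> carrier Q" "a = \<Squnion>S" "\<And>s. s \<in> S \<Longrightarrow> s \<sqsubseteq> a"
proof -
  obtain T where T: "T \<subseteq> partial_isometries Q" "\<top> = \<Squnion>T" using top_join by blast
  then have Tc: "T \<subseteq> carrier Q" by (auto simp: partial_isometries_def)
  let ?S = "(\<lambda>t. a \<sqinter> t) ` T"
  have c: "?S \<subseteq> carrier Q" using assms Tc by (intro image_subsetI meet_closed) auto
  have "?S \<subseteq> partial_isometries Q"
  proof (rule image_subsetI)
    fix t assume t: "t \<in> T"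
    then have "t \<in> carrier Q" using Tc by blast
    then show "a \<sqinter> t \<in> partial_isometries Q"
      by (rule partial_isometry_down[OF subsetD[OF T(1) t] meet_closed[OF assms] meet_right[OF assms]]) fact+
  qed
  moreover have "a = \<Squnion>?S" using frame_distrib[OF assms Tc, folded T(2)] assms by simp
  moreover have "s \<sqsubseteq> a" if "s \<in> ?S" for s using that assms Tc meet_left[OF assms] by blast
  ultimately show thesis using c by (intro that)
qed

lemma ideal_partial_isometries:
  assumes K: "balanced.ideal K" and xy: "x \<in> carrier Q" "y \<in> carrier Q"
    and h: "\<And>s t. s \<in> partial_isometries Q \<Longrightarrow> t \<in> partial_isometries Q \<Longrightarrow> s \<sqsubseteq> x \<Longrightarrow> t \<sqsubseteq> y \<Longrightarrow> (s, t) \<in> K"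
  shows "(x, y) \<in> K"
proof -
  obtain S where S: "S \<subseteq> partial_isometries Q" "S \<subseteq> carrier Q" "x = \<Squnion>S" "\<And>s. s \<in> S \<Longrightarrow> s \<sqsubseteq> x"
    by (rule sup_partial_isometries[OF xy(1)]) blast
  obtain T where T: "T \<subseteq> partial_isometries Q" "T \<subseteq> carrier Q" "y = \<Squnion>T" "\<And>s. s \<in> T \<Longrightarrow> s \<sqsubseteq> y"
    by (rule sup_partial_isometries[OF xy(2)]) blast
  have "(s, y) \<in> K" if s: "s \<in> S" for s
    unfolding T(3) using balanced.ideal_sup2[OF K _ T(2), of s] s S T h[of s] by blast
  then show ?thesis unfolding S(3) using balanced.ideal_sup1[OF K S(2) xy(2)] by blast
qed

text \<open>By the previous lemma it suffices to treat a product of partial isometries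
  \<open>st \<sqsubseteq> \<Squnion>B\<close>. Such a product is a partial isometry, so its part below \<open>b \<in> B\<close> is a restriction
  \<open>st \<lambda>(st \<sqinter> b)\<close>, which factors as \<open>s\<close> times a restriction of \<open>t\<close>; the restrictions of \<open>t\<close> obtained
  in this way have join \<open>t \<lambda>(st)\<close>.\<close>

lemma mult_adj_sup_subset:
  assumes K: "balanced.ideal K" and B: "B \<subseteq> carrier Q" and le: "\<And>b. b \<in> B \<Longrightarrow> mult_adj Q b \<subseteq> K"
  shows "mult_adj Q (\<Squnion>B) \<subseteq> K"
proof clarify
  fix x y assume "(x, y) \<in> mult_adj Q (\<Squnion>B)"
  then have xy: "x \<in> carrier Q" "y \<in> carrier Q" "x \<cdot> y \<sqsubseteq> \<Squnion>B"
    using mult_adj_eq[OF sup_closed[OF B]] by auto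
  show "(x, y) \<in> K"
  proof (rule ideal_partial_isometries[OF K xy(1,2)])
    fix s t assume st: "s \<in> partial_isometries Q" "t \<in> partial_isometries Q" "s \<sqsubseteq> x" "t \<sqsubseteq> y"
    have c: "s \<in> carrier Q" "t \<in> carrier Q" using st by (auto simp: partial_isometries_def)
    have stc: "s \<cdot> t \<in> carrier Q" by (rule qmult_closed[OF c])
    have "s \<cdot> t \<sqsubseteq> x \<cdot> y" using c st xy by (intro qmult_mono)
    then have stB: "s \<cdot> t \<sqsubseteq> \<Squnion>B" using le_trans[OF _ xy(3) stc] xy B qmult_closed sup_closed by blast
    note pi = partial_isometries_mult[OF st(1,2)]
    let ?M = "(\<lambda>b. (s \<cdot> t) \<sqinter> b) ` B"
    have M: "?M \<subseteq> carrier Q" using B stc by (intro image_subsetI meet_closed) auto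
    have supM: "\<Squnion>?M = s \<cdot> t" using frame_distrib[OF stc B] meet_absorb1[OF stc sup_closed[OF B] stB] by simp
    have lM: "lam Q ` ?M \<subseteq> carrier Q" using M lam_closed by auto
    let ?N = "(\<lambda>f. t \<cdot> f) ` lam Q ` ?M"
    have N: "?N \<subseteq> carrier Q" using lM c qmult_closed by auto
    have "t \<cdot> lam Q (s \<cdot> t) = \<Squnion>?N"
      using qmult_sup_left[OF c(2) lM] lam_sup[OF M] supM by simp
    moreover have "(s, n) \<in> K" if "n \<in> ?N" for n
    proof -
      obtain b where b: "b \<in> B" "n = t \<cdot> lam Q ((s \<cdot> t) \<sqinter> b)" using \<open>n \<in> ?N\<close> by blast
      have bc: "b \<in> carrier Q" and mc: "(s \<cdot> t) \<sqinter> b \<in> carrier Q" using b B stc by auto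
      have "s \<cdot> n = (s \<cdot> t) \<cdot> lam Q ((s \<cdot> t) \<sqinter> b)"
        using c b lam_closed[OF mc] by (simp add: qmult_assoc)
      also have "\<dots> = (s \<cdot> t) \<sqinter> b"
        using partial_isometry_restrict(1)[OF pi mc meet_left[OF stc bc]] by simp
      also have "\<dots> \<sqsubseteq> b" by (rule meet_right[OF stc bc])
      finally have "(s, n) \<in> mult_adj Q b"
        using c N that by (auto simp: mult_adj_eq[OF bc])
      then show ?thesis using le[OF b(1)] by blast
    qed
    ultimately have "(s, t \<cdot> lam Q (s \<cdot> t)) \<in> K"
      using balanced.ideal_sup2[OF K c(1) N] by simp
    then show "(s, t) \<in> K" by (rule ideal_restrict_support[OF K c])
  qed
qed

lemma mult_adj_ideal: "a \<in> carrier Q \<Longrightarrow> balanced.ideal (mult_adj Q a)"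
  by (simp add: mult_adj_eq ideal_mult_below)

lemma mult_adj_mono:
  assumes "a \<in> carrier Q" "b \<in> carrier Q" "a \<sqsubseteq> b"
  shows "mult_adj Q a \<subseteq> mult_adj Q b"
  unfolding mult_adj_eq[OF assms(1)] mult_adj_eq[OF assms(2)]
  using le_trans[OF _ assms(3) qmult_closed assms(1,2)] by blast

lemma mult_adj_sup:
  assumes B: "B \<subseteq> carrier Q"
  shows "mult_adj Q (\<Squnion>B) = \<Squnion>\<^bsub>balanced.T\<^esub>(mult_adj Q ` B)"
proof (rule balanced.T.sup_eqI[symmetric])
  show "mult_adj Q ` B \<subseteq> carrier balanced.T" using B mult_adj_ideal by auto
  show "mult_adj Q (\<Squnion>B) \<in> carrier balanced.T" using B mult_adj_ideal by simp
  fix K assume "K \<in> carrier balanced.T"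
  then have K: "balanced.ideal K" by simp
  have "mult_adj Q b \<subseteq> mult_adj Q (\<Squnion>B)" if "b \<in> B" for b
    using that B sup_upper[OF B] by (intro mult_adj_mono) auto
  then show "mult_adj Q (\<Squnion>B) \<sqsubseteq>\<^bsub>balanced.T\<^esub> K \<longleftrightarrow> (\<forall>I\<in>mult_adj Q ` B. I \<sqsubseteq>\<^bsub>balanced.T\<^esub> K)"
    using mult_adj_sup_subset[OF K B] by (simp only: balanced.T_simps) blast
qed

lemma multiplicative: "multiplicative Q"
  unfolding multiplicative_def preserves_sups_def sup_pres_def balanced_tensor_def
  using mult_adj_sup mult_adj_ideal complete_lattice_axioms balanced.complete_T by simp

text \<open>Openness of \<open>m\<close> rests on the same restriction of a product of partial isometries. The inequality
  \<open>z \<sqinter> b \<sqsubseteq> g\<close> is tested in the form \<open>z \<sqsubseteq> h\<close> for the Heyting implication \<open>h\<close>, because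
  \<open>mult_adj Q h\<close> is a balanced ideal and partial isometries suffice to test membership.\<close>

lemma mult_frobenius:
  assumes I: "balanced.ideal I" and b: "b \<in> carrier Q"
  shows "\<Squnion>{x \<cdot> y | x y. (x, y) \<in> I \<inter> mult_adj Q b} = \<Squnion>{x \<cdot> y | x y. (x, y) \<in> I} \<sqinter> b"
    (is "\<Squnion>?G = \<Squnion>?F \<sqinter> b")
proof (rule le_antisym)
  have F: "?F \<subseteq> carrier Q" using balanced.ideal_carrier[OF I] qmult_closed by auto
  have GF: "?G \<subseteq> ?F" by blast
  then have G: "?G \<subseteq> carrier Q" using F by blast
  show "\<Squnion>?G \<sqsubseteq> \<Squnion>?F \<sqinter> b"
  proof (rule sup_least[OF G])
    show "\<Squnion>?F \<sqinter> b \<in> carrier Q" using F b by simp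
    fix z assume z: "z \<in> ?G"
    then have zc: "z \<in> carrier Q" "z \<in> ?F" using G GF by blast+
    have "z \<sqsubseteq> b" using z mult_adj_eq[OF b] by auto
    moreover have "z \<sqsubseteq> \<Squnion>?F" by (rule sup_upper[OF F zc(2)])
    ultimately show "z \<sqsubseteq> \<Squnion>?F \<sqinter> b" using zc(1) b F by (simp add: le_meet_iff)
  qed
  let ?H = "{c \<in> carrier Q. c \<sqinter> b \<sqsubseteq> \<Squnion>?G}"
  have H: "?H \<subseteq> carrier Q" by blast
  have gc: "\<Squnion>?G \<in> carrier Q" by (rule sup_closed[OF G])
  have hb: "\<Squnion>?H \<sqinter> b \<sqsubseteq> \<Squnion>?G"
  proof -
    have "(\<lambda>c. c \<sqinter> b) ` ?H \<subseteq> carrier Q" using b by auto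
    then have "\<Squnion>((\<lambda>c. c \<sqinter> b) ` ?H) \<sqsubseteq> \<Squnion>?G" using sup_least[OF _ gc] by blast
    then show ?thesis using frame_distrib'[OF b H] by simp
  qed
  have "(x, y) \<in> mult_adj Q (\<Squnion>?H)" if xy: "(x, y) \<in> I" for x y
  proof (rule ideal_partial_isometries[OF mult_adj_ideal[OF sup_closed[OF H]]])
    show xyc: "x \<in> carrier Q" "y \<in> carrier Q" using balanced.ideal_carrier[OF I xy] by auto
    fix s t assume st: "s \<in> partial_isometries Q" "t \<in> partial_isometries Q" "s \<sqsubseteq> x" "t \<sqsubseteq> y"
    have c: "s \<in> carrier Q" "t \<in> carrier Q" using st by (auto simp: partial_isometries_def)
    have stc: "s \<cdot> t \<in> carrier Q" by (rule qmult_closed[OF c])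
    have mc: "(s \<cdot> t) \<sqinter> b \<in> carrier Q" using stc b by simp
    let ?f = "lam Q ((s \<cdot> t) \<sqinter> b)"
    have f: "?f \<in> carrier Q" "?f \<sqsubseteq> \<e>" using lam_closed[OF mc] by auto
    have eq: "(s \<cdot> t) \<sqinter> b = s \<cdot> (t \<cdot> ?f)"
      using partial_isometry_restrict(1)[OF partial_isometries_mult[OF st(1,2)] mc meet_left[OF stc b]]
        qmult_assoc[OF c f(1)] by simp
    have tf: "t \<cdot> ?f \<in> carrier Q" "t \<cdot> ?f \<sqsubseteq> y"
      using qmult_closed[OF c(2) f(1)] le_trans[OF mult_below_unit(1)[OF c(2) f] st(4)] c xyc by auto
    have "(s, t \<cdot> ?f) \<in> I" using balanced.ideal_down[OF I xy c(1) tf(1) st(3) tf(2)] .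
    moreover have "(s, t \<cdot> ?f) \<in> mult_adj Q b"
      using c tf eq meet_right[OF stc b] by (simp add: mult_adj_eq[OF b])
    ultimately have "s \<cdot> (t \<cdot> ?f) \<in> ?G" by blast
    then have "(s \<cdot> t) \<sqinter> b \<sqsubseteq> \<Squnion>?G" unfolding eq[symmetric] by (rule sup_upper[OF G])
    then have "s \<cdot> t \<sqsubseteq> \<Squnion>?H" using stc by (intro sup_upper[OF H]) simp
    then show "(s, t) \<in> mult_adj Q (\<Squnion>?H)" unfolding mult_adj_eq[OF sup_closed[OF H]] using c by blast
  qed
  then have "z \<sqsubseteq> \<Squnion>?H" if "z \<in> ?F" for z
    using that mult_adj_eq[OF sup_closed[OF H]] by blast
  then have "\<Squnion>?F \<sqsubseteq> \<Squnion>?H" using sup_least[OF F sup_closed[OF H]] by blast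
  then have "\<Squnion>?F \<sqinter> b \<sqsubseteq> \<Squnion>?H \<sqinter> b" using F H b by (intro meet_mono) simp_all
  then show "\<Squnion>?F \<sqinter> b \<sqsubseteq> \<Squnion>?G"
    by (rule le_trans[OF _ hb meet_closed[OF sup_closed[OF F] b] meet_closed[OF sup_closed[OF H] b] gc])
  show "\<Squnion>?G \<in> carrier Q" "\<Squnion>?F \<sqinter> b \<in> carrier Q" using F G b by simp_all
qed

end

section \<open>The localic category of a restriction quantal frame\<close>

locale restriction_quantal_frame_plain = restriction_quantal_frame Q
  for Q :: "'q equantale" (structure)
begin

lemma frame_arrows: "frame (gorder.truncate Q)"
  by (rule frame_truncate[OF frame_axioms])

lemma dstar_frame_map: "frame_map (down Q \<e>) (gorder.truncate Q) (\<lambda>f. \<top> \<cdot> f)"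
proof (rule frame_mapI[OF frame_objects frame_arrows], unfold truncate_simps)
  show "\<top> \<cdot> f \<in> carrier Q" if "f \<in> carrier (down Q \<e>)" for f using that qmult_closed by simp
  show "\<top> \<cdot> \<Squnion>\<^bsub>down Q \<e>\<^esub>S = \<Squnion>((\<lambda>f. \<top> \<cdot> f) ` S)" if "S \<subseteq> carrier (down Q \<e>)" for S
    unfolding objects_sup[OF that] using that by (intro qmult_sup_left) auto
  show "\<top> \<cdot> \<top>\<^bsub>down Q \<e>\<^esub> = \<top>" by (simp add: objects_top qunit_right)
  show "\<top> \<cdot> (f \<sqinter>\<^bsub>down Q \<e>\<^esub> g) = \<top> \<cdot> f \<sqinter> (\<top> \<cdot> g)"
    if "f \<in> carrier (down Q \<e>)" "g \<in> carrier (down Q \<e>)" for f g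
    using that by (simp add: objects_meet unit_meet meet_dstar qmult_closed qmult_assoc)
qed

lemma rstar_frame_map: "frame_map (down Q \<e>) (gorder.truncate Q) (\<lambda>f. f \<cdot> \<top>)"
proof (rule frame_mapI[OF frame_objects frame_arrows], unfold truncate_simps)
  show "f \<cdot> \<top> \<in> carrier Q" if "f \<in> carrier (down Q \<e>)" for f using that qmult_closed by simp
  show "\<Squnion>\<^bsub>down Q \<e>\<^esub>S \<cdot> \<top> = \<Squnion>((\<lambda>f. f \<cdot> \<top>) ` S)" if "S \<subseteq> carrier (down Q \<e>)" for S
    unfolding objects_sup[OF that] using that by (intro qmult_sup_right) auto
  show "\<top>\<^bsub>down Q \<e>\<^esub> \<cdot> \<top> = \<top>" by (simp add: objects_top qunit_left)
  show "(f \<sqinter>\<^bsub>down Q \<e>\<^esub> g) \<cdot> \<top> = f \<cdot> \<top> \<sqinter> (g \<cdot> \<top>)"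
    if "f \<in> carrier (down Q \<e>)" "g \<in> carrier (down Q \<e>)" for f g
    using that by (simp add: objects_meet unit_meet meet_rstar qmult_closed qmult_assoc)
qed

lemma meet_unit_closed: "a \<in> carrier Q \<Longrightarrow> a \<sqinter> \<e> \<in> carrier (down Q \<e>)"
  using qunit_closed meet_right[of a \<e>] by simp

lemma ustar_frame_map: "frame_map (gorder.truncate Q) (down Q \<e>) (\<lambda>a. a \<sqinter> \<e>)"
proof (rule frame_mapI[OF frame_arrows frame_objects], unfold truncate_simps)
  show "a \<sqinter> \<e> \<in> carrier (down Q \<e>)" if "a \<in> carrier Q" for a by (rule meet_unit_closed[OF that])
  show "\<Squnion>S \<sqinter> \<e> = \<Squnion>\<^bsub>down Q \<e>\<^esub>((\<lambda>a. a \<sqinter> \<e>) ` S)" if "S \<subseteq> carrier Q" for S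
  proof -
    have "(\<lambda>a. a \<sqinter> \<e>) ` S \<subseteq> carrier (down Q \<e>)"
      using that meet_unit_closed by blast
    then show ?thesis using frame_distrib'[OF qunit_closed that] by (simp add: objects_sup)
  qed
  show "\<top> \<sqinter> \<e> = \<top>\<^bsub>down Q \<e>\<^esub>" by (simp add: objects_top qunit_closed)
  show "a \<sqinter> b \<sqinter> \<e> = (a \<sqinter> \<e>) \<sqinter>\<^bsub>down Q \<e>\<^esub> (b \<sqinter> \<e>)" if "a \<in> carrier Q" "b \<in> carrier Q" for a b
    unfolding objects_meet[OF meet_unit_closed[OF that(1)] meet_unit_closed[OF that(2)]]
    using that qunit_closed
    by (intro meet_eqI[symmetric]) (auto simp: le_meet_iff)
qed

sublocale graph: reflexive_span "gorder.truncate Q" "down Q \<e>" "\<lambda>f. \<top> \<cdot> f" "\<lambda>f. f \<cdot> \<top>" "\<lambda>a. a \<sqinter> \<e>"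
proof (intro reflexive_span.intro reflexive_span_axioms.intro frame_arrows frame_objects
    dstar_frame_map rstar_frame_map ustar_frame_map)
  fix f assume "f \<in> carrier (down Q \<e>)"
  then have f: "f \<in> carrier Q" "f \<sqsubseteq> \<e>" by simp_all
  show "\<top> \<cdot> f \<sqinter> \<e> = f" using meet_dstar[OF qunit_closed f] f by (simp add: meet_comm[of Q] qunit_left)
  show "f \<cdot> \<top> \<sqinter> \<e> = f" using meet_rstar[OF qunit_closed f] f by (simp add: qunit_right)
qed

lemma composable_eq: "graph.span.P = balanced.T"
  using composable_cat_of(1)[OF ehresmann_quantale_axioms]
  by (simp add: composable_def cat_of_def balanced_tensor_def)

lemma span_ideal_iff: "graph.span.ideal I \<longleftrightarrow> balanced.ideal I"
  using composable_eq graph.span.T_simps(1) balanced.T_simps(1) unfolding graph.span.P_T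
  by (metis mem_Collect_eq)

sublocale cat: span_multiplication "gorder.truncate Q" "down Q \<e>" "\<lambda>f. \<top> \<cdot> f" "\<lambda>f. f \<cdot> \<top>"
    "\<lambda>a. a \<sqinter> \<e>" "(\<cdot>)" "mult_adj Q"
proof (unfold_locales, unfold truncate_simps)
  show "x \<cdot> y \<in> carrier Q" if "x \<in> carrier Q" "y \<in> carrier Q" for x y by (rule qmult_closed[OF that])
  show "graph.span.ideal (mult_adj Q b)" if "b \<in> carrier Q" for b
    unfolding span_ideal_iff by (rule mult_adj_ideal[OF that])
  show "(x, y) \<in> mult_adj Q b \<longleftrightarrow> x \<cdot> y \<sqsubseteq> b" if "b \<in> carrier Q" "x \<in> carrier Q" "y \<in> carrier Q" for b x y
    using that by (simp add: mult_adj_eq)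
  show "(z \<cdot> \<top> \<sqinter> x) \<cdot> y = z \<cdot> \<top> \<sqinter> (x \<cdot> y)"
    if "z \<in> carrier (down Q \<e>)" "x \<in> carrier Q" "y \<in> carrier Q" for z x y
    using that by (simp add: meet_rstar qmult_closed qmult_assoc)
  show "x \<cdot> (y \<sqinter> (\<top> \<cdot> z)) = x \<cdot> y \<sqinter> (\<top> \<cdot> z)"
    if "x \<in> carrier Q" "y \<in> carrier Q" "z \<in> carrier (down Q \<e>)" for x y z
    using that by (simp add: meet_dstar qmult_closed qmult_assoc)
qed

lemma cat_of_eq: "cat_of Q = cat.graph"
  by (simp add: cat_of_def)

lemma cat_of_right_unit: "right_unit_law (cat_of Q)"
  unfolding cat_of_eq cat.right_unit_law_iff truncate_simps
proof
  fix a assume a: "a \<in> carrier Q"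
  let ?X = "{x \<sqinter> (\<top> \<cdot> (y \<sqinter> \<e>)) | x y. (x, y) \<in> mult_adj Q a}"
  have x: "x \<sqinter> (\<top> \<cdot> (y \<sqinter> \<e>)) \<in> carrier Q" "x \<sqinter> (\<top> \<cdot> (y \<sqinter> \<e>)) \<sqsubseteq> a" if "(x, y) \<in> mult_adj Q a" for x y
  proof -
    have c: "x \<in> carrier Q" "y \<in> carrier Q" "x \<cdot> y \<sqsubseteq> a" using that mult_adj_eq[OF a] by auto
    have ye: "y \<sqinter> \<e> \<in> carrier Q" "y \<sqinter> \<e> \<sqsubseteq> \<e>" using meet_unit_closed[OF c(2)] by simp_all
    show "x \<sqinter> (\<top> \<cdot> (y \<sqinter> \<e>)) \<in> carrier Q" using c ye qmult_closed by simp
    have "x \<cdot> (y \<sqinter> \<e>) \<sqsubseteq> x \<cdot> y" using c ye qunit_closed by (intro qmult_mono meet_left) simp_all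
    then have "x \<cdot> (y \<sqinter> \<e>) \<sqsubseteq> a"
      by (rule le_trans[OF _ c(3)]) (use c ye a qmult_closed in simp_all)
    then show "x \<sqinter> (\<top> \<cdot> (y \<sqinter> \<e>)) \<sqsubseteq> a" using meet_dstar[OF c(1) ye] by simp
  qed
  then have X: "?X \<subseteq> carrier Q" by blast
  show "\<Squnion>?X = a"
  proof (rule le_antisym)
    show "\<Squnion>?X \<sqsubseteq> a" using x by (intro sup_least[OF X a]) blast
    have "(a, \<e>) \<in> mult_adj Q a" using a by (simp add: mult_adj_eq qunit_closed qunit_right)
    moreover have "a \<sqinter> (\<top> \<cdot> (\<e> \<sqinter> \<e>)) = a" using a qunit_closed by (simp add: qunit_right)
    ultimately have "\<exists>x y. a = x \<sqinter> (\<top> \<cdot> (y \<sqinter> \<e>)) \<and> (x, y) \<in> mult_adj Q a"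
      by (intro exI[of _ a] exI[of _ \<e>]) simp
    then have "a \<in> ?X" by (rule CollectI)
    then show "a \<sqsubseteq> \<Squnion>?X" by (rule sup_upper[OF X])
  qed (use a X in simp_all)
qed

lemma cat_of_left_unit: "left_unit_law (cat_of Q)"
  unfolding cat_of_eq cat.left_unit_law_iff truncate_simps
proof
  fix a assume a: "a \<in> carrier Q"
  let ?X = "{(x \<sqinter> \<e>) \<cdot> \<top> \<sqinter> y | x y. (x, y) \<in> mult_adj Q a}"
  have x: "(x \<sqinter> \<e>) \<cdot> \<top> \<sqinter> y \<in> carrier Q" "(x \<sqinter> \<e>) \<cdot> \<top> \<sqinter> y \<sqsubseteq> a" if "(x, y) \<in> mult_adj Q a" for x y
  proof -
    have c: "x \<in> carrier Q" "y \<in> carrier Q" "x \<cdot> y \<sqsubseteq> a" using that mult_adj_eq[OF a] by auto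
    have xe: "x \<sqinter> \<e> \<in> carrier Q" "x \<sqinter> \<e> \<sqsubseteq> \<e>" using meet_unit_closed[OF c(1)] by simp_all
    show "(x \<sqinter> \<e>) \<cdot> \<top> \<sqinter> y \<in> carrier Q" using c xe qmult_closed by simp
    have "(x \<sqinter> \<e>) \<cdot> y \<sqsubseteq> x \<cdot> y" using c xe qunit_closed by (intro qmult_mono meet_left) simp_all
    then have "(x \<sqinter> \<e>) \<cdot> y \<sqsubseteq> a"
      by (rule le_trans[OF _ c(3)]) (use c xe a qmult_closed in simp_all)
    then show "(x \<sqinter> \<e>) \<cdot> \<top> \<sqinter> y \<sqsubseteq> a" using meet_rstar[OF c(2) xe] by simp
  qed
  then have X: "?X \<subseteq> carrier Q" by blast
  show "\<Squnion>?X = a"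
  proof (rule le_antisym)
    show "\<Squnion>?X \<sqsubseteq> a" using x by (intro sup_least[OF X a]) blast
    have "(\<e>, a) \<in> mult_adj Q a" using a by (simp add: mult_adj_eq qunit_closed qunit_left)
    moreover have "(\<e> \<sqinter> \<e>) \<cdot> \<top> \<sqinter> a = a" using a qunit_closed by (simp add: qunit_left)
    ultimately have "\<exists>x y. a = (x \<sqinter> \<e>) \<cdot> \<top> \<sqinter> y \<and> (x, y) \<in> mult_adj Q a"
      by (intro exI[of _ \<e>] exI[of _ a]) simp
    then have "a \<in> ?X" by (rule CollectI)
    then show "a \<sqsubseteq> \<Squnion>?X" by (rule sup_upper[OF X])
  qed (use a X in simp_all)
qed

lemma cat_of_assoc: "assoc_law (cat_of Q)"
  unfolding cat_of_eq cat.assoc_law_iff truncate_simps using qmult_assoc by blast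

text \<open>The inverse images of \<open>f\<close> along \<open>d m\<close> and \<open>d \<pi>\<^sub>2\<close> agree: if \<open>xy \<sqsubseteq> 1f\<close>, then \<open>\<lambda>(xy) \<sqsubseteq> f\<close>, and \<open>y\<close> may be replaced by
  its restriction to \<open>\<lambda>(xy)\<close>, which is below \<open>1f\<close>.\<close>

lemma mult_adj_dstar:
  assumes f: "f \<in> carrier Q" "f \<sqsubseteq> \<e>"
  shows "graph.span.p2 (\<top> \<cdot> f) = mult_adj Q (\<top> \<cdot> f)"
proof
  have tf: "\<top> \<cdot> f \<in> carrier Q" using f qmult_closed by simp
  note ideals = mult_adj_ideal[OF tf, folded span_ideal_iff]
  have "(\<top>, \<top> \<cdot> f) \<in> mult_adj Q (\<top> \<cdot> f)"
    using f tf qmult_mono[of "\<top> \<cdot> \<top>" \<top> f f] qmult_closed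
    by (simp add: mult_adj_eq[OF tf] qmult_assoc[symmetric])
  then show "graph.span.p2 (\<top> \<cdot> f) \<subseteq> mult_adj Q (\<top> \<cdot> f)"
    unfolding proj2_def graph.span.pure_le[OF ideals] by (simp add: truncate_simps)
  have ip: "graph.span.ideal (graph.span.p2 (\<top> \<cdot> f))"
    unfolding proj2_def using tf by (intro graph.span.ideal_pure) (simp_all add: truncate_simps)
  then have K: "balanced.ideal (graph.span.p2 (\<top> \<cdot> f))" by (simp only: span_ideal_iff)
  have mem: "(\<top>, \<top> \<cdot> f) \<in> graph.span.p2 (\<top> \<cdot> f)"
    unfolding proj2_def using graph.span.pure_mem by (simp add: truncate_simps)
  show "mult_adj Q (\<top> \<cdot> f) \<subseteq> graph.span.p2 (\<top> \<cdot> f)"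
  proof clarify
    fix x y assume "(x, y) \<in> mult_adj Q (\<top> \<cdot> f)"
    then have c: "x \<in> carrier Q" "y \<in> carrier Q" and le: "x \<cdot> y \<sqsubseteq> \<top> \<cdot> f"
      using mult_adj_eq[OF tf] by auto
    have l: "lam Q (x \<cdot> y) \<in> carrier Q" "lam Q (x \<cdot> y) \<sqsubseteq> \<e>" "lam Q (x \<cdot> y) \<sqsubseteq> f"
      using lam_closed[OF qmult_closed[OF c]] lam_adj[OF qmult_closed[OF c] f] le by simp_all
    have "y \<cdot> lam Q (x \<cdot> y) \<sqsubseteq> \<top> \<cdot> f" using c f l by (intro qmult_mono) simp_all
    then have "(x, y \<cdot> lam Q (x \<cdot> y)) \<in> graph.span.p2 (\<top> \<cdot> f)"
      using balanced.ideal_down[OF K mem c(1), of "y \<cdot> lam Q (x \<cdot> y)"] c l qmult_closed by simp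
    then show "(x, y) \<in> graph.span.p2 (\<top> \<cdot> f)" by (rule ideal_restrict_support[OF K c])
  qed
qed

lemma mult_adj_rstar:
  assumes f: "f \<in> carrier Q" "f \<sqsubseteq> \<e>"
  shows "graph.span.p1 (f \<cdot> \<top>) = mult_adj Q (f \<cdot> \<top>)"
proof
  have ft: "f \<cdot> \<top> \<in> carrier Q" using f qmult_closed by simp
  note ideals = mult_adj_ideal[OF ft, folded span_ideal_iff]
  have "(f \<cdot> \<top>, \<top>) \<in> mult_adj Q (f \<cdot> \<top>)"
    using f ft qmult_mono[of f f "\<top> \<cdot> \<top>" \<top>] qmult_closed
    by (simp add: mult_adj_eq[OF ft] qmult_assoc)
  then show "graph.span.p1 (f \<cdot> \<top>) \<subseteq> mult_adj Q (f \<cdot> \<top>)"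
    unfolding proj1_def graph.span.pure_le[OF ideals] by (simp add: truncate_simps)
  have ip: "graph.span.ideal (graph.span.p1 (f \<cdot> \<top>))"
    unfolding proj1_def using ft by (intro graph.span.ideal_pure) (simp_all add: truncate_simps)
  then have K: "balanced.ideal (graph.span.p1 (f \<cdot> \<top>))" by (simp only: span_ideal_iff)
  have mem: "(f \<cdot> \<top>, \<top>) \<in> graph.span.p1 (f \<cdot> \<top>)"
    unfolding proj1_def using graph.span.pure_mem by (simp add: truncate_simps)
  show "mult_adj Q (f \<cdot> \<top>) \<subseteq> graph.span.p1 (f \<cdot> \<top>)"
  proof clarify
    fix x y assume "(x, y) \<in> mult_adj Q (f \<cdot> \<top>)"
    then have c: "x \<in> carrier Q" "y \<in> carrier Q" and le: "x \<cdot> y \<sqsubseteq> f \<cdot> \<top>"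
      using mult_adj_eq[OF ft] by auto
    have l: "rho Q (x \<cdot> y) \<in> carrier Q" "rho Q (x \<cdot> y) \<sqsubseteq> \<e>" "rho Q (x \<cdot> y) \<sqsubseteq> f"
      using rho_closed[OF qmult_closed[OF c]] rho_adj[OF qmult_closed[OF c] f] le by simp_all
    have "rho Q (x \<cdot> y) \<cdot> x \<sqsubseteq> f \<cdot> \<top>" using c f l by (intro qmult_mono) simp_all
    then have "(rho Q (x \<cdot> y) \<cdot> x, y) \<in> graph.span.p1 (f \<cdot> \<top>)"
      using balanced.ideal_down[OF K mem _ c(2), of "rho Q (x \<cdot> y) \<cdot> x"] c l qmult_closed by simp
    then show "(x, y) \<in> graph.span.p1 (f \<cdot> \<top>)" by (rule ideal_restrict_range[OF K c])
  qed
qed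

lemma mult_adj_locale_map: "locale_map balanced.T (gorder.truncate Q) (mult_adj Q)"
proof -
  have "frame balanced.T" using graph.span.frame_P unfolding composable_eq .
  moreover have "frame_map (gorder.truncate Q) balanced.T (mult_adj Q)"
  proof (rule frame_mapI[OF frame_arrows calculation], unfold truncate_simps)
    show "mult_adj Q a \<in> carrier balanced.T" if "a \<in> carrier Q" for a using mult_adj_ideal[OF that] by simp
    show "mult_adj Q (\<Squnion>S) = \<Squnion>\<^bsub>balanced.T\<^esub>(mult_adj Q ` S)" if "S \<subseteq> carrier Q" for S
      by (rule mult_adj_sup[OF that])
    show "mult_adj Q \<top> = \<top>\<^bsub>balanced.T\<^esub>"
      using qmult_closed by (auto simp: mult_adj_eq balanced.top_T top_higher)
    show "mult_adj Q (a \<sqinter> b) = mult_adj Q a \<sqinter>\<^bsub>balanced.T\<^esub> mult_adj Q b"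
      if "a \<in> carrier Q" "b \<in> carrier Q" for a b
      unfolding balanced.meet_T[OF mult_adj_ideal[OF that(1)] mult_adj_ideal[OF that(2)]]
      using that qmult_closed by (auto simp: mult_adj_eq le_meet_iff)
  qed
  ultimately show ?thesis using frame_arrows by (simp add: locale_map_def)
qed

lemma mult_adj_adjoint:
  assumes I: "balanced.ideal I"
  shows "\<Squnion>{x \<cdot> y | x y. (x, y) \<in> I} \<in> carrier Q"
    and "a \<in> carrier Q \<Longrightarrow> \<Squnion>{x \<cdot> y | x y. (x, y) \<in> I} \<sqsubseteq> a \<longleftrightarrow> I \<subseteq> mult_adj Q a"
  using mult_adj_right_adjoint I
  by (auto simp: galois_connection_def galois_connection_axioms_def connection_def balanced_tensor_def
      truncate_simps Pi_iff)

lemma mult_adj_open: "open_map balanced.T (gorder.truncate Q) (mult_adj Q)"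
  by (rule open_of_adjoint[OF mult_adj_locale_map, of "\<lambda>I. \<Squnion>{x \<cdot> y | x y. (x, y) \<in> I}"])
    (simp_all add: truncate_simps mult_adj_adjoint balanced.meet_T mult_adj_ideal mult_frobenius[unfolded Int_iff])

lemma shriek_mult_adj:
  "balanced.ideal I \<Longrightarrow> shriek balanced.T (gorder.truncate Q) (mult_adj Q) I = \<Squnion>{x \<cdot> y | x y. (x, y) \<in> I}"
  by (rule semiopen_of_adjoint(2)[OF mult_adj_locale_map])
    (simp_all add: truncate_simps mult_adj_adjoint)

lemma ustar_locale_map: "locale_map (down Q \<e>) (gorder.truncate Q) (\<lambda>a. a \<sqinter> \<e>)"
  and dstar_locale_map: "locale_map (gorder.truncate Q) (down Q \<e>) (\<lambda>f. \<top> \<cdot> f)"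
  and rstar_locale_map: "locale_map (gorder.truncate Q) (down Q \<e>) (\<lambda>f. f \<cdot> \<top>)"
  using frame_arrows frame_objects ustar_frame_map dstar_frame_map rstar_frame_map
  by (simp_all add: locale_map_def)

lemma ustar_open: "open_map (down Q \<e>) (gorder.truncate Q) (\<lambda>a. a \<sqinter> \<e>)"
proof (rule open_of_adjoint[OF ustar_locale_map, of "\<lambda>f. f"], unfold truncate_simps)
  fix f a assume f: "f \<in> carrier (down Q \<e>)" and a: "a \<in> carrier Q"
  show "f \<sqsubseteq> a \<longleftrightarrow> f \<sqsubseteq>\<^bsub>down Q \<e>\<^esub> a \<sqinter> \<e>" using f a qunit_closed by (simp add: le_meet_iff)
  show "f \<sqinter>\<^bsub>down Q \<e>\<^esub> (a \<sqinter> \<e>) = f \<sqinter> a"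
    unfolding objects_meet[OF f meet_unit_closed[OF a]]
    using f a qunit_closed by (intro meet_eqI) (auto simp: le_meet_iff intro: le_trans)
qed simp

lemma shriek_ustar: "f \<in> carrier (down Q \<e>) \<Longrightarrow> shriek (down Q \<e>) (gorder.truncate Q) (\<lambda>a. a \<sqinter> \<e>) f = f"
  by (rule semiopen_of_adjoint(2)[OF ustar_locale_map, of "\<lambda>f. f"])
    (use qunit_closed in \<open>simp_all add: truncate_simps le_meet_iff\<close>)

lemma dstar_open: "open_map (gorder.truncate Q) (down Q \<e>) (\<lambda>f. \<top> \<cdot> f)"
proof (rule open_of_adjoint[OF dstar_locale_map, of "lam Q"], unfold truncate_simps)
  fix a f assume a: "a \<in> carrier Q" and f: "f \<in> carrier (down Q \<e>)"
  show "lam Q a \<sqsubseteq>\<^bsub>down Q \<e>\<^esub> f \<longleftrightarrow> a \<sqsubseteq> \<top> \<cdot> f" using a f by (simp add: lam_adj)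
  have "lam Q a \<in> carrier (down Q \<e>)" using lam_closed[OF a] by simp
  then show "lam Q (a \<sqinter> (\<top> \<cdot> f)) = lam Q a \<sqinter>\<^bsub>down Q \<e>\<^esub> f"
    using a f by (simp add: meet_dstar lam_mult_unit objects_meet unit_meet)
qed (simp add: lam_closed)

lemma shriek_dstar: "a \<in> carrier Q \<Longrightarrow> shriek (gorder.truncate Q) (down Q \<e>) (\<lambda>f. \<top> \<cdot> f) a = lam Q a"
  by (rule semiopen_of_adjoint(2)[OF dstar_locale_map])
    (simp_all add: truncate_simps lam_adj lam_closed)

lemma rstar_open: "open_map (gorder.truncate Q) (down Q \<e>) (\<lambda>f. f \<cdot> \<top>)"
proof (rule open_of_adjoint[OF rstar_locale_map, of "rho Q"], unfold truncate_simps)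
  fix a f assume a: "a \<in> carrier Q" and f: "f \<in> carrier (down Q \<e>)"
  show "rho Q a \<sqsubseteq>\<^bsub>down Q \<e>\<^esub> f \<longleftrightarrow> a \<sqsubseteq> f \<cdot> \<top>" using a f by (simp add: rho_adj)
  have r: "rho Q a \<in> carrier (down Q \<e>)" using rho_closed[OF a] by simp
  have "rho Q (a \<sqinter> (f \<cdot> \<top>)) = f \<cdot> rho Q a"
    using a f meet_rstar[of a f] by (simp add: meet_comm[of Q a] rho_unit_mult)
  also have "\<dots> = rho Q a \<sqinter>\<^bsub>down Q \<e>\<^esub> f"
    using r f by (simp add: objects_meet unit_meet[symmetric] meet_comm[of Q f])
  finally show "rho Q (a \<sqinter> (f \<cdot> \<top>)) = rho Q a \<sqinter>\<^bsub>down Q \<e>\<^esub> f" .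
qed (simp add: rho_closed)

lemma shriek_rstar: "a \<in> carrier Q \<Longrightarrow> shriek (gorder.truncate Q) (down Q \<e>) (\<lambda>f. f \<cdot> \<top>) a = rho Q a"
  by (rule semiopen_of_adjoint(2)[OF rstar_locale_map])
    (simp_all add: truncate_simps rho_adj rho_closed)

text \<open>A cover by partial isometries trivialises \<open>d\<close>: below such an \<open>s\<close>, every \<open>a\<close> is \<open>s \<lambda>(a)\<close>, the meet of \<open>s\<close>
  with the inverse image of \<open>\<lambda>(a)\<close>.\<close>

lemma dstar_etale: "etale_map (gorder.truncate Q) (down Q \<e>) (\<lambda>f. \<top> \<cdot> f)"
proof -
  obtain S where S: "S \<subseteq> partial_isometries Q" "\<top> = \<Squnion>S" using top_join by blast
  have "(\<lambda>f. \<top> \<cdot> f \<sqinter> s) ` carrier (down Q \<e>) = {a \<in> carrier Q. a \<sqsubseteq> s}" if s: "s \<in> S" for s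
  proof (intro equalityI subsetI)
    have sp: "s \<in> partial_isometries Q" and sc: "s \<in> carrier Q"
      using s S by (auto simp: partial_isometries_def)
    show "a \<in> {a \<in> carrier Q. a \<sqsubseteq> s}" if "a \<in> (\<lambda>f. \<top> \<cdot> f \<sqinter> s) ` carrier (down Q \<e>)" for a
      using that sc qmult_closed meet_right by auto
    fix a assume "a \<in> {a \<in> carrier Q. a \<sqsubseteq> s}"
    then have a: "a \<in> carrier Q" "a \<sqsubseteq> s" by auto
    have "a = \<top> \<cdot> lam Q a \<sqinter> s"
      using partial_isometry_restrict(1)[OF sp a] meet_dstar[OF sc, of "lam Q a"] lam_closed[OF a(1)]
      by (simp add: meet_comm[of Q s])
    moreover have "lam Q a \<in> carrier (down Q \<e>)" using lam_closed[OF a(1)] by simp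
    ultimately show "a \<in> (\<lambda>f. \<top> \<cdot> f \<sqinter> s) ` carrier (down Q \<e>)" by blast
  qed
  moreover have "S \<subseteq> carrier Q" using S by (auto simp: partial_isometries_def)
  ultimately show ?thesis
    unfolding etale_map_def truncate_simps
    by (intro conjI dstar_open exI[of _ S] ballI S(2)[symmetric]) simp_all
qed

lemma rstar_etale: "etale_map (gorder.truncate Q) (down Q \<e>) (\<lambda>f. f \<cdot> \<top>)"
proof -
  obtain S where S: "S \<subseteq> partial_isometries Q" "\<top> = \<Squnion>S" using top_join by blast
  have "(\<lambda>f. f \<cdot> \<top> \<sqinter> s) ` carrier (down Q \<e>) = {a \<in> carrier Q. a \<sqsubseteq> s}" if s: "s \<in> S" for s
  proof (intro equalityI subsetI)
    have sp: "s \<in> partial_isometries Q" and sc: "s \<in> carrier Q"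
      using s S by (auto simp: partial_isometries_def)
    show "a \<in> {a \<in> carrier Q. a \<sqsubseteq> s}" if "a \<in> (\<lambda>f. f \<cdot> \<top> \<sqinter> s) ` carrier (down Q \<e>)" for a
      using that sc qmult_closed meet_right by auto
    fix a assume "a \<in> {a \<in> carrier Q. a \<sqsubseteq> s}"
    then have a: "a \<in> carrier Q" "a \<sqsubseteq> s" by auto
    have "a = rho Q a \<cdot> \<top> \<sqinter> s"
      using partial_isometry_restrict(2)[OF sp a] meet_rstar[OF sc, of "rho Q a"] rho_closed[OF a(1)]
      by simp
    moreover have "rho Q a \<in> carrier (down Q \<e>)" using rho_closed[OF a(1)] by simp
    ultimately show "a \<in> (\<lambda>f. f \<cdot> \<top> \<sqinter> s) ` carrier (down Q \<e>)" by blast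
  qed
  moreover have "S \<subseteq> carrier Q" using S by (auto simp: partial_isometries_def)
  ultimately show ?thesis
    unfolding etale_map_def truncate_simps
    by (intro conjI rstar_open exI[of _ S] ballI S(2)[symmetric]) simp_all
qed

lemma cat_of_simps:
  "arrows (cat_of Q) = gorder.truncate Q" "objects (cat_of Q) = down Q \<e>"
  "ustar (cat_of Q) = (\<lambda>a. a \<sqinter> \<e>)" "dstar (cat_of Q) = (\<lambda>f. \<top> \<cdot> f)" "rstar (cat_of Q) = (\<lambda>f. f \<cdot> \<top>)"
  "mstar (cat_of Q) = mult_adj Q" "composable (cat_of Q) = balanced.T"
  "pi1 (cat_of Q) = graph.span.p1" "pi2 (cat_of Q) = graph.span.p2"
  using composable_eq by (simp_all add: cat_of_def composable_def pi1_def pi2_def)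

lemma etale_cat_of: "etale_localic_category (cat_of Q)"
proof -
  have "localic_category (cat_of Q)"
    unfolding localic_category_def
    using cat_of_left_unit cat_of_right_unit cat_of_assoc frame_arrows frame_objects
      ustar_locale_map dstar_locale_map rstar_locale_map mult_adj_locale_map
    by (simp add: cat_of_simps graph.u_d graph.u_r mult_adj_dstar mult_adj_rstar)
  then show ?thesis
    unfolding etale_localic_category_def
    by (simp add: cat_of_simps ustar_open mult_adj_open dstar_etale rstar_etale)
qed

lemma same_quantale_of_cat_of: "same_quantale Q (quantale_of (cat_of Q))"
proof -
  have "shriek balanced.T (gorder.truncate Q) (mult_adj Q) (graph.span.p1 a \<sqinter>\<^bsub>balanced.T\<^esub> graph.span.p2 b)
      = a \<cdot> b" if ab: "a \<in> carrier Q" "b \<in> carrier Q" for a b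
  proof -
    let ?I = "graph.span.p1 a \<sqinter>\<^bsub>balanced.T\<^esub> graph.span.p2 b"
    have I: "?I = pure (gorder.truncate Q) (gorder.truncate Q) graph.span.R a b"
      using graph.span.pure_eq_meet[of a b] ab by (simp add: truncate_simps composable_eq)
    have i: "balanced.ideal ?I"
      unfolding I span_ideal_iff[symmetric] using ab by (intro graph.span.ideal_pure) (simp_all add: truncate_simps)
    have "\<Squnion>{x \<cdot> y | x y. (x, y) \<in> ?I} = a \<cdot> b"
    proof (rule eq_iff_same_upper)
      fix c assume c: "c \<in> carrier Q"
      have "\<Squnion>{x \<cdot> y | x y. (x, y) \<in> ?I} \<sqsubseteq> c \<longleftrightarrow> ?I \<subseteq> mult_adj Q c" by (rule mult_adj_adjoint(2)[OF i c])
      also have "\<dots> \<longleftrightarrow> (a, b) \<in> mult_adj Q c"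
        unfolding I by (rule graph.span.pure_le) (simp add: span_ideal_iff mult_adj_ideal c)
      also have "\<dots> \<longleftrightarrow> a \<cdot> b \<sqsubseteq> c" using ab c by (simp add: mult_adj_eq)
      finally show "\<Squnion>{x \<cdot> y | x y. (x, y) \<in> ?I} \<sqsubseteq> c \<longleftrightarrow> a \<cdot> b \<sqsubseteq> c" .
    qed (use mult_adj_adjoint(1)[OF i] qmult_closed[OF ab] in simp_all)
    then show ?thesis using shriek_mult_adj[OF i] by simp
  qed
  then show ?thesis
    by (simp add: same_quantale_def quantale_of_def cat_of_simps truncate_simps shriek_ustar shriek_dstar
        shriek_rstar objects_top lam_closed rho_closed qunit_closed)
qed

end

section \<open>The quantale of an etale localic category\<close>

text \<open>The structure maps are separate parameters, so that lattice notation without an index refers to the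
  frame of arrows.\<close>

locale etale_category =
  fixes A :: "'a gorder" (structure) and Ob :: "'b gorder" and d r :: "'b \<Rightarrow> 'a" and u :: "'a \<Rightarrow> 'b"
    and m :: "'a \<Rightarrow> ('a \<times> 'a) set"
  assumes etale: "etale_localic_category
    \<lparr>arrows = A, objects = Ob, ustar = u, dstar = d, rstar = r, mstar = m\<rparr>"
begin

lemma category:
  "localic_category \<lparr>arrows = A, objects = Ob, ustar = u, dstar = d, rstar = r, mstar = m\<rparr>"
  using etale by (simp add: etale_localic_category_def)

sublocale reflexive_span A Ob d r u
  using category
  by (auto simp: localic_category_def locale_map_def reflexive_span_def reflexive_span_axioms_def)

lemma u_open: "open_map Ob A u" and d_etale: "etale_map A Ob d" and r_etale: "etale_map A Ob r"
  and m_open: "open_map span.P A m"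
  using etale by (simp_all add: etale_localic_category_def composable_def)

lemma m_map: "frame_map A span.P m"
  and p1_r: "z \<in> carrier Ob \<Longrightarrow> m (r z) = span.p1 (r z)"
  and p2_d: "z \<in> carrier Ob \<Longrightarrow> m (d z) = span.p2 (d z)"
  using category by (simp_all add: localic_category_def composable_def locale_map_def pi1_def pi2_def)

lemma m_span_ideal: "b \<in> carrier A \<Longrightarrow> span.ideal (m b)"
  using frame_mapD(1)[OF m_map, of b] by (simp add: span.P_T)

lemma semiopen: "semiopen_map Ob A u" "semiopen_map A Ob d" "semiopen_map A Ob r" "semiopen_map span.P A m"
  using u_open d_etale r_etale m_open by (simp_all add: etale_map_def open_map_def)

definition prod :: "'a \<Rightarrow> 'a \<Rightarrow> 'a" (infixl \<open>\<odot>\<close> 75) where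
  "x \<odot> y = shriek span.P A m (pure A A span.R x y)"

lemma pure_closed: "x \<in> carrier A \<Longrightarrow> y \<in> carrier A \<Longrightarrow> pure A A span.R x y \<in> carrier span.P"
  using span.ideal_pure[of x y] by (simp add: span.P_T)

lemma prod_closed: "x \<in> carrier A \<Longrightarrow> y \<in> carrier A \<Longrightarrow> x \<odot> y \<in> carrier A"
  unfolding prod_def using shriek_adj(2)[OF semiopen(4) pure_closed top_closed] .

lemma prod_le:
  assumes "b \<in> carrier A" "x \<in> carrier A" "y \<in> carrier A"
  shows "(x, y) \<in> m b \<longleftrightarrow> x \<odot> y \<sqsubseteq> b"
  using shriek_adj(1)[OF semiopen(4) pure_closed[OF assms(2,3)] assms(1)]
    span.pure_le[OF m_span_ideal[OF assms(1)], of x y]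
  by (simp add: prod_def span.P_T)

lemma m_frobenius:
  assumes "I \<in> carrier span.P" "b \<in> carrier A"
  shows "shriek span.P A m (I \<inter> m b) = shriek span.P A m I \<sqinter> b"
proof -
  have "span.ideal I" using assms(1) by (simp add: span.P_T)
  then have eq: "I \<sqinter>\<^bsub>span.P\<^esub> m b = I \<inter> m b"
    using span.meet_T[OF _ m_span_ideal[OF assms(2)]] by (simp add: span.P_T)
  have "shriek span.P A m (I \<sqinter>\<^bsub>span.P\<^esub> m b) = shriek span.P A m I \<sqinter> b"
    using m_open assms unfolding open_map_def by blast
  then show ?thesis unfolding eq .
qed

text \<open>The target of a composite is the target of its first factor, in the form \<open>m\<^sup>* r\<^sup>* = \<pi>\<^sub>1\<^sup>* r\<^sup>*\<close>; the Frobenius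
  law for \<open>m\<close> turns this into an equation for products.\<close>

lemma r_prod:
  assumes "z \<in> carrier Ob" "x \<in> carrier A" "y \<in> carrier A"
  shows "(r z \<sqinter> x) \<odot> y = r z \<sqinter> (x \<odot> y)"
proof -
  have "pure A A span.R (r z \<sqinter> x) y = pure A A span.R x y \<inter> m (r z)"
    using span.pure_inter[of x y "r z" \<top>] assms by (simp add: p1_r proj1_def meet_comm[of A x])
  then show ?thesis
    using m_frobenius[OF pure_closed[OF assms(2,3)] r_closed[OF assms(1)]]
    by (simp add: prod_def meet_comm[of A "r z"])
qed

lemma prod_d:
  assumes "x \<in> carrier A" "y \<in> carrier A" "z \<in> carrier Ob"
  shows "x \<odot> (y \<sqinter> d z) = (x \<odot> y) \<sqinter> d z"
proof -
  have "pure A A span.R x (y \<sqinter> d z) = pure A A span.R x y \<inter> m (d z)"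
    using span.pure_inter[of x y \<top> "d z"] assms by (simp add: p2_d proj2_def)
  then show ?thesis
    using m_frobenius[OF pure_closed[OF assms(1,2)] d_closed[OF assms(3)]] by (simp add: prod_def)
qed

sublocale span_multiplication A Ob d r u prod m
  by unfold_locales (simp_all add: prod_closed m_span_ideal prod_le r_prod prod_d)

lemma right_unit: "a \<in> carrier A \<Longrightarrow> \<Squnion>{x \<sqinter> d (u y) | x y. (x, y) \<in> m a} = a"
  using category right_unit_law_iff by (simp add: localic_category_def)

lemma left_unit: "a \<in> carrier A \<Longrightarrow> \<Squnion>{r (u x) \<sqinter> y | x y. (x, y) \<in> m a} = a"
  using category left_unit_law_iff by (simp add: localic_category_def)

lemma prod_assoc: "x \<in> carrier A \<Longrightarrow> y \<in> carrier A \<Longrightarrow> z \<in> carrier A \<Longrightarrow> (x \<odot> y) \<odot> z = x \<odot> (y \<odot> z)"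
  using category assoc_law_iff by (simp add: localic_category_def)

abbreviation "ush \<equiv> shriek Ob A u"
abbreviation "dsh \<equiv> shriek A Ob d"
abbreviation "rsh \<equiv> shriek A Ob r"

lemma ush_adj: "z \<in> carrier Ob \<Longrightarrow> a \<in> carrier A \<Longrightarrow> ush z \<sqsubseteq> a \<longleftrightarrow> z \<sqsubseteq>\<^bsub>Ob\<^esub> u a"
  by (rule shriek_adj(1)[OF semiopen(1)])

lemma dsh_adj: "a \<in> carrier A \<Longrightarrow> z \<in> carrier Ob \<Longrightarrow> dsh a \<sqsubseteq>\<^bsub>Ob\<^esub> z \<longleftrightarrow> a \<sqsubseteq> d z"
  by (rule shriek_adj(1)[OF semiopen(2)])

lemma rsh_adj: "a \<in> carrier A \<Longrightarrow> z \<in> carrier Ob \<Longrightarrow> rsh a \<sqsubseteq>\<^bsub>Ob\<^esub> z \<longleftrightarrow> a \<sqsubseteq> r z"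
  by (rule shriek_adj(1)[OF semiopen(3)])

lemma sh_closed [simp]:
  "z \<in> carrier Ob \<Longrightarrow> ush z \<in> carrier A" "a \<in> carrier A \<Longrightarrow> dsh a \<in> carrier Ob"
  "a \<in> carrier A \<Longrightarrow> rsh a \<in> carrier Ob"
  using shriek_adj(2)[OF semiopen(1) _ top_closed] shriek_adj(2)[OF semiopen(2) _ Ob.top_closed]
    shriek_adj(2)[OF semiopen(3) _ Ob.top_closed] by blast+

lemma ush_frobenius: "z \<in> carrier Ob \<Longrightarrow> a \<in> carrier A \<Longrightarrow> ush (z \<sqinter>\<^bsub>Ob\<^esub> u a) = ush z \<sqinter> a"
  using u_open by (simp add: open_map_def)

lemma dsh_frobenius: "a \<in> carrier A \<Longrightarrow> z \<in> carrier Ob \<Longrightarrow> dsh (a \<sqinter> d z) = dsh a \<sqinter>\<^bsub>Ob\<^esub> z"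
  using d_etale by (simp add: etale_map_def open_map_def)

lemma rsh_frobenius: "a \<in> carrier A \<Longrightarrow> z \<in> carrier Ob \<Longrightarrow> rsh (a \<sqinter> r z) = rsh a \<sqinter>\<^bsub>Ob\<^esub> z"
  using r_etale by (simp add: etale_map_def open_map_def)

lemma le_d_dsh: "a \<in> carrier A \<Longrightarrow> a \<sqsubseteq> d (dsh a)" and le_r_rsh: "a \<in> carrier A \<Longrightarrow> a \<sqsubseteq> r (rsh a)"
  by (simp_all add: dsh_adj[symmetric] rsh_adj[symmetric])

lemma ush_le_d: "z \<in> carrier Ob \<Longrightarrow> ush z \<sqsubseteq> d z" and ush_le_r: "z \<in> carrier Ob \<Longrightarrow> ush z \<sqsubseteq> r z"
  by (simp_all add: ush_adj u_d u_r)

text \<open>As a section of \<open>d\<close>, the map \<open>u\<close> is an embedding.\<close>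

lemma u_ush:
  assumes z: "z \<in> carrier Ob"
  shows "u (ush z) = z"
proof (rule Ob.le_antisym)
  show "z \<sqsubseteq>\<^bsub>Ob\<^esub> u (ush z)" using z by (simp add: ush_adj[symmetric])
  have "u (ush z) \<sqsubseteq>\<^bsub>Ob\<^esub> u (d z)"
    using z ush_le_d[OF z] by (intro frame_map_mono[OF frame_axioms Ob.frame_axioms u_map]) simp_all
  then show "u (ush z) \<sqsubseteq>\<^bsub>Ob\<^esub> z" using z by (simp add: u_d)
qed (use z in simp_all)

lemma dsh_ush: "z \<in> carrier Ob \<Longrightarrow> dsh (ush z) = z"
  by (rule Ob.eq_iff_same_upper) (simp_all add: dsh_adj ush_adj u_d)

lemma rsh_ush: "z \<in> carrier Ob \<Longrightarrow> rsh (ush z) = z"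
  by (rule Ob.eq_iff_same_upper) (simp_all add: rsh_adj ush_adj u_r)

text \<open>Multiplying by an open set of identities is restriction of the source. The unit law, which writes
  \<open>a\<close> as the join of the \<open>x \<sqinter> d (u y)\<close> with \<open>x \<odot> y \<sqsubseteq> a\<close>, gives both inequalities: one term of that join
  is \<open>a \<sqinter> d z\<close> when \<open>a\<close> is replaced by \<open>a \<odot> u\<^sub>! z\<close>, and every term is moved below \<open>x \<odot> y\<close> on
  multiplication by \<open>u\<^sub>! z\<close>.\<close>

lemma prod_ush:
  assumes a: "a \<in> carrier A" and z: "z \<in> carrier Ob"
  shows "a \<odot> ush z = a \<sqinter> d z"
proof (rule le_antisym)
  let ?X = "{x \<sqinter> d (u y) | x y. (x, y) \<in> m a}"
  have terms: "x \<sqinter> d (u y) \<in> carrier A" "(x \<sqinter> d (u y)) \<odot> ush z \<sqsubseteq> a" if xy: "(x, y) \<in> m a" for x y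
  proof -
    have c: "x \<in> carrier A" "y \<in> carrier A" using m_carrier[OF a xy] by blast+
    have le: "x \<odot> y \<sqsubseteq> a" using xy prod_le[OF a c] by blast
    show "x \<sqinter> d (u y) \<in> carrier A" using c by simp
    have "r (u y) \<sqinter> ush z = ush (z \<sqinter>\<^bsub>Ob\<^esub> u (r (u y)))"
      using c z by (simp add: ush_frobenius meet_comm[of A "r (u y)"])
    also have "\<dots> = ush z \<sqinter> y" using c z by (simp add: u_r ush_frobenius)
    also have "\<dots> \<sqsubseteq> y" using c z by (intro meet_right) simp_all
    finally have "x \<odot> (r (u y) \<sqinter> ush z) \<sqsubseteq> x \<odot> y" using c z by (intro mul_mono) simp_all
    then have "x \<odot> (r (u y) \<sqinter> ush z) \<sqsubseteq> a" by (rule le_trans[OF _ le]) (use c z a in simp_all)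
    then show "(x \<sqinter> d (u y)) \<odot> ush z \<sqsubseteq> a" using c z by (simp add: mul_balanced)
  qed
  then have X: "?X \<subseteq> carrier A" by blast
  have Y: "(\<lambda>x. x \<odot> ush z) ` ?X \<subseteq> carrier A" using X z by (intro image_subsetI mul_closed) auto
  have "\<Squnion>?X \<odot> ush z = \<Squnion>((\<lambda>x. x \<odot> ush z) ` ?X)" using X z by (intro mul_sup_left) simp_all
  also have "\<dots> \<sqsubseteq> a" using terms by (intro sup_least[OF Y a]) blast
  finally have le_a: "a \<odot> ush z \<sqsubseteq> a" unfolding right_unit[OF a] .
  have "a \<odot> ush z = (a \<odot> ush z) \<sqinter> d z"
    using a z mul_d[of a "ush z" z] meet_absorb1[of "ush z" "d z"] ush_le_d by simp
  also have "\<dots> \<sqsubseteq> a \<sqinter> d z" using a z le_a by (intro meet_mono) simp_all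
  finally show "a \<odot> ush z \<sqsubseteq> a \<sqinter> d z" .
  let ?b = "a \<odot> ush z"
  have b: "?b \<in> carrier A" using a z by simp
  have "(a, ush z) \<in> m ?b" using a z by (intro m_mul_mem) simp_all
  then have "a \<sqinter> d (u (ush z)) \<in> {x \<sqinter> d (u y) | x y. (x, y) \<in> m ?b}" by blast
  moreover have "{x \<sqinter> d (u y) | x y. (x, y) \<in> m ?b} \<subseteq> carrier A"
  proof clarify
    fix x y assume "(x, y) \<in> m ?b"
    from m_carrier[OF b this] show "x \<sqinter> d (u y) \<in> carrier A" by simp
  qed
  ultimately have "a \<sqinter> d (u (ush z)) \<sqsubseteq> \<Squnion>{x \<sqinter> d (u y) | x y. (x, y) \<in> m ?b}" by (intro sup_upper)
  then show "a \<sqinter> d z \<sqsubseteq> a \<odot> ush z" unfolding right_unit[OF b] u_ush[OF z] .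
qed (use a z in simp_all)

lemma ush_prod:
  assumes a: "a \<in> carrier A" and z: "z \<in> carrier Ob"
  shows "ush z \<odot> a = r z \<sqinter> a"
proof (rule le_antisym)
  let ?X = "{r (u x) \<sqinter> y | x y. (x, y) \<in> m a}"
  have terms: "r (u x) \<sqinter> y \<in> carrier A" "ush z \<odot> (r (u x) \<sqinter> y) \<sqsubseteq> a" if xy: "(x, y) \<in> m a" for x y
  proof -
    have c: "x \<in> carrier A" "y \<in> carrier A" using m_carrier[OF a xy] by blast+
    have le: "x \<odot> y \<sqsubseteq> a" using xy prod_le[OF a c] by blast
    show "r (u x) \<sqinter> y \<in> carrier A" using c by simp
    have "ush z \<sqinter> d (u x) = ush (z \<sqinter>\<^bsub>Ob\<^esub> u (d (u x)))"
      using c z by (simp add: ush_frobenius)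
    also have "\<dots> = ush z \<sqinter> x" using c z by (simp add: u_d ush_frobenius)
    also have "\<dots> \<sqsubseteq> x" using c z by (intro meet_right) simp_all
    finally have "(ush z \<sqinter> d (u x)) \<odot> y \<sqsubseteq> x \<odot> y" using c z by (intro mul_mono) simp_all
    then have "(ush z \<sqinter> d (u x)) \<odot> y \<sqsubseteq> a" by (rule le_trans[OF _ le]) (use c z a in simp_all)
    then show "ush z \<odot> (r (u x) \<sqinter> y) \<sqsubseteq> a" using c z by (simp add: mul_balanced)
  qed
  then have X: "?X \<subseteq> carrier A" by blast
  have Y: "(\<lambda>x. ush z \<odot> x) ` ?X \<subseteq> carrier A" using X z by (intro image_subsetI mul_closed) auto
  have "ush z \<odot> \<Squnion>?X = \<Squnion>((\<lambda>x. ush z \<odot> x) ` ?X)" using X z by (intro mul_sup_right) simp_all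
  also have "\<dots> \<sqsubseteq> a" using terms by (intro sup_least[OF Y a]) blast
  finally have le_a: "ush z \<odot> a \<sqsubseteq> a" unfolding left_unit[OF a] .
  have "ush z \<odot> a = r z \<sqinter> (ush z \<odot> a)"
    using a z r_mul[of z "ush z" a] meet_absorb2[of "r z" "ush z"] ush_le_r by simp
  also have "\<dots> \<sqsubseteq> r z \<sqinter> a" using a z le_a by (intro meet_mono) simp_all
  finally show "ush z \<odot> a \<sqsubseteq> r z \<sqinter> a" .
  let ?b = "ush z \<odot> a"
  have b: "?b \<in> carrier A" using a z by simp
  have "(ush z, a) \<in> m ?b" using a z by (intro m_mul_mem) simp_all
  then have "r (u (ush z)) \<sqinter> a \<in> {r (u x) \<sqinter> y | x y. (x, y) \<in> m ?b}" by blast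
  moreover have "{r (u x) \<sqinter> y | x y. (x, y) \<in> m ?b} \<subseteq> carrier A"
  proof clarify
    fix x y assume "(x, y) \<in> m ?b"
    from m_carrier[OF b this] show "r (u x) \<sqinter> y \<in> carrier A" by simp
  qed
  ultimately have "r (u (ush z)) \<sqinter> a \<sqsubseteq> \<Squnion>{r (u x) \<sqinter> y | x y. (x, y) \<in> m ?b}" by (intro sup_upper)
  then show "r z \<sqinter> a \<sqsubseteq> ush z \<odot> a" unfolding left_unit[OF b] u_ush[OF z] .
qed (use a z in simp_all)

text \<open>The direct image of \<open>x \<otimes> y\<close> along \<open>\<pi>\<^sub>2\<close> is \<open>r\<^sup>* (d\<^sub>! x) \<sqinter> y\<close>, and along \<open>\<pi>\<^sub>1\<close> it is \<open>x \<sqinter> d\<^sup>* (r\<^sub>! y)\<close>: this is the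
  Beck-Chevalley condition for the pullback square, used here on opens that come from the objects.
  Since \<open>m\<^sup>* d\<^sup>* = \<pi>\<^sub>2\<^sup>* d\<^sup>*\<close>, the opens below \<open>d\<^sup>* w\<close> are detected on \<open>\<pi>\<^sub>2\<close>. The set \<open>?K\<close> in the proof is the
  bi-ideal of all pairs whose direct image lies below \<open>d\<^sup>* w\<close>.\<close>

lemma prod_le_d_iff:
  assumes c: "x \<in> carrier A" "y \<in> carrier A" and w: "w \<in> carrier Ob"
  shows "x \<odot> y \<sqsubseteq> d w \<longleftrightarrow> r (dsh x) \<sqinter> y \<sqsubseteq> d w"
proof
  assume le: "r (dsh x) \<sqinter> y \<sqsubseteq> d w"
  have "x \<odot> y = (x \<sqinter> d (dsh x)) \<odot> y" using c meet_absorb1[OF c(1)] le_d_dsh by simp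
  also have "\<dots> = x \<odot> (r (dsh x) \<sqinter> y)" using c by (simp add: mul_balanced)
  also have "\<dots> = x \<odot> ((r (dsh x) \<sqinter> y) \<sqinter> d w)" using c w le by (simp add: meet_absorb1)
  also have "\<dots> = (x \<odot> (r (dsh x) \<sqinter> y)) \<sqinter> d w" using c w by (intro mul_d) simp_all
  also have "\<dots> \<sqsubseteq> d w" using c w by (intro meet_right) simp_all
  finally show "x \<odot> y \<sqsubseteq> d w" .
next
  let ?K = "{(x, y). x \<in> carrier A \<and> y \<in> carrier A \<and> r (dsh x) \<sqinter> y \<sqsubseteq> d w}"
  have K: "span.ideal ?K"
  proof (rule ideal_mul_le[where s = "\<top>"])
    show "r (dsh x) \<sqinter> y \<in> carrier A" if "x \<in> carrier A" "y \<in> carrier A" for x y using that by simp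
    show "r (dsh (\<Squnion>S)) \<sqinter> y = \<Squnion>((\<lambda>x. r (dsh x) \<sqinter> y) ` S)" if S: "S \<subseteq> carrier A" and y: "y \<in> carrier A" for S y
    proof -
      have c1: "dsh ` S \<subseteq> carrier Ob" and c2: "r ` dsh ` S \<subseteq> carrier A" using S by auto
      have "dsh (\<Squnion>S) = \<Squnion>\<^bsub>Ob\<^esub>(dsh ` S)"
        by (rule Ob.sup_eqI[symmetric])
          (use S c1 in \<open>auto simp: dsh_adj sup_le_iff subset_iff\<close>)
      then have "r (dsh (\<Squnion>S)) = \<Squnion>(r ` dsh ` S)" using frame_mapD(2)[OF r_map c1] by simp
      then show ?thesis using frame_distrib'[OF y c2] by (simp add: image_image)
    qed
    show "r (dsh x) \<sqinter> \<Squnion>S = \<Squnion>((\<lambda>y. r (dsh x) \<sqinter> y) ` S)" if "S \<subseteq> carrier A" "x \<in> carrier A" for S x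
      using that by (intro frame_distrib) simp_all
    show "r (dsh (x \<sqinter> d z)) \<sqinter> y = r (dsh x) \<sqinter> (r z \<sqinter> y)"
      if "x \<in> carrier A" "y \<in> carrier A" "z \<in> carrier Ob" for x y z
      using that by (simp add: dsh_frobenius frame_mapD(4)[OF r_map] meet_assoc)
  qed (use w in simp_all)
  assume "x \<odot> y \<sqsubseteq> d w"
  then have "(x, y) \<in> span.p2 (d w)" using prod_le[of "d w" x y] c w by (simp add: p2_d[symmetric])
  moreover have "span.p2 (d w) \<subseteq> ?K"
    unfolding proj2_def span.pure_le[OF K] using w by (simp add: meet_right)
  ultimately show "r (dsh x) \<sqinter> y \<sqsubseteq> d w" by blast
qed

lemma prod_le_r_iff:
  assumes c: "x \<in> carrier A" "y \<in> carrier A" and w: "w \<in> carrier Ob"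
  shows "x \<odot> y \<sqsubseteq> r w \<longleftrightarrow> x \<sqinter> d (rsh y) \<sqsubseteq> r w"
proof
  assume le: "x \<sqinter> d (rsh y) \<sqsubseteq> r w"
  have "x \<odot> y = x \<odot> (r (rsh y) \<sqinter> y)" using c meet_absorb2[of "r (rsh y)" y] le_r_rsh by simp
  also have "\<dots> = (x \<sqinter> d (rsh y)) \<odot> y" using c by (simp add: mul_balanced)
  also have "\<dots> = (r w \<sqinter> (x \<sqinter> d (rsh y))) \<odot> y" using c w le by (simp add: meet_absorb2)
  also have "\<dots> = r w \<sqinter> ((x \<sqinter> d (rsh y)) \<odot> y)" using c w by (intro r_mul) simp_all
  also have "\<dots> \<sqsubseteq> r w" using c w by (intro meet_left) simp_all
  finally show "x \<odot> y \<sqsubseteq> r w" .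
next
  let ?K = "{(x, y). x \<in> carrier A \<and> y \<in> carrier A \<and> x \<sqinter> d (rsh y) \<sqsubseteq> r w}"
  have K: "span.ideal ?K"
  proof (rule ideal_mul_le[where s = "\<top>"])
    show "x \<sqinter> d (rsh y) \<in> carrier A" if "x \<in> carrier A" "y \<in> carrier A" for x y using that by simp
    show "x \<sqinter> d (rsh (\<Squnion>S)) = \<Squnion>((\<lambda>y. x \<sqinter> d (rsh y)) ` S)" if S: "S \<subseteq> carrier A" and x: "x \<in> carrier A" for S x
    proof -
      have c1: "rsh ` S \<subseteq> carrier Ob" and c2: "d ` rsh ` S \<subseteq> carrier A" using S by auto
      have "rsh (\<Squnion>S) = \<Squnion>\<^bsub>Ob\<^esub>(rsh ` S)"
        by (rule Ob.sup_eqI[symmetric])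
          (use S c1 in \<open>auto simp: rsh_adj sup_le_iff subset_iff\<close>)
      then have "d (rsh (\<Squnion>S)) = \<Squnion>(d ` rsh ` S)" using frame_mapD(2)[OF d_map c1] by simp
      then show ?thesis using frame_distrib[OF x c2] by (simp add: image_image)
    qed
    show "\<Squnion>S \<sqinter> d (rsh y) = \<Squnion>((\<lambda>x. x \<sqinter> d (rsh y)) ` S)" if "S \<subseteq> carrier A" "y \<in> carrier A" for S y
      using that by (intro frame_distrib') simp_all
    show "(x \<sqinter> d z) \<sqinter> d (rsh y) = x \<sqinter> d (rsh (r z \<sqinter> y))"
      if "x \<in> carrier A" "y \<in> carrier A" "z \<in> carrier Ob" for x y z
      using that by (simp add: meet_comm[of A "r z"] rsh_frobenius meet_comm[of Ob "rsh y"] frame_mapD(4)[OF d_map] meet_assoc)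
  qed (use w in simp_all)
  assume "x \<odot> y \<sqsubseteq> r w"
  then have "(x, y) \<in> span.p1 (r w)" using prod_le[of "r w" x y] c w by (simp add: p1_r[symmetric])
  moreover have "span.p1 (r w) \<subseteq> ?K"
    unfolding proj1_def span.pure_le[OF K] using w by (simp add: meet_left)
  ultimately show "x \<sqinter> d (rsh y) \<sqsubseteq> r w" by blast
qed

subsection \<open>Supports and partial isometries\<close>

abbreviation unit :: 'a where "unit \<equiv> ush \<top>\<^bsub>Ob\<^esub>"

lemma ush_mono: "z \<in> carrier Ob \<Longrightarrow> w \<in> carrier Ob \<Longrightarrow> z \<sqsubseteq>\<^bsub>Ob\<^esub> w \<Longrightarrow> ush z \<sqsubseteq> ush w"
  by (simp add: ush_adj u_ush)

lemma ush_le_unit: "z \<in> carrier Ob \<Longrightarrow> ush z \<sqsubseteq> unit"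
  by (rule ush_mono) (simp_all add: Ob.top_higher)

lemma ush_u: "a \<in> carrier A \<Longrightarrow> ush (u a) = a \<sqinter> unit"
  using ush_frobenius[of "\<top>\<^bsub>Ob\<^esub>" a] by (simp add: meet_comm[of A a])

lemma below_unit: "a \<in> carrier A \<Longrightarrow> a \<sqsubseteq> unit \<Longrightarrow> ush (u a) = a"
  by (simp add: ush_u meet_absorb1)

lemma d_top: "d \<top>\<^bsub>Ob\<^esub> = \<top>" and r_top: "r \<top>\<^bsub>Ob\<^esub> = \<top>"
  by (rule frame_mapD(3)[OF d_map], rule frame_mapD(3)[OF r_map])

lemma prod_unit: "a \<in> carrier A \<Longrightarrow> a \<odot> unit = a" and unit_prod: "a \<in> carrier A \<Longrightarrow> unit \<odot> a = a"
  by (simp_all add: prod_ush ush_prod d_top r_top)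

lemma dsh_sup: "S \<subseteq> carrier A \<Longrightarrow> dsh (\<Squnion>S) = \<Squnion>\<^bsub>Ob\<^esub>(dsh ` S)"
  by (rule Ob.sup_eqI[symmetric]) (auto simp: dsh_adj sup_le_iff subset_iff)

lemma rsh_sup: "S \<subseteq> carrier A \<Longrightarrow> rsh (\<Squnion>S) = \<Squnion>\<^bsub>Ob\<^esub>(rsh ` S)"
  by (rule Ob.sup_eqI[symmetric]) (auto simp: rsh_adj sup_le_iff subset_iff)

lemma ush_sup: "S \<subseteq> carrier Ob \<Longrightarrow> ush (\<Squnion>\<^bsub>Ob\<^esub>S) = \<Squnion>(ush ` S)"
  by (rule sup_eqI[symmetric]) (auto simp: ush_adj Ob.sup_le_iff subset_iff)

lemma dsh_prod:
  assumes "x \<in> carrier A" "y \<in> carrier A"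
  shows "dsh (x \<odot> y) = dsh (ush (dsh x) \<odot> y)"
  by (rule Ob.eq_iff_same_upper) (use assms in \<open>simp_all add: dsh_adj prod_le_d_iff ush_prod\<close>)

lemma rsh_prod:
  assumes "x \<in> carrier A" "y \<in> carrier A"
  shows "rsh (x \<odot> y) = rsh (x \<odot> ush (rsh y))"
  by (rule Ob.eq_iff_same_upper) (use assms in \<open>simp_all add: rsh_adj prod_le_r_iff prod_ush\<close>)

text \<open>An open set of arrows is a partial isometry exactly when each of its open subsets is cut out both
  by its source and by its target, that is, when \<open>d\<close> and \<open>r\<close> restrict to embeddings of it into the
  objects.\<close>

definition d_thin :: "'a \<Rightarrow> bool" where
  "d_thin s \<longleftrightarrow> s \<in> carrier A \<and> (\<forall>c\<in>carrier A. c \<sqsubseteq> s \<longrightarrow> c = s \<sqinter> d (dsh c))"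

definition r_thin :: "'a \<Rightarrow> bool" where
  "r_thin s \<longleftrightarrow> s \<in> carrier A \<and> (\<forall>c\<in>carrier A. c \<sqsubseteq> s \<longrightarrow> c = r (rsh c) \<sqinter> s)"

lemma d_cut:
  assumes s: "s \<in> carrier A" and z: "z \<in> carrier Ob" and c: "c = s \<sqinter> d z"
  shows "c = s \<sqinter> d (dsh c)"
proof -
  have "s \<sqinter> d (dsh c) = (s \<sqinter> d (dsh s)) \<sqinter> d z"
    using s z by (simp add: c dsh_frobenius frame_mapD(4)[OF d_map] meet_assoc)
  then show ?thesis using s c meet_absorb1[OF s _ le_d_dsh[OF s]] by simp
qed

lemma r_cut:
  assumes s: "s \<in> carrier A" and z: "z \<in> carrier Ob" and c: "c = r z \<sqinter> s"
  shows "c = r (rsh c) \<sqinter> s"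
proof -
  have c': "c = s \<sqinter> r z" using c by (simp add: meet_comm[of A s])
  have "r (rsh c) \<sqinter> s = (s \<sqinter> r (rsh s)) \<sqinter> r z"
    using s z by (simp add: c' rsh_frobenius frame_mapD(4)[OF r_map] meet_assoc meet_comm[of A _ s])
  then show ?thesis using s c' meet_absorb1[OF s _ le_r_rsh[OF s]] by simp
qed

lemma d_thin_down:
  assumes s: "d_thin s" and t: "t \<in> carrier A" "t \<sqsubseteq> s"
  shows "d_thin t"
  unfolding d_thin_def
proof (intro conjI ballI impI t)
  fix c assume c: "c \<in> carrier A" "c \<sqsubseteq> t"
  have sc: "s \<in> carrier A" using s by (simp add: d_thin_def)
  have cs: "c \<sqsubseteq> s" by (rule le_trans[OF c(2) t(2) c(1) t(1) sc])
  have eq: "c = s \<sqinter> d (dsh c)" using s c(1) cs unfolding d_thin_def by blast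
  show "c = t \<sqinter> d (dsh c)"
  proof (rule le_antisym)
    show "c \<sqsubseteq> t \<sqinter> d (dsh c)" using c t le_d_dsh by (simp add: le_meet_iff)
    have "t \<sqinter> d (dsh c) \<sqsubseteq> s \<sqinter> d (dsh c)" using c t sc by (intro meet_mono) simp_all
    then show "t \<sqinter> d (dsh c) \<sqsubseteq> c" using eq by simp
  qed (use c t in simp_all)
qed

lemma r_thin_down:
  assumes s: "r_thin s" and t: "t \<in> carrier A" "t \<sqsubseteq> s"
  shows "r_thin t"
  unfolding r_thin_def
proof (intro conjI ballI impI t)
  fix c assume c: "c \<in> carrier A" "c \<sqsubseteq> t"
  have sc: "s \<in> carrier A" using s by (simp add: r_thin_def)
  have cs: "c \<sqsubseteq> s" by (rule le_trans[OF c(2) t(2) c(1) t(1) sc])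
  have eq: "c = r (rsh c) \<sqinter> s" using s c(1) cs unfolding r_thin_def by blast
  show "c = r (rsh c) \<sqinter> t"
  proof (rule le_antisym)
    show "c \<sqsubseteq> r (rsh c) \<sqinter> t" using c t le_r_rsh by (simp add: le_meet_iff)
    have "r (rsh c) \<sqinter> t \<sqsubseteq> r (rsh c) \<sqinter> s" using c t sc by (intro meet_mono) simp_all
    then show "r (rsh c) \<sqinter> t \<sqsubseteq> c" using eq by simp
  qed (use c t in simp_all)
qed

lemma d_thin_cover: "\<exists>B. B \<subseteq> carrier A \<and> \<Squnion>B = \<top> \<and> (\<forall>b\<in>B. d_thin b)"
proof -
  obtain B where B: "B \<subseteq> carrier A" "\<Squnion>B = \<top>"
    and surj: "\<forall>b\<in>B. (\<lambda>y. d y \<sqinter> b) ` carrier Ob = {a \<in> carrier A. a \<sqsubseteq> b}"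
    using d_etale unfolding etale_map_def by (elim conjE exE)
  have "d_thin b" if b: "b \<in> B" for b
    unfolding d_thin_def
  proof (intro conjI ballI impI)
    show bc: "b \<in> carrier A" using b B by blast
    fix c assume "c \<in> carrier A" "c \<sqsubseteq> b"
    then have "c \<in> (\<lambda>y. d y \<sqinter> b) ` carrier Ob" unfolding bspec[OF surj b] by (intro CollectI conjI)
    then obtain y where y: "y \<in> carrier Ob" "c = d y \<sqinter> b" by blast
    show "c = b \<sqinter> d (dsh c)" by (rule d_cut[OF bc y(1)]) (simp add: y(2) meet_comm[of A b])
  qed
  then show ?thesis using B by blast
qed

lemma r_thin_cover: "\<exists>B. B \<subseteq> carrier A \<and> \<Squnion>B = \<top> \<and> (\<forall>b\<in>B. r_thin b)"
proof -
  obtain B where B: "B \<subseteq> carrier A" "\<Squnion>B = \<top>"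
    and surj: "\<forall>b\<in>B. (\<lambda>y. r y \<sqinter> b) ` carrier Ob = {a \<in> carrier A. a \<sqsubseteq> b}"
    using r_etale unfolding etale_map_def by (elim conjE exE)
  have "r_thin b" if b: "b \<in> B" for b
    unfolding r_thin_def
  proof (intro conjI ballI impI)
    show bc: "b \<in> carrier A" using b B by blast
    fix c assume "c \<in> carrier A" "c \<sqsubseteq> b"
    then have "c \<in> (\<lambda>y. r y \<sqinter> b) ` carrier Ob" unfolding bspec[OF surj b] by (intro CollectI conjI)
    then obtain y where y: "y \<in> carrier Ob" "c = r y \<sqinter> b" by blast
    show "c = r (rsh c) \<sqinter> b" by (rule r_cut[OF bc y])
  qed
  then show ?thesis using B by blast
qed

text \<open>Thinness passes to smaller opens, so the meets of a cover for \<open>d\<close> with a cover for \<open>r\<close> are thin on both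
  sides.\<close>

lemma thin_cover: "\<exists>S. S \<subseteq> {s. d_thin s \<and> r_thin s} \<and> \<top> = \<Squnion>S"
proof -
  obtain B where B: "B \<subseteq> carrier A" "\<Squnion>B = \<top>" "\<And>b. b \<in> B \<Longrightarrow> d_thin b" using d_thin_cover by blast
  obtain B' where B': "B' \<subseteq> carrier A" "\<Squnion>B' = \<top>" "\<And>b. b \<in> B' \<Longrightarrow> r_thin b" using r_thin_cover by blast
  let ?S = "{b \<sqinter> b' | b b'. b \<in> B \<and> b' \<in> B'}"
  have S: "?S \<subseteq> carrier A" using B(1) B'(1) by fastforce
  have "d_thin (b \<sqinter> b') \<and> r_thin (b \<sqinter> b')" if "b \<in> B" "b' \<in> B'" for b b'
  proof -
    have c: "b \<in> carrier A" "b' \<in> carrier A" using that B B' by blast+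
    show ?thesis
      using d_thin_down[OF B(3)[OF that(1)] meet_closed[OF c] meet_left[OF c]]
        r_thin_down[OF B'(3)[OF that(2)] meet_closed[OF c] meet_right[OF c]] by blast
  qed
  then have thin: "?S \<subseteq> {s. d_thin s \<and> r_thin s}" by blast
  have "b \<sqsubseteq> \<Squnion>?S" if b: "b \<in> B" for b
  proof -
    have bc: "b \<in> carrier A" using b B by blast
    have X: "(\<lambda>b'. b \<sqinter> b') ` B' \<subseteq> carrier A" using bc B'(1) by (intro image_subsetI meet_closed) blast+
    have "b \<sqinter> \<Squnion>B' = b" unfolding B'(2) using bc by simp
    then have "b = \<Squnion>((\<lambda>b'. b \<sqinter> b') ` B')" using frame_distrib[OF bc B'(1)] by simp
    moreover have "x \<sqsubseteq> \<Squnion>?S" if "x \<in> (\<lambda>b'. b \<sqinter> b') ` B'" for x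
      using that b by (intro sup_upper[OF S]) blast
    then have "\<Squnion>((\<lambda>b'. b \<sqinter> b') ` B') \<sqsubseteq> \<Squnion>?S" by (intro sup_least[OF X sup_closed[OF S]])
    ultimately show ?thesis by simp
  qed
  then have "\<top> \<sqsubseteq> \<Squnion>?S" unfolding B(2)[symmetric] by (intro sup_least[OF B(1) sup_closed[OF S]])
  then have "\<top> = \<Squnion>?S" using S top_higher[OF sup_closed[OF S]] by (intro le_antisym) simp_all
  then show ?thesis using thin by blast
qed

text \<open>Since \<open>m\<close> is open, an open set below \<open>s \<odot> t\<close> is the join of the products \<open>x \<odot> y\<close> below it with
  \<open>x \<sqsubseteq> s\<close> and \<open>y \<sqsubseteq> t\<close>.\<close>

lemma sup_of_products:
  assumes s: "s \<in> carrier A" and t: "t \<in> carrier A" and c: "c \<in> carrier A" "c \<sqsubseteq> s \<odot> t"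
  shows "c = \<Squnion>{x \<odot> y | x y. x \<in> carrier A \<and> y \<in> carrier A \<and> x \<sqsubseteq> s \<and> y \<sqsubseteq> t \<and> x \<odot> y \<sqsubseteq> c}" (is "c = \<Squnion>?X")
proof (rule sup_eqI[symmetric])
  show X: "?X \<subseteq> carrier A" by auto
  fix b assume b: "b \<in> carrier A"
  let ?p = "pure A A span.R s t"
  have p: "span.ideal ?p" by (rule span.ideal_pure[OF s t])
  have pm: "?p \<inter> m c \<in> carrier span.P"
    using span.ideal_Int[OF p m_span_ideal[OF c(1)]] by (simp add: span.P_T)
  have "shriek span.P A m (?p \<inter> m c) = (s \<odot> t) \<sqinter> c"
    unfolding prod_def by (rule m_frobenius[OF pure_closed[OF s t] c(1)])
  also have "\<dots> = c" using meet_absorb2[OF _ c] s t by simp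
  finally have "c \<sqsubseteq> b \<longleftrightarrow> ?p \<inter> m c \<subseteq> m b"
    using shriek_adj(1)[OF semiopen(4) pm b] by (simp add: span.P_T)
  also have "\<dots> \<longleftrightarrow> (\<forall>(x, y)\<in>m c. (s \<sqinter> x, t \<sqinter> y) \<in> m b)"
    by (rule span.pure_Int_subset_iff[OF m_span_ideal[OF c(1)] m_span_ideal[OF b] s t])
  also have "\<dots> \<longleftrightarrow> (\<forall>x\<in>?X. x \<sqsubseteq> b)"
  proof
    assume h: "\<forall>(x, y)\<in>m c. (s \<sqinter> x, t \<sqinter> y) \<in> m b"
    show "\<forall>x\<in>?X. x \<sqsubseteq> b"
    proof clarify
      fix x y assume xy: "x \<in> carrier A" "y \<in> carrier A" "x \<sqsubseteq> s" "y \<sqsubseteq> t" "x \<odot> y \<sqsubseteq> c"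
      then have "(x, y) \<in> m c" using prod_le[OF c(1) xy(1,2)] by blast
      then have "(s \<sqinter> x, t \<sqinter> y) \<in> m b" using h by blast
      then have "(x, y) \<in> m b" using xy s t by (simp add: meet_absorb2)
      then show "x \<odot> y \<sqsubseteq> b" using prod_le[OF b xy(1,2)] by blast
    qed
  next
    assume h: "\<forall>x\<in>?X. x \<sqsubseteq> b"
    show "\<forall>(x, y)\<in>m c. (s \<sqinter> x, t \<sqinter> y) \<in> m b"
    proof clarify
      fix x y assume xy: "(x, y) \<in> m c"
      have xyc: "x \<in> carrier A" "y \<in> carrier A" using m_carrier[OF c(1) xy] by blast+
      have le: "x \<odot> y \<sqsubseteq> c" using prod_le[OF c(1) xyc] xy by blast
      have sx: "s \<sqinter> x \<in> carrier A" "s \<sqinter> x \<sqsubseteq> s" "s \<sqinter> x \<sqsubseteq> x"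
        using s xyc meet_left meet_right by simp_all
      have ty: "t \<sqinter> y \<in> carrier A" "t \<sqinter> y \<sqsubseteq> t" "t \<sqinter> y \<sqsubseteq> y"
        using t xyc meet_left meet_right by simp_all
      have "(s \<sqinter> x) \<odot> (t \<sqinter> y) \<sqsubseteq> x \<odot> y" by (rule mul_mono[OF sx(1) ty(1) xyc sx(3) ty(3)])
      then have "(s \<sqinter> x) \<odot> (t \<sqinter> y) \<sqsubseteq> c" by (rule le_trans[OF _ le]) (use sx ty xyc c in simp_all)
      then have "(s \<sqinter> x) \<odot> (t \<sqinter> y) \<in> ?X" using sx ty by blast
      then have "(s \<sqinter> x) \<odot> (t \<sqinter> y) \<sqsubseteq> b" using h by blast
      then show "(s \<sqinter> x, t \<sqinter> y) \<in> m b" using prod_le[OF b sx(1) ty(1)] by blast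
    qed
  qed
  finally show "c \<sqsubseteq> b \<longleftrightarrow> (\<forall>x\<in>?X. x \<sqsubseteq> b)" .
qed (rule c)

lemma d_cut_sup:
  assumes b: "b \<in> carrier A" and X: "X \<subseteq> carrier A" and cut: "\<And>x. x \<in> X \<Longrightarrow> x = b \<sqinter> d (dsh x)"
  shows "\<Squnion>X = b \<sqinter> d (dsh (\<Squnion>X))"
proof -
  have c: "dsh ` X \<subseteq> carrier Ob" "d ` dsh ` X \<subseteq> carrier A" using X by auto
  have "b \<sqinter> d (dsh (\<Squnion>X)) = \<Squnion>((\<lambda>a. b \<sqinter> a) ` d ` dsh ` X)"
    using frame_distrib[OF b c(2)] frame_mapD(2)[OF d_map c(1)] dsh_sup[OF X] by simp
  also have "(\<lambda>a. b \<sqinter> a) ` d ` dsh ` X = (\<lambda>x. x) ` X"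
    unfolding image_image using cut by (intro image_cong) simp_all
  finally show ?thesis by simp
qed

lemma r_cut_sup:
  assumes b: "b \<in> carrier A" and X: "X \<subseteq> carrier A" and cut: "\<And>x. x \<in> X \<Longrightarrow> x = r (rsh x) \<sqinter> b"
  shows "\<Squnion>X = r (rsh (\<Squnion>X)) \<sqinter> b"
proof -
  have c: "rsh ` X \<subseteq> carrier Ob" "r ` rsh ` X \<subseteq> carrier A" using X by auto
  have "r (rsh (\<Squnion>X)) \<sqinter> b = \<Squnion>((\<lambda>a. a \<sqinter> b) ` r ` rsh ` X)"
    using frame_distrib'[OF b c(2)] frame_mapD(2)[OF r_map c(1)] rsh_sup[OF X] by simp
  also have "(\<lambda>a. a \<sqinter> b) ` r ` rsh ` X = (\<lambda>x. x) ` X"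
    unfolding image_image using cut by (intro image_cong) simp_all
  finally show ?thesis by simp
qed

text \<open>For \<open>x \<sqsubseteq> s\<close> and \<open>y \<sqsubseteq> t\<close>, writing \<open>x = s \<sqinter> d z\<close> and moving \<open>d z\<close> across the product gives \<open>x \<odot> y = s \<odot> y'\<close> with
  \<open>y' = r z \<sqinter> y\<close>, and \<open>y'\<close> is cut out of \<open>t\<close> by its source, which is also the source of the product. Opens cut
  out in this way are closed under joins.\<close>

lemma d_thin_prod:
  assumes s: "d_thin s" and t: "d_thin t"
  shows "d_thin (s \<odot> t)"
  unfolding d_thin_def
proof (intro conjI ballI impI)
  have c: "s \<in> carrier A" "t \<in> carrier A" using s t by (simp_all add: d_thin_def)
  then show st: "s \<odot> t \<in> carrier A" by simp
  fix b assume b: "b \<in> carrier A" "b \<sqsubseteq> s \<odot> t"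
  let ?X = "{x \<odot> y | x y. x \<in> carrier A \<and> y \<in> carrier A \<and> x \<sqsubseteq> s \<and> y \<sqsubseteq> t \<and> x \<odot> y \<sqsubseteq> b}"
  have X: "?X \<subseteq> carrier A" by auto
  have "x \<odot> y = (s \<odot> t) \<sqinter> d (dsh (x \<odot> y))"
    if xy: "x \<in> carrier A" "y \<in> carrier A" "x \<sqsubseteq> s" "y \<sqsubseteq> t" for x y
  proof -
    let ?y = "r (dsh x) \<sqinter> y"
    have y: "?y \<in> carrier A" "?y \<sqsubseteq> y" using xy meet_right by simp_all
    have yt: "?y \<sqsubseteq> t" by (rule le_trans[OF y(2) xy(4) y(1) xy(2) c(2)])
    have ey: "?y = t \<sqinter> d (dsh ?y)" using t y yt unfolding d_thin_def by blast
    have ex: "x = s \<sqinter> d (dsh x)" using s xy unfolding d_thin_def by blast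
    have "(s \<sqinter> d (dsh x)) \<odot> y = s \<odot> ?y" using c xy by (intro mul_balanced) simp_all
    then have "x \<odot> y = s \<odot> ?y" using ex by simp
    also have "\<dots> = s \<odot> (t \<sqinter> d (dsh ?y))" using ey by simp
    also have "\<dots> = (s \<odot> t) \<sqinter> d (dsh ?y)" using c y by (intro mul_d) simp_all
    finally show ?thesis by (rule d_cut[OF st sh_closed(2)[OF y(1)]])
  qed
  then have "\<Squnion>?X = (s \<odot> t) \<sqinter> d (dsh (\<Squnion>?X))" by (intro d_cut_sup[OF st X]) blast
  then show "b = (s \<odot> t) \<sqinter> d (dsh b)" unfolding sup_of_products[OF c b, symmetric] .
qed

lemma r_thin_prod:
  assumes s: "r_thin s" and t: "r_thin t"
  shows "r_thin (s \<odot> t)"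
  unfolding r_thin_def
proof (intro conjI ballI impI)
  have c: "s \<in> carrier A" "t \<in> carrier A" using s t by (simp_all add: r_thin_def)
  then show st: "s \<odot> t \<in> carrier A" by simp
  fix b assume b: "b \<in> carrier A" "b \<sqsubseteq> s \<odot> t"
  let ?X = "{x \<odot> y | x y. x \<in> carrier A \<and> y \<in> carrier A \<and> x \<sqsubseteq> s \<and> y \<sqsubseteq> t \<and> x \<odot> y \<sqsubseteq> b}"
  have X: "?X \<subseteq> carrier A" by auto
  have "x \<odot> y = r (rsh (x \<odot> y)) \<sqinter> (s \<odot> t)"
    if xy: "x \<in> carrier A" "y \<in> carrier A" "x \<sqsubseteq> s" "y \<sqsubseteq> t" for x y
  proof -
    let ?x = "x \<sqinter> d (rsh y)"
    have x: "?x \<in> carrier A" "?x \<sqsubseteq> x" using xy meet_left by simp_all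
    have xs: "?x \<sqsubseteq> s" by (rule le_trans[OF x(2) xy(3) x(1) xy(1) c(1)])
    have ex: "?x = r (rsh ?x) \<sqinter> s" using s x xs unfolding r_thin_def by blast
    have ey: "y = r (rsh y) \<sqinter> t" using t xy unfolding r_thin_def by blast
    have "?x \<odot> t = x \<odot> (r (rsh y) \<sqinter> t)" using c xy by (intro mul_balanced) simp_all
    then have "x \<odot> y = ?x \<odot> t" using ey by simp
    also have "\<dots> = (r (rsh ?x) \<sqinter> s) \<odot> t" using ex by simp
    also have "\<dots> = r (rsh ?x) \<sqinter> (s \<odot> t)" using c x by (intro r_mul) simp_all
    finally show ?thesis by (rule r_cut[OF st sh_closed(3)[OF x(1)]])
  qed
  then have "\<Squnion>?X = r (rsh (\<Squnion>?X)) \<sqinter> (s \<odot> t)" by (intro r_cut_sup[OF st X]) blast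
  then show "b = r (rsh b) \<sqinter> (s \<odot> t)" unfolding sup_of_products[OF c b, symmetric] .
qed

abbreviation Q :: "'a equantale" where
  "Q \<equiv> quantale_of \<lparr>arrows = A, objects = Ob, ustar = u, dstar = d, rstar = r, mstar = m\<rparr>"

lemma Q_carrier [simp]: "carrier Q = carrier A" and Q_eq: "eq Q = eq A" and Q_le: "le Q = le A"
  and Q_unit: "\<e>\<^bsub>Q\<^esub> = unit" and Q_lam: "lam Q a = ush (dsh a)" and Q_rho: "rho Q a = ush (rsh a)"
  by (simp_all add: quantale_of_def)

lemma Q_mult: "x \<in> carrier A \<Longrightarrow> y \<in> carrier A \<Longrightarrow> x \<cdot>\<^bsub>Q\<^esub> y = x \<odot> y"
  using span.pure_eq_meet[of x y] by (simp add: quantale_of_def prod_def composable_def pi1_def pi2_def)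

lemmas Q_lattice = frame_transfer(2-4)[OF frame_axioms Q_carrier Q_eq Q_le]

lemma Q_frame: "frame Q"
  by (rule frame_transfer(1)[OF frame_axioms Q_carrier Q_eq Q_le])

lemma Q_unital: "unital_quantale Q"
proof -
  interpret Q: frame Q by (rule Q_frame)
  show ?thesis
  proof (intro unital_quantale.intro unital_quantale_axioms.intro Q.complete_lattice_axioms,
      unfold Q_lattice Q_carrier Q_unit)
    show "unit \<in> carrier A" by simp
    fix a assume a: "a \<in> carrier A"
    show "unit \<cdot>\<^bsub>Q\<^esub> a = a" "a \<cdot>\<^bsub>Q\<^esub> unit = a" using a by (simp_all add: Q_mult unit_prod prod_unit)
    fix S assume S: "S \<subseteq> carrier A"
    have im: "(\<lambda>s. a \<cdot>\<^bsub>Q\<^esub> s) ` S = (\<lambda>s. a \<odot> s) ` S" "(\<lambda>s. s \<cdot>\<^bsub>Q\<^esub> a) ` S = (\<lambda>s. s \<odot> a) ` S"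
      using S a by (auto intro!: image_cong Q_mult)
    show "a \<cdot>\<^bsub>Q\<^esub> \<Squnion>S = \<Squnion>((\<lambda>s. a \<cdot>\<^bsub>Q\<^esub> s) ` S)" "\<Squnion>S \<cdot>\<^bsub>Q\<^esub> a = \<Squnion>((\<lambda>s. s \<cdot>\<^bsub>Q\<^esub> a) ` S)"
      using a S by (simp_all add: im Q_mult mul_sup_right mul_sup_left)
  qed (simp_all add: Q_mult prod_assoc)
qed

lemma Q_ehresmann: "ehresmann_quantale Q"
proof -
  interpret Q: frame Q by (rule Q_frame)
  have ec: "unit \<in> carrier Q" by simp
  note down = complete_lattice_down[OF Q.complete_lattice_axioms ec]
  have sups: "preserves_sups Q (down Q unit) (\<lambda>a. ush (h a))"
    if h: "\<And>a. a \<in> carrier A \<Longrightarrow> h a \<in> carrier Ob"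
      and hs: "\<And>S. S \<subseteq> carrier A \<Longrightarrow> h (\<Squnion>S) = \<Squnion>\<^bsub>Ob\<^esub>(h ` S)" for h :: "'a \<Rightarrow> 'b"
  proof -
    have c: "ush (h a) \<in> carrier (down Q unit)" if "a \<in> carrier A" for a
      using h[OF that] ush_le_unit by (simp add: down_def Q_le)
    have "ush (h (\<Squnion>\<^bsub>Q\<^esub>S)) = \<Squnion>\<^bsub>down Q unit\<^esub>((\<lambda>a. ush (h a)) ` S)" if S: "S \<subseteq> carrier Q" for S
    proof -
      have "(\<lambda>a. ush (h a)) ` S \<subseteq> carrier (down Q unit)" using S c by (intro image_subsetI) auto
      moreover have "h ` S \<subseteq> carrier Ob" using S h by auto
      ultimately show ?thesis using S by (simp add: down(2) Q_lattice hs ush_sup image_image)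
    qed
    then show ?thesis
      using c down(1) Q.complete_lattice_axioms by (simp add: preserves_sups_def sup_pres_def)
  qed
  have lam: "lam Q = (\<lambda>a. ush (dsh a))" and rho: "rho Q = (\<lambda>a. ush (rsh a))"
    by (simp_all add: fun_eq_iff Q_lam Q_rho)
  show ?thesis
  proof (intro ehresmann_quantale.intro ehresmann_quantale_axioms.intro Q_unital,
      unfold Q_unit lam rho Q_carrier Q_le)
    show "preserves_sups Q (down Q unit) (\<lambda>a. ush (dsh a))" by (rule sups) (simp_all add: dsh_sup)
    show "preserves_sups Q (down Q unit) (\<lambda>a. ush (rsh a))" by (rule sups) (simp_all add: rsh_sup)
    fix a assume a: "a \<in> carrier A"
    show "a = ush (rsh a) \<cdot>\<^bsub>Q\<^esub> a" using a by (simp add: Q_mult ush_prod meet_absorb2 le_r_rsh)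
    show "a = a \<cdot>\<^bsub>Q\<^esub> ush (dsh a)" using a by (simp add: Q_mult prod_ush meet_absorb1 le_d_dsh)
    show "ush (dsh a) = a" if "a \<sqsubseteq> unit" using dsh_ush[of "u a"] below_unit[OF a that] a by simp
    show "ush (rsh a) = a" if "a \<sqsubseteq> unit" using rsh_ush[of "u a"] below_unit[OF a that] a by simp
    fix b assume b: "b \<in> carrier A"
    show "ush (dsh (a \<cdot>\<^bsub>Q\<^esub> b)) = ush (dsh (ush (dsh a) \<cdot>\<^bsub>Q\<^esub> b))"
      using a b dsh_prod[OF a b] by (simp add: Q_mult)
    show "ush (rsh (a \<cdot>\<^bsub>Q\<^esub> b)) = ush (rsh (a \<cdot>\<^bsub>Q\<^esub> ush (rsh b)))"
      using a b rsh_prod[OF a b] by (simp add: Q_mult)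
  qed
qed

text \<open>The witnesses of the natural order are opens \<open>u\<^sub>! z\<close>, and multiplication by them is restriction of the
  source or of the target.\<close>

lemma natural_le_iff:
  assumes a: "a \<in> carrier A" and b: "b \<in> carrier A"
  shows "natural_le Q a b \<longleftrightarrow> a = r (rsh a) \<sqinter> b \<and> a = b \<sqinter> d (dsh a)"
proof
  assume "natural_le Q a b"
  then obtain f g where f: "f \<in> carrier A" "f \<sqsubseteq> unit" and g: "g \<in> carrier A" "g \<sqsubseteq> unit"
    and eq: "a = g \<cdot>\<^bsub>Q\<^esub> b" "a = b \<cdot>\<^bsub>Q\<^esub> f"
    unfolding natural_le_def Q_carrier Q_le Q_unit by blast
  have "g \<odot> b = r (u g) \<sqinter> b" using ush_prod[OF b, of "u g"] below_unit[OF g] g by simp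
  then have 1: "a = r (u g) \<sqinter> b" using eq(1) Q_mult[OF g(1) b] by simp
  have "b \<odot> f = b \<sqinter> d (u f)" using prod_ush[OF b, of "u f"] below_unit[OF f] f by simp
  then have 2: "a = b \<sqinter> d (u f)" using eq(2) Q_mult[OF b f(1)] by simp
  show "a = r (rsh a) \<sqinter> b \<and> a = b \<sqinter> d (dsh a)"
    using r_cut[OF b _ 1] d_cut[OF b _ 2] f g by simp
next
  assume eq: "a = r (rsh a) \<sqinter> b \<and> a = b \<sqinter> d (dsh a)"
  have c: "ush (rsh a) \<in> carrier A" "ush (dsh a) \<in> carrier A" "ush (rsh a) \<sqsubseteq> unit" "ush (dsh a) \<sqsubseteq> unit"
    using a ush_le_unit by simp_all
  have "ush (rsh a) \<cdot>\<^bsub>Q\<^esub> b = r (rsh a) \<sqinter> b" "b \<cdot>\<^bsub>Q\<^esub> ush (dsh a) = b \<sqinter> d (dsh a)"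
    using a b c by (simp_all add: Q_mult prod_ush ush_prod)
  then have "a = ush (rsh a) \<cdot>\<^bsub>Q\<^esub> b" "a = b \<cdot>\<^bsub>Q\<^esub> ush (dsh a)" using eq by simp_all
  then show "natural_le Q a b" unfolding natural_le_def Q_carrier Q_le Q_unit using c by blast
qed

lemma partial_isometries_Q: "partial_isometries Q = {s. d_thin s \<and> r_thin s}"
proof (intro equalityI subsetI)
  fix s assume s: "s \<in> partial_isometries Q"
  then have sc: "s \<in> carrier A" by (simp add: partial_isometries_def)
  have "c = r (rsh c) \<sqinter> s \<and> c = s \<sqinter> d (dsh c)" if c: "c \<in> carrier A" "c \<sqsubseteq> s" for c
    using s c natural_le_iff[OF c(1) sc] by (simp add: partial_isometries_def Q_le)
  then show "s \<in> {s. d_thin s \<and> r_thin s}" using sc unfolding d_thin_def r_thin_def by blast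
next
  fix s assume s: "s \<in> {s. d_thin s \<and> r_thin s}"
  then have sc: "s \<in> carrier A" by (simp add: d_thin_def)
  have "natural_le Q c s" if c: "c \<in> carrier A" "c \<sqsubseteq> s" for c
    unfolding natural_le_iff[OF c(1) sc] using s c unfolding d_thin_def r_thin_def by blast
  then show "s \<in> partial_isometries Q" using sc by (simp add: partial_isometries_def Q_le)
qed

lemma Q_restriction: "restriction_quantal_frame Q"
proof (intro restriction_quantal_frame.intro ehresmann_quantal_frame.intro
    restriction_quantal_frame_axioms.intro Q_ehresmann Q_frame, unfold partial_isometries_Q Q_lattice)
  show "\<exists>S. S \<subseteq> {s. d_thin s \<and> r_thin s} \<and> \<top> = \<Squnion>S" by (rule thin_cover)
  fix a b assume ab: "a \<in> {s. d_thin s \<and> r_thin s}" "b \<in> {s. d_thin s \<and> r_thin s}"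
  then have "a \<in> carrier A" "b \<in> carrier A" by (simp_all add: d_thin_def)
  then show "a \<cdot>\<^bsub>Q\<^esub> b \<in> {s. d_thin s \<and> r_thin s}" using ab d_thin_prod r_thin_prod by (simp add: Q_mult)
qed

subsection \<open>Recovering the category\<close>

abbreviation C :: "('a, 'b) localic_data" where
  "C \<equiv> \<lparr>arrows = A, objects = Ob, ustar = u, dstar = d, rstar = r, mstar = m\<rparr>"

interpretation QQ: restriction_quantal_frame_plain Q
  by (rule restriction_quantal_frame_plain.intro[OF Q_restriction])

lemma truncate_Q: "gorder.truncate Q = A"
  by (simp add: gorder.truncate_def quantale_of_def)

lemma down_Q: "carrier (down Q unit) = {a \<in> carrier A. a \<sqsubseteq> unit}" "le (down Q unit) = le A"
  by (simp_all add: down_def Q_le)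

lemma dstar_Q: "x \<in> carrier (down Q unit) \<Longrightarrow> \<top> \<cdot>\<^bsub>Q\<^esub> x = d (u x)"
  using prod_ush[of \<top> "u x"] below_unit[of x] by (simp add: down_Q Q_mult)

lemma rstar_Q: "x \<in> carrier (down Q unit) \<Longrightarrow> x \<cdot>\<^bsub>Q\<^esub> \<top> = r (u x)"
  using ush_prod[of \<top> "u x"] below_unit[of x] by (simp add: down_Q Q_mult)

lemma ush_down: "z \<in> carrier Ob \<Longrightarrow> ush z \<in> carrier (down Q unit)"
  using ush_le_unit by (simp add: down_Q)

lemma u_down: "x \<in> carrier (down Q unit) \<Longrightarrow> u x \<in> carrier Ob"
  by (simp add: down_Q)

lemma ush_u_down: "x \<in> carrier (down Q unit) \<Longrightarrow> ush (u x) = x"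
  using below_unit by (simp add: down_Q)

text \<open>The object frame of \<open>\<C>(Q)\<close> is the image of \<open>u\<^sub>!\<close>, and its source and target maps agree with \<open>d\<close> and \<open>r\<close>
  along this bijection. So composable pairs are the same for both categories, and their
  projections need not be transported.\<close>

lemma pb_rel_Q: "pb_rel (down Q unit) A A (\<lambda>f. \<top> \<cdot>\<^bsub>Q\<^esub> f) (\<lambda>f. f \<cdot>\<^bsub>Q\<^esub> \<top>) = pb_rel Ob A A d r"
proof (intro equalityI subrelI)
  fix p q assume "(p, q) \<in> pb_rel (down Q unit) A A (\<lambda>f. \<top> \<cdot>\<^bsub>Q\<^esub> f) (\<lambda>f. f \<cdot>\<^bsub>Q\<^esub> \<top>)"
  then obtain x y c where c: "x \<in> carrier A" "y \<in> carrier A" "c \<in> carrier (down Q unit)"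
    and pq: "p = (x \<sqinter> (\<top> \<cdot>\<^bsub>Q\<^esub> c), y)" "q = (x, (c \<cdot>\<^bsub>Q\<^esub> \<top>) \<sqinter> y)"
    unfolding pb_rel_def by blast
  then show "(p, q) \<in> pb_rel Ob A A d r"
    using span.pb_relI[OF c(1,2) u_down[OF c(3)]] by (simp add: dstar_Q rstar_Q)
next
  fix p q assume "(p, q) \<in> pb_rel Ob A A d r"
  then obtain x y z where c: "x \<in> carrier A" "y \<in> carrier A" "z \<in> carrier Ob"
    and pq: "p = (x \<sqinter> d z, y)" "q = (x, r z \<sqinter> y)"
    unfolding pb_rel_def by blast
  have "p = (x \<sqinter> (\<top> \<cdot>\<^bsub>Q\<^esub> ush z), y)" "q = (x, (ush z \<cdot>\<^bsub>Q\<^esub> \<top>) \<sqinter> y)"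
    using pq c dstar_Q[OF ush_down] rstar_Q[OF ush_down] by (simp_all add: u_ush)
  then show "(p, q) \<in> pb_rel (down Q unit) A A (\<lambda>f. \<top> \<cdot>\<^bsub>Q\<^esub> f) (\<lambda>f. f \<cdot>\<^bsub>Q\<^esub> \<top>)"
    unfolding pb_rel_def using c ush_down[OF c(3)] by blast
qed

lemma cat_of_Q:
  "arrows (cat_of Q) = A" "objects (cat_of Q) = down Q unit" "ustar (cat_of Q) = (\<lambda>a. a \<sqinter> unit)"
  "dstar (cat_of Q) = (\<lambda>f. \<top> \<cdot>\<^bsub>Q\<^esub> f)" "rstar (cat_of Q) = (\<lambda>f. f \<cdot>\<^bsub>Q\<^esub> \<top>)"
  "mstar (cat_of Q) = mult_adj Q" "composable (cat_of Q) = span.P"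
  "pi1 (cat_of Q) = span.p1" "pi2 (cat_of Q) = span.p2"
proof -
  show s: "arrows (cat_of Q) = A" "objects (cat_of Q) = down Q unit" "ustar (cat_of Q) = (\<lambda>a. a \<sqinter> unit)"
    "dstar (cat_of Q) = (\<lambda>f. \<top> \<cdot>\<^bsub>Q\<^esub> f)" "rstar (cat_of Q) = (\<lambda>f. f \<cdot>\<^bsub>Q\<^esub> \<top>)"
    "mstar (cat_of Q) = mult_adj Q"
    by (simp_all add: cat_of_def truncate_Q Q_unit Q_lattice)
  show "composable (cat_of Q) = span.P" "pi1 (cat_of Q) = span.p1" "pi2 (cat_of Q) = span.p2"
    by (simp_all add: composable_def pi1_def pi2_def s pullback_def proj1_def proj2_def pb_rel_Q fun_eq_iff)
qed

lemma mult_adj_Q: "a \<in> carrier A \<Longrightarrow> mult_adj Q a = m a"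
  using QQ.mult_adj_eq[of a] m_eq[of a] by (auto simp: Q_le Q_mult)

lemma pairing_projections:
  assumes I: "span.ideal I"
  shows "pairing span.P span.p1 span.p2 I = I"
proof -
  have "{span.p1 x \<sqinter>\<^bsub>span.P\<^esub> span.p2 y | x y. (x, y) \<in> I} = {pure A A span.R x y | x y. (x, y) \<in> I}"
    using pair_image_cong[of I "\<lambda>x y. span.p1 x \<sqinter>\<^bsub>span.P\<^esub> span.p2 y" "\<lambda>I. I" "pure A A span.R"]
      span.pure_eq_meet span.ideal_carrier[OF I] by simp
  then show ?thesis using span.ideal_eq_sup_pure[OF I] by (simp add: pairing_def span.P_T)
qed

lemma isomorphic_cat_of_Q: "localic_isomorphic C (cat_of Q)"
proof -
  have frD: "frame (down Q unit)" using QQ.frame_objects by (simp add: Q_unit)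
  have um: "frame_map (down Q unit) Ob u"
  proof (rule frame_mapI[OF frD Ob.frame_axioms])
    note D = complete_lattice_down[OF QQ.complete_lattice_axioms QQ.qunit_closed, unfolded Q_unit]
    show "u a \<in> carrier Ob" if "a \<in> carrier (down Q unit)" for a using u_down[OF that] .
    show "u (\<Squnion>\<^bsub>down Q unit\<^esub>S) = \<Squnion>\<^bsub>Ob\<^esub>(u ` S)" if S: "S \<subseteq> carrier (down Q unit)" for S
    proof -
      have "S \<subseteq> carrier A" using S by (auto simp: down_Q)
      then show ?thesis using frame_mapD(2)[OF u_map] D(2)[OF S] by (simp add: Q_lattice)
    qed
    show "u \<top>\<^bsub>down Q unit\<^esub> = \<top>\<^bsub>Ob\<^esub>" by (simp add: D(4) u_ush)
    show "u (a \<sqinter>\<^bsub>down Q unit\<^esub> b) = u a \<sqinter>\<^bsub>Ob\<^esub> u b"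
      if "a \<in> carrier (down Q unit)" "b \<in> carrier (down Q unit)" for a b
      using that frame_mapD(4)[OF u_map, of a b] by (simp add: D(3) Q_lattice down_Q)
  qed
  have sm: "frame_map Ob (down Q unit) ush"
  proof (rule frame_mapI[OF Ob.frame_axioms frD])
    note D = complete_lattice_down[OF QQ.complete_lattice_axioms QQ.qunit_closed, unfolded Q_unit]
    show "ush z \<in> carrier (down Q unit)" if "z \<in> carrier Ob" for z by (rule ush_down[OF that])
    show "ush (\<Squnion>\<^bsub>Ob\<^esub>S) = \<Squnion>\<^bsub>down Q unit\<^esub>(ush ` S)" if S: "S \<subseteq> carrier Ob" for S
    proof -
      have "ush ` S \<subseteq> carrier (down Q unit)" using S ush_down by blast
      then show ?thesis using ush_sup[OF S] D(2) by (simp add: Q_lattice)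
    qed
    show "unit = \<top>\<^bsub>down Q unit\<^esub>" by (simp add: D(4))
    show "ush (z \<sqinter>\<^bsub>Ob\<^esub> w) = ush z \<sqinter>\<^bsub>down Q unit\<^esub> ush w" if "z \<in> carrier Ob" "w \<in> carrier Ob" for z w
      using that ush_frobenius[of z "ush w"] by (simp add: D(3) ush_down u_ush Q_lattice)
  qed
  have pairing_m: "pairing span.P span.p1 span.p2 (m a) = m a" if "a \<in> carrier A" for a
    by (rule pairing_projections[OF m_span_ideal[OF that]])
  have u_meet: "u (a \<sqinter> unit) = u a" if "a \<in> carrier A" for a
    using frame_mapD(4)[OF u_map that, of unit] that by (simp add: u_ush)
  have "localic_functor C (cat_of Q) id u"
    unfolding localic_functor_def
    using frame_axioms Ob.frame_axioms frD um frame_map_id[OF frame_axioms]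
    by (simp add: cat_of_Q locale_map_def u_meet dstar_Q rstar_Q mult_adj_Q pairing_m composable_def pi1_def pi2_def)
  moreover have "localic_functor (cat_of Q) C id ush"
    unfolding localic_functor_def
    using frame_axioms Ob.frame_axioms frD sm frame_map_id[OF frame_axioms]
    by (simp add: cat_of_Q locale_map_def ush_u dstar_Q[OF ush_down] rstar_Q[OF ush_down] u_ush mult_adj_Q pairing_m)
  ultimately show ?thesis
    unfolding localic_isomorphic_def
    by (intro exI[of _ id] exI[of _ u] exI[of _ ush] conjI) (simp_all add: cat_of_Q u_ush ush_u_down)
qed

end

theorem theorem1p3:
  shows "(\<forall>Q :: 'q equantale. restriction_quantal_frame Q \<longrightarrow>
            multiplicative Q \<and> etale_localic_category (cat_of Q)) \<and>
         (\<forall>C :: ('a, 'b) localic_data. etale_localic_category C \<longrightarrow>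
            restriction_quantal_frame (quantale_of C)) \<and>
         (\<forall>Q :: 'q equantale. restriction_quantal_frame Q \<longrightarrow>
            same_quantale Q (quantale_of (cat_of Q))) \<and>
         (\<forall>C :: ('a, 'b) localic_data. etale_localic_category C \<longrightarrow>
            localic_isomorphic C (cat_of (quantale_of C)))"
proof (intro conjI allI impI)
  fix Q :: "'q equantale"
  assume "restriction_quantal_frame Q"
  then interpret restriction_quantal_frame_plain Q by (rule restriction_quantal_frame_plain.intro)
  show "multiplicative Q" by (rule multiplicative)
  show "etale_localic_category (cat_of Q)" by (rule etale_cat_of)
  show "same_quantale Q (quantale_of (cat_of Q))" by (rule same_quantale_of_cat_of)
next
  fix C :: "('a, 'b) localic_data"
  assume etale: "etale_localic_category C"
  obtain A Ob u d r m where C: "C = \<lparr>arrows = A, objects = Ob, ustar = u, dstar = d, rstar = r, mstar = m\<rparr>"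
    by (cases C)
  interpret etale_category A Ob d r u m
    by (rule etale_category.intro) (use etale C in simp)
  show "restriction_quantal_frame (quantale_of C)" unfolding C by (rule Q_restriction)
  show "localic_isomorphic C (cat_of (quantale_of C))" unfolding C by (rule isomorphic_cat_of_Q)
qed

end
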